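(* Let $W$ be a graphon such that $W$ and $x\mapsto W(x,x)$ are Riemann integrable and $\int_{[0,1]^2}W(x,y)\,dx\,dy>0$. Let $\beta\in(0,1/\|W\|_{\mathrm{op}})$, and let $\theta_N\in(0,1)$ satisfy $N^{2/3}\theta_N\gtrsim1$ and $\theta_N\to0$. Let $G_N\sim G(N,\theta_N,W)$. Let $\mathscr F$ denote the collection of finite subsets of $\mathbb R$. Then for any sequence of estimates $\bar\beta_N$ (of the parameter of the Ising model on $G_N$), $$\sup_{I\in\mathscr F}\ \liminf_{N\to\infty}\ \sup_{h\in I}\ \frac{1}{\theta_N}\mathbb E_{\beta+h\sqrt{\theta_N}}\left[\left(\bar\beta_N-(\beta+h\sqrt{\theta_N})\right)^2\right]\ \ge\ \frac{2}{\int_{[0,1]^2}W(x,y)\,dx\,dy}.$$ Moreover, the estimate $$\tilde\beta_N:=-\frac{2N^2\theta_N^2}{\sum_{1\le i,j\le N}A_{G_N}(i,j)}H_N(\vec\sigma)$$ satisfies, for all $I\in\mathscr F$, as $N\to\infty$, $$\sup_{h\in I}\ \frac{1}{\theta_N}\mathbb E_{\beta+h\sqrt{\theta_N}}\left[\left(\tilde\beta_N-(\beta+h\sqrt{\theta_N})\right)^2\,\Big|\,A_{G_N}\right]\xrightarrow{P}\frac{2}{\int_{[0,1]^2}W(x,y)\,dx\,dy}.$$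
   Context: A graphon is a symmetric measurable function $W:[0,1]^2\to[0,1]$; $\|W\|_{\mathrm{op}}$ is the operator norm of $T_W:L^2[0,1]\to L^2[0,1]$, $(T_Wf)(x)=\int_0^1W(x,y)f(y)\,dy$. $G_N\sim G(N,\theta_N,W)$ is the random graph (self-loops allowed) on $\{1,\dots,N\}$ with symmetric adjacency matrix $A_{G_N}$ whose entries $A_{G_N}(i,j)$, $1\le i\le j\le N$, are independent Bernoulli with parameters $\theta_NW(\frac iN,\frac jN)$. For $\vec\sigma\in\{-1,1\}^N$, $H_N(\vec\sigma)=-\frac{1}{2N\theta_N}\sum_{1\le i,j\le N}A_{G_N}(i,j)\sigma_i\sigma_j$. Given $G_N$, the Ising model is $\mathbb P_b(\vec\sigma)=\frac{1}{2^NZ_N(b)}e^{-bH_N(\vec\sigma)}$ with $Z_N(b)=2^{-N}\sum_{\vec\sigma\in\{-1,1\}^N}e^{-bH_N(\vec\sigma)}$. The observed data are $(\vec\sigma,A_{G_N})$, and an estimate is a real-valued function of the data. $\mathbb E_b[\cdot]$ is expectation over the joint law of $(\vec\sigma,A_{G_N})$ when $\vec\sigma\sim\mathbb P_b$ given $G_N$; $\mathbb E_b[\cdot\,|\,A_{G_N}]$ is the conditional expectation given the graph, and $\xrightarrow{P}$ is convergence in probability with respect to the randomness of $G_N$. $a_N\gtrsim b_N$ means $a_N\ge Cb_N$ for some constant $C>0$ and all large $N$. *)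

theory Defs
  imports "HOL-Probability.Probability"
begin

section \<open>Riemann integrability and graphons\<close>

text \<open>
  Riemann's condition on a box \<^term>\<open>S\<close>: the definition of the gauge integral, with the gauge
  restricted to balls of one fixed radius.
\<close>
definition Riemann_integrable_on :: "('a::euclidean_space \<Rightarrow> real) \<Rightarrow> 'a set \<Rightarrow> bool"
  (infixr \<open>Riemann'_integrable'_on\<close> 46) where
  "f Riemann_integrable_on S \<longleftrightarrow>
    (\<exists>I. \<forall>e>0. \<exists>d>0. \<forall>D. D tagged_division_of S \<and> (\<lambda>x. ball x d) fine D \<longrightarrow>
      \<bar>(\<Sum>(x, K)\<in>D. measure lborel K * f x) - I\<bar> < e)"

text \<open>Values of \<open>W\<close> outside the unit square are irrelevant. Measurability is with respect to the
  Lebesgue sets, which is weaker than Borel measurability.\<close>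
definition graphon :: "(real \<Rightarrow> real \<Rightarrow> real) \<Rightarrow> bool" where
  "graphon W \<longleftrightarrow>
    (\<forall>x\<in>{0..1}. \<forall>y\<in>{0..1}. W x y \<in> {0..1} \<and> W x y = W y x) \<and>
    case_prod W \<in> borel_measurable (lebesgue_on ({0..1} \<times> {0..1}))"

definition graphon_integral :: "(real \<Rightarrow> real \<Rightarrow> real) \<Rightarrow> real" where
  "graphon_integral W = (LINT p|lebesgue_on ({0..1} \<times> {0..1}). case_prod W p)"

text \<open>The space \<open>L\<^sup>2[0,1]\<close> is represented by square-integrable functions rather than by classes modulo
  null sets; this does not affect the operator norm.\<close>
definition L2_fun :: "(real \<Rightarrow> real) set" where
  "L2_fun = {f \<in> borel_measurable (lebesgue_on {0..1}).
               integrable (lebesgue_on {0..1}) (\<lambda>x. (f x)\<^sup>2)}"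

definition L2_norm :: "(real \<Rightarrow> real) \<Rightarrow> real" where
  "L2_norm f = sqrt (LINT x|lebesgue_on {0..1}. (f x)\<^sup>2)"

definition graphon_op :: "(real \<Rightarrow> real \<Rightarrow> real) \<Rightarrow> (real \<Rightarrow> real) \<Rightarrow> (real \<Rightarrow> real)" where
  "graphon_op W f = (\<lambda>x. LINT y|lebesgue_on {0..1}. W x y * f y)"

definition graphon_op_norm :: "(real \<Rightarrow> real \<Rightarrow> real) \<Rightarrow> real" where
  "graphon_op_norm W = (SUP f\<in>{f \<in> L2_fun. L2_norm f \<le> 1}. L2_norm (graphon_op W f))"


section \<open>The random graph and the Ising model\<close>

text \<open>
  Law of the adjacency matrix of \<open>G(N, \<theta>, W)\<close>: independent Bernoulli variables indexed by the pairs
  \<open>1 \<le> i \<le> j \<le> N\<close>, extended symmetrically. Entries with an index outside \<open>{1..N}\<close> are \<open>0\<close>.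
\<close>
definition graph_pmf ::
    "nat \<Rightarrow> real \<Rightarrow> (real \<Rightarrow> real \<Rightarrow> real) \<Rightarrow> (nat \<Rightarrow> nat \<Rightarrow> real) pmf" where
  "graph_pmf N \<theta> W =
    map_pmf (\<lambda>\<omega> i j. of_bool (\<omega> (min i j, max i j)))
      (Pi_pmf {(i, j). 1 \<le> i \<and> i \<le> j \<and> j \<le> N} False
        (\<lambda>(i, j). bernoulli_pmf (\<theta> * W (real i / real N) (real j / real N))))"

definition spins :: "nat \<Rightarrow> (nat \<Rightarrow> real) set" where
  "spins N = {1..N} \<rightarrow>\<^sub>E {-1, 1}"

definition hamiltonian :: "nat \<Rightarrow> real \<Rightarrow> (nat \<Rightarrow> nat \<Rightarrow> real) \<Rightarrow> (nat \<Rightarrow> real) \<Rightarrow> real" where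
  "hamiltonian N \<theta> A \<sigma> =
    - (1 / (2 * real N * \<theta>)) * (\<Sum>i=1..N. \<Sum>j=1..N. A i j * \<sigma> i * \<sigma> j)"

definition partition_fun :: "nat \<Rightarrow> real \<Rightarrow> (nat \<Rightarrow> nat \<Rightarrow> real) \<Rightarrow> real \<Rightarrow> real" where
  "partition_fun N \<theta> A b = (1 / 2 ^ N) * (\<Sum>\<sigma>\<in>spins N. exp (- b * hamiltonian N \<theta> A \<sigma>))"

definition ising_prob :: "nat \<Rightarrow> real \<Rightarrow> (nat \<Rightarrow> nat \<Rightarrow> real) \<Rightarrow> real \<Rightarrow> (nat \<Rightarrow> real) \<Rightarrow> real" where
  "ising_prob N \<theta> A b \<sigma> =
    (if \<sigma> \<in> spins N
     then 1 / (2 ^ N * partition_fun N \<theta> A b) * exp (- b * hamiltonian N \<theta> A \<sigma>) else 0)"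

definition ising_pmf :: "nat \<Rightarrow> real \<Rightarrow> (nat \<Rightarrow> nat \<Rightarrow> real) \<Rightarrow> real \<Rightarrow> (nat \<Rightarrow> real) pmf" where
  "ising_pmf N \<theta> A b = embed_pmf (ising_prob N \<theta> A b)"

lemma finite_spins: "finite (spins N)"
  unfolding spins_def by (intro finite_PiE) auto

lemma spins_nonempty: "spins N \<noteq> {}"
  unfolding spins_def by (simp add: PiE_eq_empty_iff)

lemma partition_fun_pos: "partition_fun N \<theta> A b > 0"
  unfolding partition_fun_def
  by (intro mult_pos_pos sum_pos finite_spins spins_nonempty) auto

lemma pmf_ising: "pmf (ising_pmf N \<theta> A b) \<sigma> = ising_prob N \<theta> A b \<sigma>"
  unfolding ising_pmf_def
proof (rule pmf_embed_pmf)
  show nonneg: "0 \<le> ising_prob N \<theta> A b \<sigma>" for \<sigma>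
    using partition_fun_pos[of N \<theta> A b] by (auto simp: ising_prob_def)
  have "(\<integral>\<^sup>+\<sigma>. ennreal (ising_prob N \<theta> A b \<sigma>) \<partial>count_space UNIV)
      = (\<Sum>\<sigma>\<in>spins N. ennreal (ising_prob N \<theta> A b \<sigma>))"
    by (intro nn_integral_count_space') (auto simp: finite_spins ising_prob_def)
  also have "\<dots> = ennreal (\<Sum>\<sigma>\<in>spins N. ising_prob N \<theta> A b \<sigma>)"
    by (intro sum_ennreal nonneg)
  also have "(\<Sum>\<sigma>\<in>spins N. ising_prob N \<theta> A b \<sigma>)
      = 1 / (2 ^ N * partition_fun N \<theta> A b) * (\<Sum>\<sigma>\<in>spins N. exp (- b * hamiltonian N \<theta> A \<sigma>))"
    by (simp add: ising_prob_def sum_distrib_left)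
  also have "\<dots> = 1 / (2 ^ N * partition_fun N \<theta> A b) * (2 ^ N * partition_fun N \<theta> A b)"
    by (simp add: partition_fun_def)
  also have "\<dots> = 1"
    using partition_fun_pos[of N \<theta> A b] by simp
  finally show "(\<integral>\<^sup>+\<sigma>. ennreal (ising_prob N \<theta> A b \<sigma>) \<partial>count_space UNIV) = 1"
    by simp
qed

definition data_pmf ::
    "nat \<Rightarrow> real \<Rightarrow> (real \<Rightarrow> real \<Rightarrow> real) \<Rightarrow> real \<Rightarrow> ((nat \<Rightarrow> real) \<times> (nat \<Rightarrow> nat \<Rightarrow> real)) pmf" where
  "data_pmf N \<theta> W b = do {A \<leftarrow> graph_pmf N \<theta> W; \<sigma> \<leftarrow> ising_pmf N \<theta> A b; return_pmf (\<sigma>, A)}"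


section \<open>Estimates and their risk\<close>

type_synonym estimate = "(nat \<Rightarrow> real) \<times> (nat \<Rightarrow> nat \<Rightarrow> real) \<Rightarrow> real"

definition mse :: "nat \<Rightarrow> real \<Rightarrow> (real \<Rightarrow> real \<Rightarrow> real) \<Rightarrow> estimate \<Rightarrow> real \<Rightarrow> real" where
  "mse N \<theta> W T b = measure_pmf.expectation (data_pmf N \<theta> W b) (\<lambda>d. (T d - b)\<^sup>2)"

text \<open>Given the graph, the spins have law \<^const>\<open>ising_pmf\<close>; so the conditional expectation given the
  adjacency matrix is the following function of that matrix.\<close>
definition cond_mse :: "nat \<Rightarrow> real \<Rightarrow> (nat \<Rightarrow> nat \<Rightarrow> real) \<Rightarrow> estimate \<Rightarrow> real \<Rightarrow> real" where
  "cond_mse N \<theta> A T b = measure_pmf.expectation (ising_pmf N \<theta> A b) (\<lambda>\<sigma>. (T (\<sigma>, A) - b)\<^sup>2)"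

text \<open>On the edgeless graph the denominator vanishes and the value is \<open>0\<close>.\<close>
definition tilde_beta :: "nat \<Rightarrow> real \<Rightarrow> estimate" where
  "tilde_beta N \<theta> = (\<lambda>(\<sigma>, A).
    - (2 * (real N)\<^sup>2 * \<theta>\<^sup>2 / (\<Sum>i=1..N. \<Sum>j=1..N. A i j)) * hamiltonian N \<theta> A \<sigma>)"

text \<open>Convergence in probability to a constant, where the \<open>N\<close>-th variable lives on the \<open>N\<close>-th
  probability space.\<close>
definition tendsto_in_prob :: "(nat \<Rightarrow> 'a pmf) \<Rightarrow> (nat \<Rightarrow> 'a \<Rightarrow> real) \<Rightarrow> real \<Rightarrow> bool" where
  "tendsto_in_prob p X c \<longleftrightarrow>
    (\<forall>\<epsilon>>0. (\<lambda>N. measure_pmf.prob (p N) {\<omega>. \<bar>X N \<omega> - c\<bar> > \<epsilon>}) \<longlonglongrightarrow> 0)"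

end

theory Submission
  imports Defs "HOL-Real_Asymp.Real_Asymp"
begin

text \<open>
  Write \<open>Z(b)\<close> for the partition function, \<open>x = b / (N\<theta>)\<close> and \<open>t = tanh x\<close>. Since spins are signs,
  \<open>exp (x A\<^sub>i\<^sub>j \<sigma>\<^sub>i \<sigma>\<^sub>j) = cosh x \<cdot> (1 + t \<sigma>\<^sub>i \<sigma>\<^sub>j)\<close> on an edge, so \<open>Z(b)\<close> is an explicit exponential in the number of
  edges and loops times the reduced partition function, the spin average of \<open>\<Prod> (1 + t A\<^sub>i\<^sub>j \<sigma>\<^sub>i \<sigma>\<^sub>j)\<close>.
  
  The reduced partition function has no influence on the scale \<open>\<surd>\<theta>\<close>. Its expectation over the graph is the spin
  average of \<open>\<Prod> (1 + a\<^sub>i\<^sub>j \<sigma>\<^sub>i \<sigma>\<^sub>j)\<close> with \<open>a\<^sub>i\<^sub>j \<approx> b W(i/N, j/N) / N\<close>, a mean-field model whose coupling matrix has operator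
  norm close to \<open>b \<parallel>W\<parallel> < 1\<close>. In this regime exponential moments of the energy are bounded in \<open>N\<close>
  (\<open>spin_avg_exp_energy_le\<close>), and perturbing the couplings by \<open>o(1/N)\<close> changes the average by a factor \<open>1 + o(1)\<close>. The
  second moment of the reduced partition function is such a perturbation of the square of the first one: two replicas interact
  only through \<open>t\<^sup>2 \<theta> = O(1 / (N\<^sup>2 \<theta>))\<close>. Hence the reduced partition function is concentrated
  (\<open>reduced_Z_concentration\<close>), and its mean is asymptotically constant in \<open>b\<close> near \<open>\<beta>\<close> (\<open>mean_Z_ratio\<close>).
  
  The exponential prefactor is \<open>exp (b\<^sup>2 c / 2)\<close> with \<open>c = \<Sum> A\<^sub>i\<^sub>j / (2 N\<^sup>2 \<theta>\<^sup>2)\<close>, up to a contribution of the loops and a term of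
  order \<open>N\<^sup>2 \<theta> \<cdot> x\<^sup>4 \<approx> 1 / (N\<^sup>2 \<theta>\<^sup>3)\<close>, which is bounded because \<open>N\<^bsup>2/3\<^esup> \<theta>\<close> is bounded below. A law of large numbers gives
  \<open>\<theta> c \<longlongrightarrow> v = (\<integral> W) / 2\<close>. Altogether, for every real \<open>h\<close> and in probability over the graph,
  
  \<open>Z(\<beta> + h \<surd>\<theta>) / Z(\<beta>) \<cdot> exp (- \<beta> h \<surd>\<theta> c) \<longlongrightarrow> exp (h\<^sup>2 v / 2)\<close>,
  
  which is \<open>centered_Z_ratio_tendsto\<close>. Both halves of the theorem follow from this limit for finitely many \<open>h\<close>.
  
  The error of the estimate is \<open>Y / (\<surd>\<theta> c)\<close>, where \<open>Y\<close> is \<open>\<surd>\<theta>\<close> times the deviation of \<open>- H\<close> from \<open>b c\<close>. Ratios of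
  partition functions are Laplace transforms of \<open>Y\<close> given the graph; their Gaussian limit forces the second moment of \<open>Y\<close> to
  tend to \<open>v\<close>, so the rescaled risk tends to \<open>v / v\<^sup>2 = 2 / \<integral> W\<close>.
  
  For the lower bound a uniform prior is put on a finite grid of values of \<open>h\<close>. A finite-difference version of the van Trees
  inequality, valid on each fixed graph, bounds the average risk from below in terms of overlaps of the Ising laws at points
  of the grid and at their midpoints (\<open>average_cond_mse_ge\<close>). In an exponential family the overlaps are again ratios of
  partition functions, so the bound has an explicit limit; refining and lengthening the grid raises this limit to
  \<open>1 / v\<close>.
\<close>

section \<open>Spin averages\<close>

definition spin_avg :: "nat \<Rightarrow> ((nat \<Rightarrow> real) \<Rightarrow> real) \<Rightarrow> real" where
  "spin_avg N F = (1 / 2 ^ N) * (\<Sum>\<sigma>\<in>spins N. F \<sigma>)"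

definition edges :: "nat \<Rightarrow> (nat \<times> nat) set" where
  "edges N = {(i, j). 1 \<le> i \<and> i < j \<and> j \<le> N}"

definition pair_energy :: "nat \<Rightarrow> (nat \<Rightarrow> nat \<Rightarrow> real) \<Rightarrow> (nat \<Rightarrow> real) \<Rightarrow> real" where
  "pair_energy N M \<sigma> = (\<Sum>(i, j)\<in>edges N. M i j * \<sigma> i * \<sigma> j)"

lemma finite_edges: "finite (edges N)"
  by (rule finite_subset[of _ "{..N} \<times> {..N}"]) (auto simp: edges_def)

lemma edges_memD: "(i, j) \<in> edges N \<Longrightarrow> i \<in> {1..N} \<and> j \<in> {1..N} \<and> i < j"
  by (auto simp: edges_def)

lemma spins_apply: "\<sigma> \<in> spins N \<Longrightarrow> i \<in> {1..N} \<Longrightarrow> \<sigma> i = 1 \<or> \<sigma> i = -1"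
  by (auto simp: spins_def PiE_def Pi_def)

lemma spins_square: "\<sigma> \<in> spins N \<Longrightarrow> i \<in> {1..N} \<Longrightarrow> \<sigma> i * \<sigma> i = 1"
  using spins_apply[of \<sigma> N i] by auto

lemma spins_abs: "\<sigma> \<in> spins N \<Longrightarrow> i \<in> {1..N} \<Longrightarrow> \<bar>\<sigma> i\<bar> = 1"
  using spins_apply[of \<sigma> N i] by auto

lemma card_spins: "card (spins N) = 2 ^ N"
  unfolding spins_def by (subst card_PiE) (auto simp: numeral_2_eq_2)

lemma spin_avg_const [simp]: "spin_avg N (\<lambda>_. c) = c"
  by (simp add: spin_avg_def card_spins)

lemma spin_avg_mono: "(\<And>\<sigma>. \<sigma> \<in> spins N \<Longrightarrow> F \<sigma> \<le> G \<sigma>) \<Longrightarrow> spin_avg N F \<le> spin_avg N G"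
  by (simp add: spin_avg_def sum_mono divide_right_mono)

lemma spin_avg_cong: "(\<And>\<sigma>. \<sigma> \<in> spins N \<Longrightarrow> F \<sigma> = G \<sigma>) \<Longrightarrow> spin_avg N F = spin_avg N G"
  by (simp add: spin_avg_def cong: sum.cong)

lemma spin_avg_add: "spin_avg N (\<lambda>\<sigma>. F \<sigma> + G \<sigma>) = spin_avg N F + spin_avg N G"
  by (simp add: spin_avg_def sum.distrib add_divide_distrib)

lemma spin_avg_cmult: "spin_avg N (\<lambda>\<sigma>. c * F \<sigma>) = c * spin_avg N F"
  by (simp add: spin_avg_def sum_distrib_left)

lemma spin_avg_sum: "spin_avg N (\<lambda>\<sigma>. \<Sum>i\<in>I. F i \<sigma>) = (\<Sum>i\<in>I. spin_avg N (F i))"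
  unfolding spin_avg_def by (subst sum.swap) (simp add: sum_distrib_left)

lemma spin_avg_nonneg: "(\<And>\<sigma>. \<sigma> \<in> spins N \<Longrightarrow> 0 \<le> F \<sigma>) \<Longrightarrow> 0 \<le> spin_avg N F"
  by (simp add: spin_avg_def sum_nonneg)

lemma sum_full_eq_edges:
  fixes F :: "nat \<Rightarrow> nat \<Rightarrow> real"
  assumes "\<And>i j. i \<in> {1..N} \<Longrightarrow> j \<in> {1..N} \<Longrightarrow> F i j = F j i"
  shows "(\<Sum>i=1..N. \<Sum>j=1..N. F i j) = 2 * (\<Sum>(i, j)\<in>edges N. F i j) + (\<Sum>i=1..N. F i i)"
proof -
  define L where "L = {(j, i). (i, j) \<in> edges N}"
  define Dg where "Dg = (\<lambda>i. (i, i)) ` {1..N}"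
  have U: "{1..N} \<times> {1..N} = edges N \<union> (L \<union> Dg)"
    by (auto simp: edges_def L_def Dg_def)
  have fin: "finite L" "finite Dg"
    by (rule finite_subset[of _ "{..N} \<times> {..N}"]; auto simp: L_def Dg_def edges_def)+
  have "(\<Sum>i=1..N. \<Sum>j=1..N. F i j) = (\<Sum>(i, j)\<in>{1..N} \<times> {1..N}. F i j)"
    by (simp add: sum.cartesian_product)
  also have "\<dots> = (\<Sum>(i, j)\<in>edges N. F i j) + ((\<Sum>(i, j)\<in>L. F i j) + (\<Sum>(i, j)\<in>Dg. F i j))"
  proof -
    have d: "edges N \<inter> (L \<union> Dg) = {}" "L \<inter> Dg = {}"
      by (auto simp: edges_def L_def Dg_def)
    show ?thesis
      unfolding U sum.union_disjoint[OF finite_edges finite_UnI[OF fin] d(1)]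
        sum.union_disjoint[OF fin d(2)] by (rule refl)
  qed
  also have "(\<Sum>(i, j)\<in>L. F i j) = (\<Sum>(i, j)\<in>edges N. F i j)"
    by (rule sum.reindex_bij_witness[of _ "\<lambda>(i, j). (j, i)" "\<lambda>(i, j). (j, i)"])
       (auto simp: L_def assms dest: edges_memD)
  also have "(\<Sum>(i, j)\<in>Dg. F i j) = (\<Sum>i=1..N. F i i)"
    unfolding Dg_def by (subst sum.reindex) (auto simp: inj_on_def)
  finally show ?thesis by simp
qed

lemma card_edges_le: "real (card (edges N)) \<le> (real N)\<^sup>2 / 2"
proof -
  have "(\<Sum>i=1..N. \<Sum>j=1..N. 1::real) = 2 * (\<Sum>(i, j)\<in>edges N. 1) + (\<Sum>i=1..N. 1)"
    by (rule sum_full_eq_edges) simp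
  thus ?thesis by (simp add: power2_eq_square split_def)
qed

lemma sum_edges_bound:
  assumes "\<And>i j. (i, j) \<in> edges N \<Longrightarrow> f i j \<le> c" "0 \<le> (c::real)"
  shows "(\<Sum>(i, j)\<in>edges N. f i j) \<le> (real N)\<^sup>2 / 2 * c"
proof -
  have "(\<Sum>(i, j)\<in>edges N. f i j) \<le> (\<Sum>(i, j)\<in>edges N. c)"
    by (rule sum_mono) (use assms in auto)
  also have "\<dots> = real (card (edges N)) * c" by (simp add: split_def)
  also have "\<dots> \<le> (real N)\<^sup>2 / 2 * c" using card_edges_le assms(2) by (rule mult_right_mono)
  finally show ?thesis .
qed

subsection \<open>Flipping one spin\<close>

definition flip_spin :: "nat \<Rightarrow> (nat \<Rightarrow> real) \<Rightarrow> nat \<Rightarrow> real" where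
  "flip_spin i \<sigma> = \<sigma>(i := - \<sigma> i)"

lemma flip_spin_simps [simp]:
  "flip_spin i \<sigma> i = - \<sigma> i" "j \<noteq> i \<Longrightarrow> flip_spin i \<sigma> j = \<sigma> j"
  by (auto simp: flip_spin_def)

lemma flip_spin_flip_spin [simp]: "flip_spin i (flip_spin i \<sigma>) = \<sigma>"
  by (simp add: flip_spin_def)

lemma flip_spin_spins: "i \<in> {1..N} \<Longrightarrow> \<sigma> \<in> spins N \<Longrightarrow> flip_spin i \<sigma> \<in> spins N"
  unfolding spins_def flip_spin_def PiE_def Pi_def extensional_def by fastforce

lemma spin_avg_flip:
  assumes "i \<in> {1..N}"
  shows "spin_avg N (\<lambda>\<sigma>. F (flip_spin i \<sigma>)) = spin_avg N F"
proof -
  have "(\<Sum>\<sigma>\<in>spins N. F (flip_spin i \<sigma>)) = (\<Sum>\<sigma>\<in>spins N. F \<sigma>)"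
    by (rule sum.reindex_bij_witness[of _ "flip_spin i" "flip_spin i"])
       (auto simp: flip_spin_spins[OF assms])
  thus ?thesis by (simp add: spin_avg_def)
qed

lemma spin_avg_mult_spins:
  assumes "\<tau> \<in> spins N"
  shows "spin_avg N (\<lambda>\<sigma>. F (\<lambda>i\<in>{1..N}. \<sigma> i * \<tau> i)) = spin_avg N F"
proof -
  define g where "g = (\<lambda>\<sigma>::nat\<Rightarrow>real. \<lambda>i\<in>{1..N}. \<sigma> i * \<tau> i)"
  have g1: "g \<sigma> \<in> spins N" if "\<sigma> \<in> spins N" for \<sigma>
    using that spins_apply[OF assms] spins_apply[OF that]
    unfolding spins_def g_def by (intro restrict_PiE_iff[THEN iffD2]) fastforce
  have g2: "g (g \<sigma>) = \<sigma>" if "\<sigma> \<in> spins N" for \<sigma>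
  proof
    fix i show "g (g \<sigma>) i = \<sigma> i"
      using spins_square[OF assms, of i] that
      by (cases "i \<in> {1..N}") (auto simp: g_def mult.assoc spins_def PiE_def extensional_def)
  qed
  have "(\<Sum>\<sigma>\<in>spins N. F (g \<sigma>)) = (\<Sum>\<sigma>\<in>spins N. F \<sigma>)"
    by (rule sum.reindex_bij_witness[of _ g g]) (auto simp: g1 g2)
  thus ?thesis by (simp add: spin_avg_def g_def)
qed

lemma spin_avg_pair_energy: "spin_avg N (pair_energy N M) = 0"
proof -
  have *: "spin_avg N (\<lambda>\<sigma>. M i j * \<sigma> i * \<sigma> j) = 0" if "(i, j) \<in> edges N" for i j
  proof -
    have ij: "i \<in> {1..N}" "j \<noteq> i" using that by (auto simp: edges_def)
    have "spin_avg N (\<lambda>\<sigma>. M i j * \<sigma> i * \<sigma> j) = spin_avg N (\<lambda>\<sigma>. M i j * flip_spin i \<sigma> i * flip_spin i \<sigma> j)"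
      using spin_avg_flip[OF ij(1), of "\<lambda>\<sigma>. M i j * \<sigma> i * \<sigma> j"] by simp
    also have "\<dots> = - spin_avg N (\<lambda>\<sigma>. M i j * \<sigma> i * \<sigma> j)"
      using ij spin_avg_cmult[of N "-1" "\<lambda>\<sigma>. M i j * \<sigma> i * \<sigma> j"] by simp
    finally show ?thesis by simp
  qed
  have "spin_avg N (pair_energy N M) = (\<Sum>p\<in>edges N. spin_avg N (\<lambda>\<sigma>. M (fst p) (snd p) * \<sigma> (fst p) * \<sigma> (snd p)))"
    unfolding pair_energy_def split_def by (rule spin_avg_sum)
  also have "\<dots> = 0" by (rule sum.neutral) (use * in auto)
  finally show ?thesis .
qed

subsection \<open>Exponential moments of the pair energy at high temperature\<close>

text \<open>
  This is \<open>\<bar>tanh y\<bar> \<le> \<bar>y\<bar>\<close> without denominators.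
\<close>
lemma sinh_le_mult_cosh: "\<bar>exp y - exp (- y)\<bar> \<le> \<bar>y\<bar> * (exp y + exp (- y))" for y :: real
proof -
  have pos: "exp y - exp (-y) \<le> y * (exp y + exp (-y))" if "y \<ge> 0" for y :: real
  proof -
    define f where "f = (\<lambda>y::real. y * (exp y + exp (-y)) - (exp y - exp (-y)))"
    have "f 0 \<le> f y"
    proof (rule DERIV_nonneg_imp_nondecreasing[OF that])
      fix x :: real assume "0 \<le> x" "x \<le> y"
      have "(f has_real_derivative x * (exp x - exp (-x))) (at x)"
        unfolding f_def by (auto intro!: derivative_eq_intros simp: algebra_simps)
      moreover have "x * (exp x - exp (-x)) \<ge> 0" using \<open>0 \<le> x\<close> by simp
      ultimately show "\<exists>d. (f has_real_derivative d) (at x) \<and> d \<ge> 0" by blast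
    qed
    thus ?thesis by (simp add: f_def)
  qed
  show ?thesis
    using pos[of y] pos[of "-y"] by (cases "y \<ge> 0") (auto simp: abs_if algebra_simps)
qed

text \<open>
  Averaging over \<open>\<sigma>\<^sub>i\<close> alone replaces it by \<open>tanh (s m)\<close>, because the weight depends on this spin only through the local
  field \<open>m\<close>; and \<open>\<bar>tanh (s m)\<bar> \<le> s \<bar>m\<bar>\<close>.
\<close>
lemma spin_avg_single_spin_le:
  assumes i: "i \<in> {1..N}"
    and e: "\<And>\<sigma>. e \<sigma> = \<sigma> i * m \<sigma> + r \<sigma>"
    and m: "\<And>\<sigma>. m (flip_spin i \<sigma>) = m \<sigma>" and r: "\<And>\<sigma>. r (flip_spin i \<sigma>) = r \<sigma>"
    and g: "\<And>\<sigma>. g (flip_spin i \<sigma>) = g \<sigma>"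
    and s: "0 \<le> s"
  shows "spin_avg N (\<lambda>\<sigma>. exp (s * e \<sigma>) * (\<sigma> i * g \<sigma>)) \<le> s * spin_avg N (\<lambda>\<sigma>. exp (s * e \<sigma>) * (\<bar>m \<sigma>\<bar> * \<bar>g \<sigma>\<bar>))"
proof -
  have sym: "2 * spin_avg N F = spin_avg N (\<lambda>\<sigma>. F \<sigma> + F (flip_spin i \<sigma>))" for F
    by (simp add: spin_avg_add spin_avg_flip[OF i])
  have "2 * spin_avg N (\<lambda>\<sigma>. exp (s * e \<sigma>) * (\<sigma> i * g \<sigma>))
     \<le> 2 * spin_avg N (\<lambda>\<sigma>. s * (exp (s * e \<sigma>) * (\<bar>m \<sigma>\<bar> * \<bar>g \<sigma>\<bar>)))"
    unfolding sym
  proof (rule spin_avg_mono)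
    fix \<sigma> assume \<sigma>: "\<sigma> \<in> spins N"
    define y where "y = s * m \<sigma>"
    have E: "exp (s * e \<sigma>) = exp (s * r \<sigma>) * exp (\<sigma> i * y)"
            "exp (s * e (flip_spin i \<sigma>)) = exp (s * r \<sigma>) * exp (- (\<sigma> i * y))"
      by (simp_all add: e m r y_def exp_add[symmetric] algebra_simps)
    have "\<sigma> i * g \<sigma> * (exp (\<sigma> i * y) - exp (- (\<sigma> i * y))) \<le> \<bar>y\<bar> * \<bar>g \<sigma>\<bar> * (exp (\<sigma> i * y) + exp (- (\<sigma> i * y)))"
    proof -
      have "\<sigma> i * g \<sigma> * (exp (\<sigma> i * y) - exp (- (\<sigma> i * y))) \<le> \<bar>\<sigma> i * g \<sigma>\<bar> * \<bar>exp (\<sigma> i * y) - exp (- (\<sigma> i * y))\<bar>"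
        using abs_ge_self[of "\<sigma> i * g \<sigma> * (exp (\<sigma> i * y) - exp (- (\<sigma> i * y)))"] by (simp add: abs_mult)
      also have "\<dots> \<le> \<bar>\<sigma> i * g \<sigma>\<bar> * (\<bar>\<sigma> i * y\<bar> * (exp (\<sigma> i * y) + exp (- (\<sigma> i * y))))"
        by (intro mult_left_mono sinh_le_mult_cosh) auto
      finally show ?thesis using spins_abs[OF \<sigma> i] by (simp add: abs_mult mult_ac)
    qed
    hence "exp (s * r \<sigma>) * (\<sigma> i * g \<sigma> * (exp (\<sigma> i * y) - exp (- (\<sigma> i * y))))
       \<le> exp (s * r \<sigma>) * (\<bar>y\<bar> * \<bar>g \<sigma>\<bar> * (exp (\<sigma> i * y) + exp (- (\<sigma> i * y))))"
      by (intro mult_left_mono) auto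
    moreover have "\<bar>y\<bar> = s * \<bar>m \<sigma>\<bar>" using s by (simp add: y_def abs_mult)
    ultimately show "exp (s * e \<sigma>) * (\<sigma> i * g \<sigma>) + exp (s * e (flip_spin i \<sigma>)) * (flip_spin i \<sigma> i * g (flip_spin i \<sigma>))
         \<le> s * (exp (s * e \<sigma>) * (\<bar>m \<sigma>\<bar> * \<bar>g \<sigma>\<bar>)) + s * (exp (s * e (flip_spin i \<sigma>)) * (\<bar>m (flip_spin i \<sigma>)\<bar> * \<bar>g (flip_spin i \<sigma>)\<bar>))"
      unfolding E by (simp add: g m algebra_simps)
  qed
  thus ?thesis by (simp add: spin_avg_cmult)
qed

text \<open>
  Let \<open>m = M \<sigma>\<close> be the vector of local fields, and let \<open>V\<close> be the average of \<open>\<bar>m\<bar>\<^sup>2\<close> under the Gibbs weight. Integrating out one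
  spin at a time bounds twice the mean energy \<open>\<Sum> \<sigma>\<^sub>i m\<^sub>i\<close> by \<open>V\<close>. The same device applied to \<open>\<bar>m\<bar>\<^sup>2 = \<sigma> \<cdot> M\<^sup>2 \<sigma>\<close> gives
  \<open>V \<le> B\<^sup>2 + B\<^sup>3 + \<rho> V\<close>: the diagonal of \<open>M\<^sup>2\<close> contributes at most \<open>B\<^sup>2\<close>, its off-diagonal part at most \<open>\<bar>m\<bar> \<bar>M m\<bar> \<le> \<rho> \<bar>m\<bar>\<^sup>2\<close>, and
  \<open>B\<^sup>3\<close> pays for removing the diagonal term from \<open>M m\<close>. As \<open>\<rho> < 1\<close>, this bounds \<open>V\<close>.
\<close>
lemma spin_avg_energy_le:
  fixes M :: "nat \<Rightarrow> nat \<Rightarrow> real"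
  assumes N: "N \<ge> 1"
    and sym: "\<And>i j. i \<in> {1..N} \<Longrightarrow> j \<in> {1..N} \<Longrightarrow> M i j = M j i"
    and diag: "\<And>i. i \<in> {1..N} \<Longrightarrow> M i i = 0"
    and bd: "\<And>i j. i \<in> {1..N} \<Longrightarrow> j \<in> {1..N} \<Longrightarrow> \<bar>M i j\<bar> \<le> B / real N"
    and op: "\<And>u. (\<Sum>i=1..N. (\<Sum>j=1..N. M i j * u j)\<^sup>2) \<le> \<rho>\<^sup>2 * (\<Sum>i=1..N. (u i)\<^sup>2)"
    and \<rho>: "0 < \<rho>" "\<rho> < 1" and s: "0 \<le> s" "s \<le> 1"
  shows "spin_avg N (\<lambda>\<sigma>. pair_energy N M \<sigma> * exp (s * pair_energy N M \<sigma>))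
       \<le> (B\<^sup>2 + B ^ 3) / (2 * (1 - \<rho>)) * spin_avg N (\<lambda>\<sigma>. exp (s * pair_energy N M \<sigma>))"
proof -
  define m where "m = (\<lambda>i (\<sigma>::nat \<Rightarrow> real). \<Sum>j=1..N. M i j * \<sigma> j)"
  \<comment> \<open>\<open>e\<close> is the pair energy, \<open>k = M m\<close>, \<open>b\<close> the diagonal of \<open>M\<^sup>2\<close>; \<open>k'\<close> is the part of \<open>k\<close> without self-interaction.\<close>
  define e where "e = (\<lambda>\<sigma>. 1 / 2 * (\<Sum>i=1..N. \<sigma> i * m i \<sigma>))"
  define k where "k = (\<lambda>i \<sigma>. \<Sum>j=1..N. M i j * m j \<sigma>)"
  define b where "b = (\<lambda>i. \<Sum>j=1..N. (M i j)\<^sup>2)"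
  define k' where "k' = (\<lambda>i \<sigma>. k i \<sigma> - b i * \<sigma> i)"
  have B: "B \<ge> 0"
    using bd[of 1 1] N by (simp add: zero_le_divide_iff diag)
  have e: "pair_energy N M \<sigma> = e \<sigma>" for \<sigma>
  proof -
    have "(\<Sum>i=1..N. \<Sum>j=1..N. M i j * \<sigma> i * \<sigma> j)
        = 2 * pair_energy N M \<sigma> + (\<Sum>i=1..N. M i i * \<sigma> i * \<sigma> i)"
      unfolding pair_energy_def by (rule sum_full_eq_edges) (simp add: sym mult_ac)
    moreover have "(\<Sum>i=1..N. \<sigma> i * m i \<sigma>) = (\<Sum>i=1..N. \<Sum>j=1..N. M i j * \<sigma> i * \<sigma> j)"
      by (simp add: m_def sum_distrib_left mult_ac)
    ultimately show ?thesis by (simp add: e_def diag)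
  qed
  have lin_flip: "(\<Sum>j=1..N. K j * flip_spin i \<sigma> j) = (\<Sum>j=1..N. K j * \<sigma> j) - 2 * K i * \<sigma> i"
    if i: "i \<in> {1..N}" for K i \<sigma>
  proof -
    have "(\<Sum>j=1..N. K j * flip_spin i \<sigma> j) = (\<Sum>j=1..N. K j * \<sigma> j - (if j = i then 2 * K j * \<sigma> j else 0))"
      by (rule sum.cong) (auto simp: flip_spin_def)
    thus ?thesis using i by (simp add: sum_subtractf)
  qed
  have m_flip: "m j (flip_spin i \<sigma>) = m j \<sigma> - 2 * M j i * \<sigma> i" if "i \<in> {1..N}" for i j \<sigma>
    unfolding m_def by (rule lin_flip[OF that])
  have e_flip: "e (flip_spin i \<sigma>) = e \<sigma> - 2 * \<sigma> i * m i \<sigma>" if i: "i \<in> {1..N}" for i \<sigma>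
  proof -
    have "(\<Sum>l=1..N. m l (flip_spin i \<sigma>) * flip_spin i \<sigma> l)
        = (\<Sum>l=1..N. m l (flip_spin i \<sigma>) * \<sigma> l) - 2 * m i \<sigma> * \<sigma> i"
      using lin_flip[OF i, of "\<lambda>l. m l (flip_spin i \<sigma>)"] m_flip[OF i, of i] diag[OF i] by simp
    also have "(\<Sum>l=1..N. m l (flip_spin i \<sigma>) * \<sigma> l) = (\<Sum>l=1..N. m l \<sigma> * \<sigma> l) - (\<Sum>l=1..N. 2 * \<sigma> i * (M i l * \<sigma> l))"
      unfolding sum_subtractf[symmetric]
      by (rule sum.cong) (use i in \<open>auto simp: m_flip sym[of i] algebra_simps\<close>)
    also have "(\<Sum>l=1..N. 2 * \<sigma> i * (M i l * \<sigma> l)) = 2 * \<sigma> i * m i \<sigma>"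
      by (simp add: m_def sum_distrib_left)
    finally show ?thesis by (simp add: e_def mult.commute algebra_simps)
  qed
  have k'_flip: "k' i (flip_spin i \<sigma>) = k' i \<sigma>" if i: "i \<in> {1..N}" for i \<sigma>
  proof -
    have "k i (flip_spin i \<sigma>) = k i \<sigma> - (\<Sum>j=1..N. 2 * \<sigma> i * (M i j)\<^sup>2)"
      unfolding k_def sum_subtractf[symmetric]
      by (rule sum.cong) (use i in \<open>auto simp: m_flip sym[of i] algebra_simps power2_eq_square\<close>)
    thus ?thesis by (simp add: k'_def b_def sum_distrib_left[symmetric] algebra_simps)
  qed
  have m_sq: "(\<Sum>i=1..N. (m i \<sigma>)\<^sup>2) = (\<Sum>i=1..N. \<sigma> i * k i \<sigma>)" for \<sigma>
  proof -
    have "(\<Sum>i=1..N. \<sigma> i * k i \<sigma>) = (\<Sum>i=1..N. \<Sum>j=1..N. M i j * m j \<sigma> * \<sigma> i)"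
      by (simp add: k_def sum_distrib_left mult_ac)
    also have "\<dots> = (\<Sum>j=1..N. \<Sum>i=1..N. M i j * m j \<sigma> * \<sigma> i)" by (rule sum.swap)
    also have "\<dots> = (\<Sum>j=1..N. m j \<sigma> * m j \<sigma>)"
      by (auto simp: m_def sum_distrib_left sum_distrib_right sym mult_ac intro!: sum.cong)
    finally show ?thesis by (simp add: power2_eq_square)
  qed
  have M_sq: "(M i j)\<^sup>2 \<le> (B / N)\<^sup>2" if "i \<in> {1..N}" "j \<in> {1..N}" for i j
    using bd[OF that] by (metis abs_ge_zero power2_abs power_mono)
  have b_le: "b i \<le> B\<^sup>2 / N" if "i \<in> {1..N}" for i
  proof -
    have "b i \<le> (\<Sum>j=1..N. (B / N)\<^sup>2)" unfolding b_def by (rule sum_mono) (use M_sq that in auto)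
    also have "\<dots> = B\<^sup>2 / N" using N by (simp add: power2_eq_square field_simps)
    finally show ?thesis .
  qed
  have b_nn: "b i \<ge> 0" for i by (simp add: b_def sum_nonneg)
  have b_sum: "(\<Sum>i=1..N. b i) \<le> B\<^sup>2"
  proof -
    have "(\<Sum>i=1..N. b i) \<le> (\<Sum>i=1..N. B\<^sup>2 / N)" by (rule sum_mono) (use b_le in auto)
    thus ?thesis using N by simp
  qed
  have m_abs: "\<bar>m i \<sigma>\<bar> \<le> B" if "i \<in> {1..N}" "\<sigma> \<in> spins N" for i \<sigma>
  proof -
    have "\<bar>m i \<sigma>\<bar> \<le> (\<Sum>j=1..N. \<bar>M i j * \<sigma> j\<bar>)" unfolding m_def by (rule sum_abs)
    also have "\<dots> \<le> (\<Sum>j=1..N. B / N)"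
      by (rule sum_mono) (use bd that spins_abs[OF that(2)] in \<open>auto simp: abs_mult\<close>)
    finally show ?thesis using N by simp
  qed
  have mk: "(\<Sum>i=1..N. \<bar>m i \<sigma>\<bar> * \<bar>k i \<sigma>\<bar>) \<le> \<rho> * (\<Sum>i=1..N. (m i \<sigma>)\<^sup>2)" for \<sigma>
  proof -
    have "\<bar>m i \<sigma>\<bar> * \<bar>k i \<sigma>\<bar> \<le> (\<rho> * (m i \<sigma>)\<^sup>2 + (k i \<sigma>)\<^sup>2 / \<rho>) / 2" for i
    proof -
      have "0 \<le> (\<rho> * \<bar>m i \<sigma>\<bar> - \<bar>k i \<sigma>\<bar>)\<^sup>2 / \<rho>" using \<rho> by simp
      thus ?thesis using \<rho> by (simp add: power2_diff field_simps power2_eq_square)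
    qed
    hence "(\<Sum>i=1..N. \<bar>m i \<sigma>\<bar> * \<bar>k i \<sigma>\<bar>) \<le> (\<Sum>i=1..N. (\<rho> * (m i \<sigma>)\<^sup>2 + (k i \<sigma>)\<^sup>2 / \<rho>) / 2)"
      by (rule sum_mono)
    also have "\<dots> = (\<rho> * (\<Sum>i=1..N. (m i \<sigma>)\<^sup>2) + (\<Sum>i=1..N. (k i \<sigma>)\<^sup>2) / \<rho>) / 2"
      by (simp add: sum.distrib sum_divide_distrib[symmetric] sum_distrib_left)
    also have "(\<Sum>i=1..N. (k i \<sigma>)\<^sup>2) \<le> \<rho>\<^sup>2 * (\<Sum>i=1..N. (m i \<sigma>)\<^sup>2)"
      unfolding k_def by (rule op)
    finally show ?thesis using \<rho> by (simp add: power2_eq_square divide_right_mono)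
  qed
  define w where "w = (\<lambda>\<sigma>. exp (s * e \<sigma>))"
  define Z where "Z = spin_avg N w"
  define V where "V = spin_avg N (\<lambda>\<sigma>. w \<sigma> * (\<Sum>i=1..N. (m i \<sigma>)\<^sup>2))"
  have w: "w \<sigma> > 0" for \<sigma> by (simp add: w_def)
  have single: "spin_avg N (\<lambda>\<sigma>. w \<sigma> * (\<sigma> i * g \<sigma>)) \<le> spin_avg N (\<lambda>\<sigma>. w \<sigma> * (\<bar>m i \<sigma>\<bar> * \<bar>g \<sigma>\<bar>))"
    if i: "i \<in> {1..N}" and g: "\<And>\<sigma>. g (flip_spin i \<sigma>) = g \<sigma>" for i g
  proof -
    have "spin_avg N (\<lambda>\<sigma>. w \<sigma> * (\<sigma> i * g \<sigma>)) \<le> s * spin_avg N (\<lambda>\<sigma>. w \<sigma> * (\<bar>m i \<sigma>\<bar> * \<bar>g \<sigma>\<bar>))"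
      unfolding w_def
    proof (rule spin_avg_single_spin_le[OF i, where r = "\<lambda>\<sigma>. e \<sigma> - \<sigma> i * m i \<sigma>"])
      show "m i (flip_spin i \<sigma>) = m i \<sigma>" for \<sigma> using m_flip[OF i, of i] diag[OF i] by simp
      thus "e (flip_spin i \<sigma>) - flip_spin i \<sigma> i * m i (flip_spin i \<sigma>) = e \<sigma> - \<sigma> i * m i \<sigma>" for \<sigma>
        using e_flip[OF i] by simp
    qed (use g s in auto)
    also have "\<dots> \<le> 1 * spin_avg N (\<lambda>\<sigma>. w \<sigma> * (\<bar>m i \<sigma>\<bar> * \<bar>g \<sigma>\<bar>))"
      using s w by (intro mult_right_mono spin_avg_nonneg) (auto intro!: mult_nonneg_nonneg less_imp_le[OF w])
    finally show ?thesis by simp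
  qed
  have "V = spin_avg N (\<lambda>\<sigma>. w \<sigma> * (\<Sum>i=1..N. b i + \<sigma> i * k' i \<sigma>))"
    unfolding V_def m_sq
  proof (intro spin_avg_cong arg_cong2[where f = "(*)"] sum.cong refl)
    fix \<sigma> i assume "\<sigma> \<in> spins N" "i \<in> {1..N}"
    from spins_square[OF this] have "\<sigma> i * (b i * \<sigma> i) = b i" by (simp add: mult_ac)
    thus "\<sigma> i * k i \<sigma> = b i + \<sigma> i * k' i \<sigma>"
      by (simp add: k'_def right_diff_distrib)
  qed
  also have "\<dots> = (\<Sum>i=1..N. b i) * Z + (\<Sum>i=1..N. spin_avg N (\<lambda>\<sigma>. w \<sigma> * (\<sigma> i * k' i \<sigma>)))"
    by (simp add: sum.distrib distrib_left spin_avg_add spin_avg_sum[symmetric] sum_distrib_left Z_def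
        spin_avg_cmult[symmetric] mult.commute)
  also have "\<dots> \<le> B\<^sup>2 * Z + (\<Sum>i=1..N. spin_avg N (\<lambda>\<sigma>. w \<sigma> * (\<bar>m i \<sigma>\<bar> * \<bar>k' i \<sigma>\<bar>)))"
    using b_sum w by (intro add_mono mult_right_mono sum_mono single)
      (auto simp: k'_flip Z_def intro!: spin_avg_nonneg less_imp_le[OF w])
  also have "(\<Sum>i=1..N. spin_avg N (\<lambda>\<sigma>. w \<sigma> * (\<bar>m i \<sigma>\<bar> * \<bar>k' i \<sigma>\<bar>)))
      = spin_avg N (\<lambda>\<sigma>. w \<sigma> * (\<Sum>i=1..N. \<bar>m i \<sigma>\<bar> * \<bar>k' i \<sigma>\<bar>))"
    by (simp add: spin_avg_sum[symmetric] sum_distrib_left)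
  also have "\<dots> \<le> spin_avg N (\<lambda>\<sigma>. B ^ 3 * w \<sigma> + \<rho> * (w \<sigma> * (\<Sum>i=1..N. (m i \<sigma>)\<^sup>2)))"
  proof (rule spin_avg_mono)
    fix \<sigma> assume \<sigma>: "\<sigma> \<in> spins N"
    have "(\<Sum>i=1..N. \<bar>m i \<sigma>\<bar> * \<bar>k' i \<sigma>\<bar>) \<le> (\<Sum>i=1..N. \<bar>m i \<sigma>\<bar> * \<bar>k i \<sigma>\<bar> + B * (B\<^sup>2 / N))"
    proof (rule sum_mono)
      fix i assume i: "i \<in> {1..N}"
      have "\<bar>k' i \<sigma>\<bar> \<le> \<bar>k i \<sigma>\<bar> + b i"
        using abs_triangle_ineq4[of "k i \<sigma>" "b i * \<sigma> i"] spins_abs[OF \<sigma> i] b_nn[of i]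
        by (simp add: k'_def abs_mult)
      hence "\<bar>m i \<sigma>\<bar> * \<bar>k' i \<sigma>\<bar> \<le> \<bar>m i \<sigma>\<bar> * (\<bar>k i \<sigma>\<bar> + b i)" by (rule mult_left_mono) simp
      also have "\<dots> = \<bar>m i \<sigma>\<bar> * \<bar>k i \<sigma>\<bar> + \<bar>m i \<sigma>\<bar> * b i" by (rule distrib_left)
      also have "\<bar>m i \<sigma>\<bar> * b i \<le> B * (B\<^sup>2 / N)"
        by (rule mult_mono) (use m_abs[OF i \<sigma>] b_le[OF i] B b_nn in auto)
      finally show "\<bar>m i \<sigma>\<bar> * \<bar>k' i \<sigma>\<bar> \<le> \<bar>m i \<sigma>\<bar> * \<bar>k i \<sigma>\<bar> + B * (B\<^sup>2 / N)"
        by simp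
    qed
    also have "\<dots> = (\<Sum>i=1..N. \<bar>m i \<sigma>\<bar> * \<bar>k i \<sigma>\<bar>) + B ^ 3"
      using N by (simp add: sum.distrib power3_eq_cube power2_eq_square)
    also have "\<dots> \<le> \<rho> * (\<Sum>i=1..N. (m i \<sigma>)\<^sup>2) + B ^ 3" using mk by simp
    finally have "w \<sigma> * (\<Sum>i=1..N. \<bar>m i \<sigma>\<bar> * \<bar>k' i \<sigma>\<bar>) \<le> w \<sigma> * (\<rho> * (\<Sum>i=1..N. (m i \<sigma>)\<^sup>2) + B ^ 3)"
      using w[of \<sigma>] by (intro mult_left_mono) auto
    thus "w \<sigma> * (\<Sum>i=1..N. \<bar>m i \<sigma>\<bar> * \<bar>k' i \<sigma>\<bar>) \<le> B ^ 3 * w \<sigma> + \<rho> * (w \<sigma> * (\<Sum>i=1..N. (m i \<sigma>)\<^sup>2))"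
      by (simp add: algebra_simps)
  qed
  also have "\<dots> = B ^ 3 * Z + \<rho> * V"
    by (simp only: spin_avg_add spin_avg_cmult Z_def V_def)
  finally have "V \<le> B\<^sup>2 * Z + (B ^ 3 * Z + \<rho> * V)" by simp
  hence "V * (1 - \<rho>) \<le> (B\<^sup>2 + B ^ 3) * Z" by (simp add: algebra_simps)
  hence V: "V \<le> (B\<^sup>2 + B ^ 3) / (1 - \<rho>) * Z" using \<rho> by (simp add: field_simps)
  have "spin_avg N (\<lambda>\<sigma>. e \<sigma> * w \<sigma>) = 1 / 2 * (\<Sum>i=1..N. spin_avg N (\<lambda>\<sigma>. w \<sigma> * (\<sigma> i * m i \<sigma>)))"
    by (simp add: e_def spin_avg_sum[symmetric] spin_avg_cmult[symmetric] sum_distrib_left mult_ac)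
  also have "\<dots> \<le> 1 / 2 * (\<Sum>i=1..N. spin_avg N (\<lambda>\<sigma>. w \<sigma> * (\<bar>m i \<sigma>\<bar> * \<bar>m i \<sigma>\<bar>)))"
    by (intro mult_left_mono sum_mono single) (auto simp: m_flip diag)
  also have "\<dots> = 1 / 2 * V"
    by (simp add: V_def spin_avg_sum[symmetric] sum_distrib_left power2_eq_square)
  also have "\<dots> \<le> 1 / 2 * ((B\<^sup>2 + B ^ 3) / (1 - \<rho>) * Z)" using V by (intro mult_left_mono) auto
  finally show ?thesis using \<rho> by (simp add: e w_def Z_def field_simps)
qed

text \<open>
  By \<open>spin_avg_energy_le\<close>, with constant \<open>K\<close>, the function \<open>s \<mapsto> exp (- K s) \<langle>exp (s e)\<rangle>\<close> is non-increasing on \<open>[0, 1]\<close>.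
\<close>
lemma spin_avg_exp_energy_le:
  fixes M :: "nat \<Rightarrow> nat \<Rightarrow> real"
  assumes N: "N \<ge> 1"
    and sym: "\<And>i j. i \<in> {1..N} \<Longrightarrow> j \<in> {1..N} \<Longrightarrow> M i j = M j i"
    and diag: "\<And>i. i \<in> {1..N} \<Longrightarrow> M i i = 0"
    and bd: "\<And>i j. i \<in> {1..N} \<Longrightarrow> j \<in> {1..N} \<Longrightarrow> \<bar>M i j\<bar> \<le> B / real N"
    and op: "\<And>u. (\<Sum>i=1..N. (\<Sum>j=1..N. M i j * u j)\<^sup>2) \<le> \<rho>\<^sup>2 * (\<Sum>i=1..N. (u i)\<^sup>2)"
    and \<rho>: "0 < \<rho>" "\<rho> < 1"
  shows "spin_avg N (\<lambda>\<sigma>. exp (pair_energy N M \<sigma>)) \<le> exp ((B\<^sup>2 + B ^ 3) / (2 * (1 - \<rho>)))"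
proof -
  define e where "e = pair_energy N M"
  define K where "K = (B\<^sup>2 + B ^ 3) / (2 * (1 - \<rho>))"
  define f where "f = (\<lambda>s. spin_avg N (\<lambda>\<sigma>. exp (s * e \<sigma>)) * exp (- K * s))"
  have "f 1 \<le> f 0"
  proof (rule DERIV_nonpos_imp_nonincreasing[of 0 1 f])
    fix s :: real assume s: "0 \<le> s" "s \<le> 1"
    have "((\<lambda>s. spin_avg N (\<lambda>\<sigma>. exp (s * e \<sigma>))) has_real_derivative
        spin_avg N (\<lambda>\<sigma>. e \<sigma> * exp (s * e \<sigma>))) (at s)"
      unfolding spin_avg_def
      by (rule DERIV_cmult, rule DERIV_sum) (auto intro!: derivative_eq_intros)
    hence "(f has_real_derivative
        (spin_avg N (\<lambda>\<sigma>. e \<sigma> * exp (s * e \<sigma>)) - K * spin_avg N (\<lambda>\<sigma>. exp (s * e \<sigma>))) * exp (- K * s)) (at s)"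
      unfolding f_def by (auto intro!: derivative_eq_intros simp: algebra_simps)
    moreover have "spin_avg N (\<lambda>\<sigma>. e \<sigma> * exp (s * e \<sigma>)) \<le> K * spin_avg N (\<lambda>\<sigma>. exp (s * e \<sigma>))"
      unfolding e_def K_def by (rule spin_avg_energy_le[OF assms s])
    hence "(spin_avg N (\<lambda>\<sigma>. e \<sigma> * exp (s * e \<sigma>)) - K * spin_avg N (\<lambda>\<sigma>. exp (s * e \<sigma>))) * exp (- K * s) \<le> 0"
      by (intro mult_nonpos_nonneg) auto
    ultimately show "\<exists>y. (f has_real_derivative y) (at s) \<and> y \<le> 0" by blast
  qed simp
  hence "spin_avg N (\<lambda>\<sigma>. exp (e \<sigma>)) * exp (- K) \<le> 1" by (simp add: f_def)
  hence "spin_avg N (\<lambda>\<sigma>. exp (e \<sigma>)) \<le> exp K" by (simp add: exp_minus field_simps)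
  thus ?thesis by (simp add: e_def K_def)
qed

section \<open>Moments of the normalised partition function\<close>

lemma spin_avg_multc: "spin_avg N (\<lambda>\<sigma>. F \<sigma> * c) = spin_avg N F * c"
  using spin_avg_cmult[of N c F] by (simp only: mult.commute)

lemma exp_convex_comb:
  fixes x y l :: real
  assumes "0 \<le> l" "l \<le> 1"
  shows "exp (l * x + (1 - l) * y) \<le> l * exp x + (1 - l) * exp y"
proof -
  define c where "c = l * x + (1 - l) * y"
  have t: "exp c * (1 + (z - c)) \<le> exp z" for z
    using exp_ge_add_one_self[of "z - c"] by (simp add: exp_diff field_simps)
  have "exp c = l * (exp c * (1 + (x - c))) + (1 - l) * (exp c * (1 + (y - c)))"
    by (simp add: c_def algebra_simps)
  also have "\<dots> \<le> l * exp x + (1 - l) * exp y"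
    using assms by (intro add_mono mult_left_mono t) auto
  finally show ?thesis by (simp add: c_def)
qed

text \<open>
  Young's inequality splits \<open>F\<close> from \<open>m X\<close>; convexity of the exponential between \<open>0\<close> and \<open>m X\<close>
  produces the small factor \<open>1 / m\<close>.
\<close>
lemma mult_exp_le_young:
  fixes F X w p q m :: real
  assumes "0 \<le> w" "w \<le> exp F" "p > 1" "q = p / (p - 1)" "m \<ge> 1"
  shows "w * exp X \<le> w + (exp (p * F) + exp (q * m * X)) / m"
proof -
  have "exp X = exp (1 / m * (m * X) + (1 - 1 / m) * 0)" using assms by simp
  also have "\<dots> \<le> 1 / m * exp (m * X) + (1 - 1 / m) * exp 0"
    by (rule exp_convex_comb) (use assms in auto)
  finally have "w * exp X \<le> w * (1 / m * exp (m * X) + (1 - 1 / m))"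
    using assms by (intro mult_left_mono) auto
  also have "\<dots> = w * exp (m * X) / m + w * (1 - 1 / m)"
    by (simp add: algebra_simps)
  also have "\<dots> \<le> exp F * exp (m * X) / m + w * 1"
    using assms by (intro add_mono divide_right_mono mult_right_mono mult_left_mono) auto
  also have "exp F * exp (m * X) = exp (1 / p * (p * F) + (1 - 1 / p) * (q * m * X))"
    using assms by (simp add: exp_add[symmetric] field_simps)
  also have "\<dots> \<le> 1 / p * exp (p * F) + (1 - 1 / p) * exp (q * m * X)"
    by (rule exp_convex_comb) (use assms in auto)
  also have "\<dots> \<le> 1 * exp (p * F) + 1 * exp (q * m * X)"
    using assms by (intro add_mono mult_right_mono) auto
  finally show ?thesis using assms by (simp add: divide_right_mono)
qed

text \<open>
  A matrix with entries at most \<open>1 / (2 N)\<close> has operator norm at most \<open>1 / 2\<close>, so \<open>spin_avg_exp_energy_le\<close> applies with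
  \<open>B = \<rho> = 1 / 2\<close> and has exponent \<open>3 / 8\<close>.
\<close>
lemma spin_avg_exp_small_energy:
  assumes N: "N \<ge> 1" and R: "\<And>i j. (i, j) \<in> edges N \<Longrightarrow> \<bar>R i j\<bar> \<le> 1 / (2 * real N)"
  shows "spin_avg N (\<lambda>\<sigma>. exp (pair_energy N R \<sigma>)) \<le> exp 1"
proof -
  define R' where "R' = (\<lambda>i j. if i < j then R i j else if j < i then R j i else 0)"
  have R': "\<bar>R' i j\<bar> \<le> (1/2) / real N" if "i \<in> {1..N}" "j \<in> {1..N}" for i j
    using R[of i j] R[of j i] that N by (auto simp: R'_def edges_def)
  have "spin_avg N (\<lambda>\<sigma>. exp (pair_energy N R' \<sigma>)) \<le> exp (((1/2)\<^sup>2 + (1/2) ^ 3) / (2 * (1 - 1/2)))"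
  proof (rule spin_avg_exp_energy_le[OF N])
    fix u :: "nat \<Rightarrow> real"
    have "(\<Sum>j=1..N. R' i j * u j)\<^sup>2 \<le> 1 / (4 * real N) * (\<Sum>j=1..N. (u j)\<^sup>2)" if i: "i \<in> {1..N}" for i
    proof -
      have "(\<Sum>j=1..N. R' i j * u j)\<^sup>2 \<le> (\<Sum>j=1..N. (R' i j)\<^sup>2) * (\<Sum>j=1..N. (u j)\<^sup>2)"
        by (rule Cauchy_Schwarz_ineq_sum)
      also have "(\<Sum>j=1..N. (R' i j)\<^sup>2) \<le> (\<Sum>j=1..N. ((1/2) / real N)\<^sup>2)"
        by (intro sum_mono) (use R'[OF i] in \<open>metis abs_ge_zero power2_abs power_mono\<close>)
      also have "\<dots> = 1 / (4 * real N)" using N by (simp add: power2_eq_square)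
      finally show ?thesis by (simp add: mult_right_mono sum_nonneg)
    qed
    hence "(\<Sum>i=1..N. (\<Sum>j=1..N. R' i j * u j)\<^sup>2) \<le> (\<Sum>i=1..N. 1 / (4 * real N) * (\<Sum>j=1..N. (u j)\<^sup>2))"
      by (intro sum_mono) auto
    also have "\<dots> = (1/2)\<^sup>2 * (\<Sum>j=1..N. (u j)\<^sup>2)" using N by (simp add: power2_eq_square)
    finally show "(\<Sum>i=1..N. (\<Sum>j=1..N. R' i j * u j)\<^sup>2) \<le> (1/2)\<^sup>2 * (\<Sum>j=1..N. (u j)\<^sup>2)" .
  qed (use R' in \<open>auto simp: R'_def\<close>)
  also have "\<dots> \<le> exp 1" by (simp add: power2_eq_square power3_eq_cube)
  finally have "spin_avg N (\<lambda>\<sigma>. exp (pair_energy N R' \<sigma>)) \<le> exp 1" .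
  moreover have "pair_energy N R' \<sigma> = pair_energy N R \<sigma>" for \<sigma>
    unfolding pair_energy_def by (rule sum.cong) (auto simp: R'_def edges_def)
  ultimately show ?thesis by simp
qed

lemma pair_energy_cmult: "pair_energy N (\<lambda>i j. c * M i j) \<sigma> = c * pair_energy N M \<sigma>"
  by (simp add: pair_energy_def sum_distrib_left split_def mult_ac)

lemma pair_energy_cong: "(\<And>i. i \<in> {1..N} \<Longrightarrow> \<sigma> i = \<tau> i) \<Longrightarrow> pair_energy N M \<sigma> = pair_energy N M \<tau>"
  unfolding pair_energy_def by (rule sum.cong) (auto dest: edges_memD)

text \<open>
  The energy of \<open>R\<close> is a small perturbation of that of \<open>M\<close>. Enlarged by the factor \<open>1 / (2 \<delta>)\<close> it still has bounded exponential
  moments, and Young's inequality with exponents \<open>p\<close> and \<open>q\<close> then yields errors of order \<open>\<delta>\<close>.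
\<close>
locale weak_perturbation =
  fixes N :: nat and M R :: "nat \<Rightarrow> nat \<Rightarrow> real" and p q K \<delta> :: real
  assumes N: "N \<ge> 1" and p: "p > 1" and q: "q = p / (p - 1)"
    and K: "spin_avg N (\<lambda>\<sigma>. exp (p * pair_energy N M \<sigma>)) \<le> K"
    and R: "\<And>i j. (i, j) \<in> edges N \<Longrightarrow> \<bar>R i j\<bar> \<le> \<delta> / real N"
    and \<delta>: "0 < \<delta>" "2 * q * \<delta> \<le> 1"
begin

lemma young:
  assumes "0 \<le> w" "w \<le> exp F"
  shows "w * exp X \<le> w + 2 * q * \<delta> * (exp (p * F) + exp (1 / (2 * \<delta>) * X))"
proof -
  have q0: "q > 0" using p q by simp
  have "w * exp X \<le> w + (exp (p * F) + exp (q * (1 / (2 * q * \<delta>)) * X)) / (1 / (2 * q * \<delta>))"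
    by (rule mult_exp_le_young) (use assms p q q0 \<delta> in \<open>auto simp: field_simps\<close>)
  thus ?thesis using q0 \<delta> by (simp add: field_simps)
qed

lemma small: "spin_avg N (\<lambda>\<sigma>. exp (1 / (2 * \<delta>) * pair_energy N R \<sigma>)) \<le> exp 1"
  unfolding pair_energy_cmult[symmetric]
  by (rule spin_avg_exp_small_energy) (use N R \<delta> in \<open>auto simp: abs_mult field_simps\<close>)

lemma spin_avg_le:
  assumes w: "\<And>\<sigma>. \<sigma> \<in> spins N \<Longrightarrow> 0 \<le> w \<sigma>" "\<And>\<sigma>. \<sigma> \<in> spins N \<Longrightarrow> w \<sigma> \<le> exp (pair_energy N M \<sigma>)"
  shows "spin_avg N (\<lambda>\<sigma>. w \<sigma> * exp (pair_energy N R \<sigma>)) \<le> spin_avg N w + 2 * q * \<delta> * (K + exp 1)"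
proof -
  have q0: "q > 0" using p q by simp
  have "spin_avg N (\<lambda>\<sigma>. w \<sigma> * exp (pair_energy N R \<sigma>))
     \<le> spin_avg N (\<lambda>\<sigma>. w \<sigma> + 2 * q * \<delta> * (exp (p * pair_energy N M \<sigma>) + exp (1 / (2 * \<delta>) * pair_energy N R \<sigma>)))"
    by (intro spin_avg_mono young w)
  also have "\<dots> = spin_avg N w + 2 * q * \<delta> * (spin_avg N (\<lambda>\<sigma>. exp (p * pair_energy N M \<sigma>))
      + spin_avg N (\<lambda>\<sigma>. exp (1 / (2 * \<delta>) * pair_energy N R \<sigma>)))"
    by (simp only: spin_avg_add spin_avg_cmult)
  also have "\<dots> \<le> spin_avg N w + 2 * q * \<delta> * (K + exp 1)"
    using q0 \<delta> by (intro add_left_mono mult_left_mono add_mono K small) auto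
  finally show ?thesis .
qed

text \<open>
  Two replicas that interact through their product: for fixed \<open>\<sigma>\<close> the product \<open>\<sigma> \<tau>\<close> is as uniform as \<open>\<tau>\<close>.
\<close>
lemma spin_avg_two_le:
  assumes w: "\<And>\<sigma>. \<sigma> \<in> spins N \<Longrightarrow> 0 \<le> w \<sigma>" "\<And>\<sigma>. \<sigma> \<in> spins N \<Longrightarrow> w \<sigma> \<le> exp (pair_energy N M \<sigma>)"
  shows "spin_avg N (\<lambda>\<sigma>. spin_avg N (\<lambda>\<tau>. w \<sigma> * w \<tau> * exp (pair_energy N R (\<lambda>i. \<sigma> i * \<tau> i))))
    \<le> (spin_avg N w)\<^sup>2 + 2 * q * \<delta> * (K\<^sup>2 + exp 1)"
proof -
  let ?e = "\<lambda>\<sigma>. exp (p * pair_energy N M \<sigma>)"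
  let ?r = "\<lambda>\<sigma>. exp (1 / (2 * \<delta>) * pair_energy N R \<sigma>)"
  have q0: "q > 0" using p q by simp
  have nn: "0 \<le> spin_avg N ?e" by (rule spin_avg_nonneg) simp
  have KK: "spin_avg N ?e * spin_avg N ?e \<le> K * K"
    by (rule mult_mono[OF K K order_trans[OF nn K] nn])
  have inner: "spin_avg N (\<lambda>\<tau>. ?r (\<lambda>i. \<sigma> i * \<tau> i)) = spin_avg N ?r" if \<sigma>: "\<sigma> \<in> spins N" for \<sigma>
  proof -
    have "spin_avg N (\<lambda>\<tau>. ?r (\<lambda>i. \<sigma> i * \<tau> i)) = spin_avg N (\<lambda>\<tau>. ?r (\<lambda>i\<in>{1..N}. \<tau> i * \<sigma> i))"
      by (intro spin_avg_cong arg_cong[where f = exp] arg_cong2[where f = "(*)"] pair_energy_cong)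
         (auto simp: mult.commute)
    also have "\<dots> = spin_avg N ?r" by (rule spin_avg_mult_spins[OF \<sigma>])
    finally show ?thesis .
  qed
  have "spin_avg N (\<lambda>\<sigma>. spin_avg N (\<lambda>\<tau>. w \<sigma> * w \<tau> * exp (pair_energy N R (\<lambda>i. \<sigma> i * \<tau> i))))
     \<le> spin_avg N (\<lambda>\<sigma>. spin_avg N (\<lambda>\<tau>. w \<sigma> * w \<tau> + 2 * q * \<delta> * (?e \<sigma> * ?e \<tau> + ?r (\<lambda>i. \<sigma> i * \<tau> i))))"
  proof (intro spin_avg_mono)
    fix \<sigma> \<tau> assume s: "\<sigma> \<in> spins N" "\<tau> \<in> spins N"
    have "w \<sigma> * w \<tau> \<le> exp (pair_energy N M \<sigma>) * exp (pair_energy N M \<tau>)"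
      by (intro mult_mono w s) auto
    from young[OF _ this[folded exp_add]] w s
    show "w \<sigma> * w \<tau> * exp (pair_energy N R (\<lambda>i. \<sigma> i * \<tau> i))
      \<le> w \<sigma> * w \<tau> + 2 * q * \<delta> * (?e \<sigma> * ?e \<tau> + ?r (\<lambda>i. \<sigma> i * \<tau> i))"
      by (simp add: exp_add[symmetric] distrib_left)
  qed
  also have "\<dots> = spin_avg N (\<lambda>\<sigma>. w \<sigma> * spin_avg N w + 2 * q * \<delta> * (?e \<sigma> * spin_avg N ?e + spin_avg N ?r))"
    by (intro spin_avg_cong) (simp only: spin_avg_add spin_avg_cmult inner)
  also have "\<dots> = spin_avg N w * spin_avg N w + 2 * q * \<delta> * (spin_avg N ?e * spin_avg N ?e + spin_avg N ?r)"
    by (simp only: spin_avg_add spin_avg_cmult spin_avg_multc spin_avg_const)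
  also have "\<dots> \<le> spin_avg N w * spin_avg N w + 2 * q * \<delta> * (K * K + exp 1)"
    using q0 \<delta> by (intro add_left_mono mult_left_mono add_mono KK small) auto
  finally show ?thesis by (simp add: power2_eq_square)
qed

end

definition edge_prod :: "nat \<Rightarrow> (nat \<Rightarrow> nat \<Rightarrow> real) \<Rightarrow> (nat \<Rightarrow> real) \<Rightarrow> real" where
  "edge_prod N a \<sigma> = (\<Prod>(i, j)\<in>edges N. 1 + a i j * \<sigma> i * \<sigma> j)"

lemma edges_spins_cases:
  assumes "(i, j) \<in> edges N" "\<sigma> \<in> spins N"
  shows "\<sigma> i * \<sigma> j = 1 \<or> \<sigma> i * \<sigma> j = -1"
  using assms spins_apply[of \<sigma> N i] spins_apply[of \<sigma> N j] edges_memD[of i j N] by auto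

lemma edge_prod_bounds:
  assumes a: "\<And>i j. (i, j) \<in> edges N \<Longrightarrow> \<bar>a i j\<bar> \<le> 1" and \<sigma>: "\<sigma> \<in> spins N"
  shows "0 \<le> edge_prod N a \<sigma>" "edge_prod N a \<sigma> \<le> exp (pair_energy N a \<sigma>)"
proof -
  have nn: "0 \<le> 1 + a i j * \<sigma> i * \<sigma> j" if "(i, j) \<in> edges N" for i j
    using a[OF that] edges_spins_cases[OF that \<sigma>] by (auto simp: mult.assoc abs_le_iff)
  show "0 \<le> edge_prod N a \<sigma>" unfolding edge_prod_def by (rule prod_nonneg) (use nn in auto)
  show "edge_prod N a \<sigma> \<le> exp (pair_energy N a \<sigma>)"
    unfolding edge_prod_def pair_energy_def exp_sum[OF finite_edges]
    by (rule prod_mono) (use nn in \<open>auto simp: exp_ge_add_one_self\<close>)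
qed

text \<open>
  Since \<open>1 + x \<ge> exp (x - 2 x\<^sup>2)\<close> for \<open>\<bar>x\<bar> \<le> 1 / 2\<close>, the product is at least \<open>exp (- B\<^sup>2)\<close> times the exponential of an energy
  of mean zero.
\<close>
lemma spin_avg_edge_prod_ge:
  assumes a: "\<And>i j. (i, j) \<in> edges N \<Longrightarrow> \<bar>a i j\<bar> \<le> B / real N" and B: "B / real N \<le> 1 / 2" "N \<ge> 1" "B \<ge> 0"
  shows "exp (- (B\<^sup>2)) \<le> spin_avg N (edge_prod N a)"
proof -
  have a2: "(\<Sum>(i, j)\<in>edges N. 2 * (a i j)\<^sup>2) \<le> B\<^sup>2"
  proof -
    have "(\<Sum>(i, j)\<in>edges N. 2 * (a i j)\<^sup>2) \<le> (real N)\<^sup>2 / 2 * (2 * (B / real N)\<^sup>2)"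
      by (rule sum_edges_bound) (use power_mono[OF a, of _ _ 2] in auto)
    thus ?thesis using B by (simp add: power_divide)
  qed
  have "exp (- (B\<^sup>2)) = spin_avg N (\<lambda>\<sigma>. exp (- (B\<^sup>2)) * (1 + pair_energy N a \<sigma>))"
    by (simp only: spin_avg_cmult spin_avg_add spin_avg_const spin_avg_pair_energy add_0_right mult_1_right)
  also have "\<dots> \<le> spin_avg N (edge_prod N a)"
  proof (rule spin_avg_mono)
    fix \<sigma> assume \<sigma>: "\<sigma> \<in> spins N"
    have "exp (- (B\<^sup>2)) * (1 + pair_energy N a \<sigma>) \<le> exp (- (B\<^sup>2)) * exp (pair_energy N a \<sigma>)"
      by (intro mult_left_mono exp_ge_add_one_self) auto
    also have "\<dots> \<le> exp (\<Sum>(i, j)\<in>edges N. a i j * \<sigma> i * \<sigma> j - 2 * (a i j)\<^sup>2)"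
      using a2 by (simp add: exp_add[symmetric] pair_energy_def sum_subtractf split_def)
    also have "\<dots> \<le> edge_prod N a \<sigma>"
      unfolding edge_prod_def exp_sum[OF finite_edges]
    proof (rule prod_mono, safe)
      fix i j assume ij: "(i, j) \<in> edges N"
      have x: "\<bar>a i j * \<sigma> i * \<sigma> j\<bar> \<le> 1 / 2" "(a i j * \<sigma> i * \<sigma> j)\<^sup>2 = (a i j)\<^sup>2"
        using order_trans[OF a[OF ij] B(1)] edges_spins_cases[OF ij \<sigma>] by (auto simp: mult.assoc)
      have "exp (a i j * \<sigma> i * \<sigma> j - 2 * (a i j)\<^sup>2) \<le> exp (ln (1 + a i j * \<sigma> i * \<sigma> j))"
        using abs_ln_one_plus_x_minus_x_bound[OF x(1)] x(2) by (auto simp: abs_le_iff)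
      thus "exp (a i j * \<sigma> i * \<sigma> j - 2 * (a i j)\<^sup>2) \<le> 1 + a i j * \<sigma> i * \<sigma> j"
        using x(1) by (auto simp: abs_le_iff)
    qed auto
    finally show "exp (- (B\<^sup>2)) * (1 + pair_energy N a \<sigma>) \<le> edge_prod N a \<sigma>" .
  qed
  finally show ?thesis .
qed

text \<open>
  Replacing \<open>a\<close> by \<open>a'\<close> multiplies each factor \<open>1 + a e\<close>, \<open>e = \<plusminus>1\<close>, by \<open>1 + (a' - a) e / (1 + a e)\<close>, which is at most
  \<open>exp ((a' - a) e + 2 \<bar>a' - a\<bar> a)\<close>. The terms linear in \<open>e\<close> form a weak perturbation and the others sum to at most \<open>B \<delta>\<close>.
\<close>
lemma spin_avg_edge_prod_perturb:
  assumes "weak_perturbation N a (\<lambda>i j. a' i j - a i j) p q K \<delta>"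
    and a: "\<And>i j. (i, j) \<in> edges N \<Longrightarrow> 0 \<le> a i j \<and> a i j \<le> B / real N"
    and a': "\<And>i j. (i, j) \<in> edges N \<Longrightarrow> 0 \<le> a' i j \<and> a' i j \<le> B / real N"
    and B: "B / real N \<le> 1 / 2" "B \<ge> 0"
  shows "spin_avg N (edge_prod N a') \<le> exp (B * \<delta>) * (spin_avg N (edge_prod N a) + 2 * q * \<delta> * (K + exp 1))"
proof -
  interpret weak_perturbation N a "\<lambda>i j. a' i j - a i j" p q K \<delta> by fact
  have a1: "\<bar>a i j\<bar> \<le> 1" if "(i, j) \<in> edges N" for i j
    using a[OF that] B(1) by linarith
  have "spin_avg N (edge_prod N a')
     \<le> spin_avg N (\<lambda>\<sigma>. exp (B * \<delta>) * (edge_prod N a \<sigma> * exp (pair_energy N (\<lambda>i j. a' i j - a i j) \<sigma>)))"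
  proof (rule spin_avg_mono)
    fix \<sigma> assume \<sigma>: "\<sigma> \<in> spins N"
    have err: "(\<Sum>(i, j)\<in>edges N. 2 * \<bar>a' i j - a i j\<bar> * a i j) \<le> B * \<delta>"
    proof -
      have "2 * \<bar>a' i j - a i j\<bar> * a i j \<le> 2 * (\<delta> / real N) * (B / real N)" if "(i, j) \<in> edges N" for i j
        by (intro mult_mono) (use a[OF that] R[OF that] \<delta> in auto)
      hence "(\<Sum>(i, j)\<in>edges N. 2 * \<bar>a' i j - a i j\<bar> * a i j) \<le> (real N)\<^sup>2 / 2 * (2 * (\<delta> / real N) * (B / real N))"
        by (rule sum_edges_bound) (use B \<delta> in auto)
      thus ?thesis using N by (simp add: power2_eq_square field_simps)
    qed
    have "edge_prod N a' \<sigma> \<le> (\<Prod>(i, j)\<in>edges N. (1 + a i j * \<sigma> i * \<sigma> j) *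
        (exp ((a' i j - a i j) * \<sigma> i * \<sigma> j) * exp (2 * \<bar>a' i j - a i j\<bar> * a i j)))"
      unfolding edge_prod_def
    proof (rule prod_mono, safe)
      fix i j assume ij: "(i, j) \<in> edges N"
      define e where "e = \<sigma> i * \<sigma> j"
      define d where "d = a' i j - a i j"
      define c where "c = a i j"
      have e: "e = 1 \<or> e = -1" unfolding e_def using edges_spins_cases[OF ij \<sigma>] .
      have c: "0 \<le> c" "c \<le> 1 / 2" using a[OF ij] B(1) unfolding c_def by linarith+
      show "0 \<le> 1 + a' i j * \<sigma> i * \<sigma> j"
      proof -
        have "0 \<le> a' i j" "a' i j \<le> 1 / 2" using a'[OF ij] B(1) by linarith+
        thus ?thesis using e by (auto simp: mult.assoc e_def)
      qed
      have pos: "1 + c * e > 0" using c e by auto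
      have inv: "1 / (1 + c * e) \<le> 1 + 2 * c" "1 - 2 * c \<le> 1 / (1 + c * e)"
        using e c mult_right_mono[of c "1/2" c] by (auto simp: field_simps)
      have key: "d * e / (1 + c * e) \<le> d * e + 2 * \<bar>d\<bar> * c"
      proof -
        have "d * e * (1 / (1 + c * e) - 1) \<le> \<bar>d * e * (1 / (1 + c * e) - 1)\<bar>" by simp
        also have "\<dots> = \<bar>d\<bar> * \<bar>1 / (1 + c * e) - 1\<bar>" using e by (auto simp: abs_mult)
        also have "\<dots> \<le> \<bar>d\<bar> * (2 * c)" by (rule mult_left_mono) (use inv in auto)
        finally show ?thesis by (simp add: algebra_simps)
      qed
      have "1 + (c + d) * e = (1 + c * e) * (1 + d * e / (1 + c * e))"
        using pos by (simp add: field_simps)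
      also have "\<dots> \<le> (1 + c * e) * exp (d * e + 2 * \<bar>d\<bar> * c)"
        using pos key exp_ge_add_one_self[of "d * e + 2 * \<bar>d\<bar> * c"] by (intro mult_left_mono) linarith+
      finally show "1 + a' i j * \<sigma> i * \<sigma> j \<le> (1 + a i j * \<sigma> i * \<sigma> j) *
        (exp ((a' i j - a i j) * \<sigma> i * \<sigma> j) * exp (2 * \<bar>a' i j - a i j\<bar> * a i j))"
        by (simp add: c_def d_def e_def exp_add mult.assoc)
    qed
    also have "\<dots> = edge_prod N a \<sigma> * (exp (pair_energy N (\<lambda>i j. a' i j - a i j) \<sigma>)
        * exp (\<Sum>(i, j)\<in>edges N. 2 * \<bar>a' i j - a i j\<bar> * a i j))"
      by (simp add: edge_prod_def pair_energy_def exp_sum[OF finite_edges] prod.distrib split_def)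
    also have "\<dots> \<le> edge_prod N a \<sigma> * (exp (pair_energy N (\<lambda>i j. a' i j - a i j) \<sigma>) * exp (B * \<delta>))"
      using err by (intro mult_left_mono edge_prod_bounds(1)[OF a1 \<sigma>]) auto
    finally show "edge_prod N a' \<sigma> \<le> exp (B * \<delta>) * (edge_prod N a \<sigma> * exp (pair_energy N (\<lambda>i j. a' i j - a i j) \<sigma>))"
      by (simp add: mult_ac)
  qed
  also have "\<dots> = exp (B * \<delta>) * spin_avg N (\<lambda>\<sigma>. edge_prod N a \<sigma> * exp (pair_energy N (\<lambda>i j. a' i j - a i j) \<sigma>))"
    by (rule spin_avg_cmult)
  also have "\<dots> \<le> exp (B * \<delta>) * (spin_avg N (edge_prod N a) + 2 * q * \<delta> * (K + exp 1))"
    by (intro mult_left_mono spin_avg_le edge_prod_bounds a1) auto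
  finally show ?thesis .
qed

text \<open>
  Dividing by \<open>(1 + c e) (1 + c f)\<close> changes \<open>d e f\<close> by at most \<open>6 c d\<close>, as the reciprocal of this product lies within \<open>6 c\<close> of
  \<open>1\<close> for \<open>c \<le> 1 / 2\<close>.
\<close>
lemma two_replica_factor:
  fixes c d e f :: real
  assumes c: "0 \<le> c" "c \<le> 1 / 2" and d: "0 \<le> d" "d \<le> 1 / 4"
    and e: "e = 1 \<or> e = -1" and f: "f = 1 \<or> f = -1"
  shows "0 \<le> (1 + c * e) * (1 + c * f) + d * e * f"
    and "(1 + c * e) * (1 + c * f) + d * e * f \<le> (1 + c * e) * (1 + c * f) * exp (d * e * f + 6 * d * c)"
proof -
  define P where "P = (1 + c * e) * (1 + c * f)"
  have ge: "1 + c * e \<ge> 1 / 2" "1 + c * f \<ge> 1 / 2" using c e f by auto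
  have P4: "P \<ge> 1 / 2 * (1 / 2)" unfolding P_def using ge by (intro mult_mono) auto
  have "d * e * f \<ge> - (1 / 4)" using d e f by auto
  thus "0 \<le> (1 + c * e) * (1 + c * f) + d * e * f" using P4 unfolding P_def by linarith
  have P: "P > 0" using P4 by simp
  have inv: "1 \<le> (1 + 6 * c) * P \<and> (1 - 6 * c) * P \<le> 1"
  proof -
    have c2: "0 \<le> c * c" "c * c \<le> c / 2" "0 \<le> c * c * c" "c * c * c \<le> c * c / 2"
      using c mult_left_mono[of c "1/2" c] mult_left_mono[of c "1/2" "c * c"] by auto
    have "0 \<le> c * ((1 - 2 * c) * (4 - 3 * c))" using c by simp
    also have "\<dots> = 4 * c - 11 * (c * c) + 6 * (c * c * c)" by algebra
    finally have c3: "0 \<le> 4 * c - 11 * (c * c) + 6 * (c * c * c)" .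
    consider "P = 1 + 2 * c + c * c" | "P = 1 - c * c" | "P = 1 - 2 * c + c * c"
      using e f by (auto simp: P_def algebra_simps)
    thus ?thesis
    proof cases
      case 1
      have "(1 + 6 * c) * P = 1 + 8 * c + 13 * (c * c) + 6 * (c * c * c)"
           "(1 - 6 * c) * P = 1 - 4 * c - 11 * (c * c) - 6 * (c * c * c)" unfolding 1 by algebra+
      thus ?thesis using c2 c by linarith
    next
      case 2
      have "(1 + 6 * c) * P = 1 + 6 * c - c * c - 6 * (c * c * c)"
           "(1 - 6 * c) * P = 1 - 6 * c - c * c + 6 * (c * c * c)" unfolding 2 by algebra+
      thus ?thesis using c2 c by linarith
    next
      case 3
      have "(1 + 6 * c) * P = 1 + 4 * c - 11 * (c * c) + 6 * (c * c * c)"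
           "(1 - 6 * c) * P = 1 - 8 * c + 13 * (c * c) - 6 * (c * c * c)" unfolding 3 by algebra+
      thus ?thesis using c2 c3 c by linarith
    qed
  qed
  hence inv: "1 / P \<le> 1 + 6 * c" "1 - 6 * c \<le> 1 / P"
    using P by (simp_all add: pos_divide_le_eq pos_le_divide_eq)
  have key: "d * e * f / P \<le> d * e * f + 6 * d * c"
  proof -
    have "d * e * f * (1 / P - 1) \<le> \<bar>d * e * f * (1 / P - 1)\<bar>" by simp
    also have "\<dots> = d * \<bar>1 / P - 1\<bar>" using e f d by (auto simp: abs_mult)
    also have "\<dots> \<le> d * (6 * c)" by (rule mult_left_mono) (use inv d in auto)
    finally show ?thesis by (simp add: right_diff_distrib)
  qed
  have "P + d * e * f = P * (1 + d * e * f / P)" using P by (simp add: distrib_left)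
  also have "\<dots> \<le> P * exp (d * e * f + 6 * d * c)"
    using P key exp_ge_add_one_self[of "d * e * f + 6 * d * c"] by (intro mult_left_mono) linarith+
  finally show "(1 + c * e) * (1 + c * f) + d * e * f \<le> (1 + c * e) * (1 + c * f) * exp (d * e * f + 6 * d * c)"
    unfolding P_def .
qed

text \<open>
  The second moment of the reduced partition function will have this form; the replica interaction \<open>r\<close> is weak, so it is
  nearly the square of the first moment.
\<close>
lemma spin_avg_two_edge_prod:
  assumes "weak_perturbation N a r p q K \<delta>"
    and a: "\<And>i j. (i, j) \<in> edges N \<Longrightarrow> 0 \<le> a i j \<and> a i j \<le> B / real N"
    and r: "\<And>i j. (i, j) \<in> edges N \<Longrightarrow> 0 \<le> r i j"
    and B: "B / real N \<le> 1 / 2" "B \<ge> 0" "\<delta> \<le> 1 / 4"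
  shows "spin_avg N (\<lambda>\<sigma>. spin_avg N (\<lambda>\<tau>. \<Prod>(i, j)\<in>edges N.
           (1 + a i j * \<sigma> i * \<sigma> j) * (1 + a i j * \<tau> i * \<tau> j) + r i j * (\<sigma> i * \<sigma> j) * (\<tau> i * \<tau> j)))
     \<le> exp (3 * B * \<delta>) * ((spin_avg N (edge_prod N a))\<^sup>2 + 2 * q * \<delta> * (K\<^sup>2 + exp 1))"
proof -
  interpret weak_perturbation N a r p q K \<delta> by fact
  have a1: "\<bar>a i j\<bar> \<le> 1" if "(i, j) \<in> edges N" for i j
    using a[OF that] B(1) by linarith
  have "spin_avg N (\<lambda>\<sigma>. spin_avg N (\<lambda>\<tau>. \<Prod>(i, j)\<in>edges N.
           (1 + a i j * \<sigma> i * \<sigma> j) * (1 + a i j * \<tau> i * \<tau> j) + r i j * (\<sigma> i * \<sigma> j) * (\<tau> i * \<tau> j)))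
     \<le> spin_avg N (\<lambda>\<sigma>. spin_avg N (\<lambda>\<tau>. exp (3 * B * \<delta>) *
         (edge_prod N a \<sigma> * edge_prod N a \<tau> * exp (pair_energy N r (\<lambda>i. \<sigma> i * \<tau> i)))))"
  proof (intro spin_avg_mono)
    fix \<sigma> \<tau> assume \<sigma>: "\<sigma> \<in> spins N" and \<tau>: "\<tau> \<in> spins N"
    have err: "(\<Sum>(i, j)\<in>edges N. 6 * r i j * a i j) \<le> 3 * B * \<delta>"
    proof -
      have "6 * r i j * a i j \<le> 6 * (\<delta> / real N) * (B / real N)" if "(i, j) \<in> edges N" for i j
        by (intro mult_mono) (use a[OF that] R[OF that] r[OF that] \<delta> in auto)
      hence "(\<Sum>(i, j)\<in>edges N. 6 * r i j * a i j) \<le> (real N)\<^sup>2 / 2 * (6 * (\<delta> / real N) * (B / real N))"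
        by (rule sum_edges_bound) (use B \<delta> in auto)
      thus ?thesis using N by (simp add: power2_eq_square field_simps)
    qed
    have "(\<Prod>(i, j)\<in>edges N.
           (1 + a i j * \<sigma> i * \<sigma> j) * (1 + a i j * \<tau> i * \<tau> j) + r i j * (\<sigma> i * \<sigma> j) * (\<tau> i * \<tau> j))
       \<le> (\<Prod>(i, j)\<in>edges N. (1 + a i j * \<sigma> i * \<sigma> j) * (1 + a i j * \<tau> i * \<tau> j) *
        (exp (r i j * (\<sigma> i * \<tau> i) * (\<sigma> j * \<tau> j)) * exp (6 * r i j * a i j)))"
    proof (rule prod_mono, safe)
      fix i j assume ij: "(i, j) \<in> edges N"
      define e where "e = \<sigma> i * \<sigma> j"
      define f where "f = \<tau> i * \<tau> j"
      define c where "c = a i j"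
      define d where "d = r i j"
      have e: "e = 1 \<or> e = -1" unfolding e_def using edges_spins_cases[OF ij \<sigma>] .
      have f: "f = 1 \<or> f = -1" unfolding f_def using edges_spins_cases[OF ij \<tau>] .
      have c: "0 \<le> c" "c \<le> 1 / 2" using a[OF ij] B(1) unfolding c_def by linarith+
      have "\<delta> / real N \<le> \<delta> / 1" using N \<delta> by (intro divide_left_mono) auto
      hence d: "0 \<le> d" "d \<le> 1 / 4" using R[OF ij] r[OF ij] B by (auto simp: d_def)
      note fac = two_replica_factor[OF c d e f]
      show "0 \<le> (1 + a i j * \<sigma> i * \<sigma> j) * (1 + a i j * \<tau> i * \<tau> j) + r i j * (\<sigma> i * \<sigma> j) * (\<tau> i * \<tau> j)"
        using fac(1) by (simp add: c_def d_def e_def f_def mult.assoc)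
      show "(1 + a i j * \<sigma> i * \<sigma> j) * (1 + a i j * \<tau> i * \<tau> j) + r i j * (\<sigma> i * \<sigma> j) * (\<tau> i * \<tau> j)
        \<le> (1 + a i j * \<sigma> i * \<sigma> j) * (1 + a i j * \<tau> i * \<tau> j) *
        (exp (r i j * (\<sigma> i * \<tau> i) * (\<sigma> j * \<tau> j)) * exp (6 * r i j * a i j))"
        using fac(2) by (simp add: c_def d_def e_def f_def exp_add mult_ac)
    qed
    also have "\<dots> = edge_prod N a \<sigma> * edge_prod N a \<tau> * (exp (pair_energy N r (\<lambda>i. \<sigma> i * \<tau> i))
        * exp (\<Sum>(i, j)\<in>edges N. 6 * r i j * a i j))"
      by (simp add: edge_prod_def pair_energy_def exp_sum[OF finite_edges] prod.distrib split_def)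
    also have "\<dots> \<le> edge_prod N a \<sigma> * edge_prod N a \<tau> * (exp (pair_energy N r (\<lambda>i. \<sigma> i * \<tau> i)) * exp (3 * B * \<delta>))"
      using err by (intro mult_left_mono mult_nonneg_nonneg edge_prod_bounds(1)[OF a1 \<sigma>] edge_prod_bounds(1)[OF a1 \<tau>]) auto
    finally show "(\<Prod>(i, j)\<in>edges N.
           (1 + a i j * \<sigma> i * \<sigma> j) * (1 + a i j * \<tau> i * \<tau> j) + r i j * (\<sigma> i * \<sigma> j) * (\<tau> i * \<tau> j))
      \<le> exp (3 * B * \<delta>) * (edge_prod N a \<sigma> * edge_prod N a \<tau> * exp (pair_energy N r (\<lambda>i. \<sigma> i * \<tau> i)))"
      by (simp add: mult_ac)
  qed
  also have "\<dots> = exp (3 * B * \<delta>) * spin_avg N (\<lambda>\<sigma>. spin_avg N (\<lambda>\<tau>.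
         edge_prod N a \<sigma> * edge_prod N a \<tau> * exp (pair_energy N r (\<lambda>i. \<sigma> i * \<tau> i))))"
    by (simp only: spin_avg_cmult)
  also have "\<dots> \<le> exp (3 * B * \<delta>) * ((spin_avg N (edge_prod N a))\<^sup>2 + 2 * q * \<delta> * (K\<^sup>2 + exp 1))"
    by (intro mult_left_mono spin_avg_two_le edge_prod_bounds a1) auto
  finally show ?thesis .
qed

section \<open>Sampling a graphon on the uniform grid\<close>

text \<open>
  The closed cells of the grid are the intervals of a tagged division, with the grid point \<open>i / N\<close> as a corner; the half-open
  cells are disjoint and carry the step functions.
\<close>
definition cell :: "nat \<Rightarrow> nat \<Rightarrow> real set" where
  "cell N i = {(real i - 1) / real N .. real i / real N}"

definition ocell :: "nat \<Rightarrow> nat \<Rightarrow> real set" where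
  "ocell N i = {(real i - 1) / real N <.. real i / real N}"

lemma cell_subset: "i \<in> {1..N} \<Longrightarrow> cell N i \<subseteq> {0..1}"
  by (auto simp: cell_def divide_simps intro: order_trans[rotated])

lemma ocell_subset_cell: "ocell N i \<subseteq> cell N i"
  by (auto simp: cell_def ocell_def)

lemma cell_prod_eq_cbox:
  "cell N i \<times> cell N j = cbox ((real i - 1) / real N, (real j - 1) / real N) (real i / real N, real j / real N)"
  by (simp add: cell_def cbox_Pair_eq)

lemma measure_cell_prod: "N \<ge> 1 \<Longrightarrow> measure lborel (cell N i \<times> cell N j) = 1 / (real N)\<^sup>2"
  unfolding cell_prod_eq_cbox content_Pair
  by (simp add: divide_right_mono diff_divide_distrib[symmetric] power2_eq_square)

lemma ocell_disjoint: "i \<noteq> j \<Longrightarrow> ocell N i \<inter> ocell N j = {}"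
proof -
  have "ocell N i \<inter> ocell N j = {}" if "i < j" for i j
  proof -
    have "real i / real N \<le> (real j - 1) / real N" using that by (intro divide_right_mono) auto
    thus ?thesis by (auto simp: ocell_def)
  qed
  thus "i \<noteq> j \<Longrightarrow> ocell N i \<inter> ocell N j = {}" by (metis Int_commute nat_neq_iff)
qed

lemma interior_cell_disjoint: "i \<noteq> j \<Longrightarrow> interior (cell N i) \<inter> interior (cell N j) = {}"
proof -
  have "interior (cell N i) \<subseteq> ocell N i" for i
    by (auto simp: cell_def ocell_def interior_atLeastAtMost_real)
  thus "i \<noteq> j \<Longrightarrow> interior (cell N i) \<inter> interior (cell N j) = {}"
    using ocell_disjoint[of i j N] by blast
qed

lemma Union_cell: "N \<ge> 1 \<Longrightarrow> (\<Union>i\<in>{1..N}. cell N i) = {0..1}"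
proof
  assume N: "N \<ge> 1"
  show "(\<Union>i\<in>{1..N}. cell N i) \<subseteq> {0..1}" using cell_subset by blast
  show "{0..1} \<subseteq> (\<Union>i\<in>{1..N}. cell N i)"
  proof
    fix x :: real assume x: "x \<in> {0..1}"
    define i where "i = max 1 (nat \<lceil>real N * x\<rceil>)"
    have xN: "0 \<le> real N * x" "real N * x \<le> real N" using x N by (auto intro: mult_left_le)
    have "i \<in> {1..N}" using xN N by (auto simp: i_def ceiling_le_iff nat_le_iff)
    moreover have "real i - 1 \<le> real N * x" "real N * x \<le> real i"
      using xN by (auto simp: i_def max_def; linarith)+
    hence "x \<in> cell N i" using N by (auto simp: cell_def field_simps)
    ultimately show "x \<in> (\<Union>i\<in>{1..N}. cell N i)" by blast
  qed
qed

text \<open>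
  The number in Riemann's condition is the gauge integral, as balls of a fixed radius form a gauge.
\<close>
lemma Riemann_integrable_has_integral:
  assumes f: "f Riemann_integrable_on (cbox a b)"
    and g: "(f has_integral I) (cbox a b)" and e: "e > 0"
  shows "\<exists>d>0. \<forall>D. D tagged_division_of (cbox a b) \<and> (\<lambda>x. ball x d) fine D \<longrightarrow>
      \<bar>(\<Sum>(x, K)\<in>D. measure lborel K * f x) - I\<bar> < e"
proof -
  obtain J where J: "\<And>e. e > 0 \<Longrightarrow> \<exists>d>0. \<forall>D. D tagged_division_of (cbox a b) \<and> (\<lambda>x. ball x d) fine D \<longrightarrow>
      \<bar>(\<Sum>(x, K)\<in>D. measure lborel K * f x) - J\<bar> < e"
    using f unfolding Riemann_integrable_on_def by blast
  have "(f has_integral J) (cbox a b)"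
    unfolding has_integral
  proof (intro allI impI)
    fix e :: real assume "e > 0"
    from J[OF this] obtain d where d: "d > 0" "\<And>D. D tagged_division_of (cbox a b) \<and> (\<lambda>x. ball x d) fine D \<Longrightarrow>
      \<bar>(\<Sum>(x, K)\<in>D. measure lborel K * f x) - J\<bar> < e" by blast
    show "\<exists>\<gamma>. gauge \<gamma> \<and> (\<forall>D. D tagged_division_of cbox a b \<and> \<gamma> fine D \<longrightarrow>
              norm ((\<Sum>(x, k)\<in>D. measure lborel k *\<^sub>R f x) - J) < e)"
      by (rule exI[of _ "\<lambda>x. ball x d"]) (use d in \<open>auto intro: gauge_ball\<close>)
  qed
  with g have "J = I" by (rule has_integral_unique[rotated])
  with J[OF e] show ?thesis by simp
qed

lemma graphon_has_integral:
  assumes "graphon W"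
  shows "(case_prod W has_integral graphon_integral W) ({0..1} \<times> {0..1})"
  unfolding graphon_integral_def
proof (rule has_integral_integral_lebesgue_on)
  have S: "{0..1::real} \<times> {0..1::real} = cbox (0, 0) (1, 1)" by (simp add: cbox_Pair_eq)
  show "{0..1::real} \<times> {0..1::real} \<in> sets lebesgue" unfolding S by simp
  have fin: "emeasure (lebesgue_on ({0..1::real} \<times> {0..1::real})) ({0..1} \<times> {0..1}) < \<infinity>"
    unfolding S by (simp add: emeasure_restrict_space emeasure_lborel_cbox_eq)
  show "integrable (lebesgue_on ({0..1} \<times> {0..1})) (case_prod W)"
  proof (rule integrableI_bounded_set[where A = "{0..1} \<times> {0..1}" and B = 1])
    show "{0..1::real} \<times> {0..1::real} \<in> sets (lebesgue_on ({0..1} \<times> {0..1}))"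
      unfolding S by (simp add: sets_restrict_space_iff)
    show "case_prod W \<in> borel_measurable (lebesgue_on ({0..1} \<times> {0..1}))"
      using assms by (simp add: graphon_def)
    show "AE x in lebesgue_on ({0..1} \<times> {0..1}). x \<in> {0..1} \<times> {0..1} \<longrightarrow> norm (case_prod W x) \<le> 1"
      using assms by (auto simp: graphon_def intro!: AE_I2)
  qed (use fin in auto)
qed

text \<open>
  Whatever the tags, the cells form a tagged division that is fine for balls of any radius larger than \<open>2 / N\<close>.
\<close>
lemma eventually_grid_Riemann_sum:
  assumes W: "graphon W" and R: "case_prod W Riemann_integrable_on ({0..1} \<times> {0..1})" and e: "e > 0"
  shows "\<forall>\<^sub>F N in sequentially. \<forall>x y. (\<forall>i\<in>{1..N}. \<forall>j\<in>{1..N}. x i j \<in> cell N i \<and> y i j \<in> cell N j) \<longrightarrow>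
    \<bar>(\<Sum>i=1..N. \<Sum>j=1..N. W (x i j) (y i j)) / (real N)\<^sup>2 - graphon_integral W\<bar> < e"
proof -
  have S: "{0..1::real} \<times> {0..1::real} = cbox (0, 0) (1, 1)" by (simp add: cbox_Pair_eq)
  obtain d where d: "d > 0" "\<And>D. D tagged_division_of ({0..1} \<times> {0..1}) \<Longrightarrow> (\<lambda>x. ball x d) fine D \<Longrightarrow>
      \<bar>(\<Sum>(x, K)\<in>D. measure lborel K * case_prod W x) - graphon_integral W\<bar> < e"
    using Riemann_integrable_has_integral[OF R[unfolded S] graphon_has_integral[OF W, unfolded S] e] unfolding S by blast
  obtain N0 :: nat where N0: "real N0 > 2 / d" using reals_Archimedean2 by blast
  show ?thesis
  proof (rule eventually_sequentiallyI[of "max 1 N0"], intro allI impI)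
    fix N x y assume N: "max 1 N0 \<le> N"
      and xy: "\<forall>i\<in>{1..N}. \<forall>j\<in>{1..N}. x i j \<in> cell N i \<and> y i j \<in> cell N j"
    have N1: "N \<ge> 1" "real N > 2 / d" using N N0 by auto
    hence Nd: "2 / real N < d" using d(1) by (simp add: field_simps)
    define Q where "Q = (\<lambda>(i, j). cell N i \<times> cell N j)"
    define D where "D = (\<lambda>(i, j). ((x i j, y i j), Q (i, j))) ` ({1..N} \<times> {1..N})"
    have Qdis: "interior (Q p) \<inter> interior (Q p') = {}" if "p \<noteq> p'" for p p'
      using that interior_cell_disjoint[of "fst p" "fst p'" N] interior_cell_disjoint[of "snd p" "snd p'" N]
      by (auto simp: Q_def interior_Times split_def prod_eq_iff)
    have "\<not> real i / real N \<le> (real i - 1) / real N" for i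
      using N1(1) by (simp add: not_le divide_strict_right_mono)
    hence Qne: "interior (Q p) \<noteq> {}" for p
      by (auto simp: Q_def interior_Times split_def cell_def interior_atLeastAtMost_real)
    have injQ: "inj Q" using Qdis Qne by (metis inf.idem injI)
    have inj: "inj_on (\<lambda>(i, j). ((x i j, y i j), Q (i, j))) ({1..N} \<times> {1..N})"
      using injQ by (auto simp: inj_on_def)
    have "D tagged_division_of ({0..1} \<times> {0..1})"
    proof (rule tagged_division_ofI)
      show "finite D" by (simp add: D_def)
      show "p \<in> K" if "(p, K) \<in> D" for p K
      proof -
        from that obtain i j where "i \<in> {1..N}" "j \<in> {1..N}" "p = (x i j, y i j)" "K = cell N i \<times> cell N j"
          by (auto simp: D_def Q_def)
        thus ?thesis using xy by simp
      qed
      show "K \<subseteq> {0..1} \<times> {0..1}" if "(p, K) \<in> D" for p K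
      proof -
        from that obtain i j where "i \<in> {1..N}" "j \<in> {1..N}" "K = cell N i \<times> cell N j"
          by (auto simp: D_def Q_def)
        thus ?thesis using cell_subset[of i N] cell_subset[of j N] by blast
      qed
      show "\<exists>a b. K = cbox a b" if "(p, K) \<in> D" for p K
      proof -
        from that obtain i j where "K = cell N i \<times> cell N j" by (auto simp: D_def Q_def)
        thus ?thesis unfolding cell_prod_eq_cbox by blast
      qed
      show "interior K1 \<inter> interior K2 = {}" if "(p1, K1) \<in> D" "(p2, K2) \<in> D" "(p1, K1) \<noteq> (p2, K2)" for p1 K1 p2 K2
      proof -
        from that(1,2) obtain q1 q2 where "(p1, K1) = (\<lambda>(i, j). ((x i j, y i j), Q (i, j))) q1"
          "(p2, K2) = (\<lambda>(i, j). ((x i j, y i j), Q (i, j))) q2" unfolding D_def by blast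
        moreover from this that(3) have "q1 \<noteq> q2" by metis
        ultimately show ?thesis using Qdis[of q1 q2] by (simp add: split_def)
      qed
      have "\<Union>{K. \<exists>x. (x, K) \<in> D} = (\<Union>i\<in>{1..N}. cell N i) \<times> (\<Union>i\<in>{1..N}. cell N i)"
      proof -
        have "{K. \<exists>x. (x, K) \<in> D} = Q ` ({1..N} \<times> {1..N})" by (force simp: D_def)
        thus ?thesis by (auto simp: Q_def)
      qed
      thus "\<Union>{K. \<exists>x. (x, K) \<in> D} = {0..1} \<times> {0..1}" using Union_cell[OF N1(1)] by simp
    qed
    moreover have "(\<lambda>x. ball x d) fine D"
      unfolding fine_def
    proof safe
      fix a b K u v assume "((a, b), K) \<in> D" "(u, v) \<in> K"
      then obtain i j where ij: "i \<in> {1..N}" "j \<in> {1..N}" "a \<in> cell N i" "b \<in> cell N j" "u \<in> cell N i" "v \<in> cell N j"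
      proof -
        assume K: "((a, b), K) \<in> D" and uv: "(u, v) \<in> K"
          and H: "\<And>i j. i \<in> {1..N} \<Longrightarrow> j \<in> {1..N} \<Longrightarrow> a \<in> cell N i \<Longrightarrow> b \<in> cell N j \<Longrightarrow> u \<in> cell N i \<Longrightarrow> v \<in> cell N j \<Longrightarrow> thesis"
        from K obtain i j where ij: "i \<in> {1..N}" "j \<in> {1..N}" "a = x i j" "b = y i j" "K = cell N i \<times> cell N j"
          unfolding D_def Q_def by auto
        show thesis by (rule H[of i j]) (use ij xy uv in simp_all)
      qed
      have dd: "dist s t \<le> 1 / real N" if "s \<in> cell N i" "t \<in> cell N i" for s t i
        using that by (auto simp: cell_def dist_real_def abs_le_iff diff_divide_distrib)
      have "dist (a, b) (u, v) \<le> dist a u + dist b v"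
        by (simp add: dist_prod_def sqrt_sum_squares_le_sum)
      also have "\<dots> \<le> 1 / real N + 1 / real N" using ij by (intro add_mono dd)
      also have "\<dots> < d" using Nd by simp
      finally show "(u, v) \<in> ball (a, b) d" by simp
    qed
    ultimately have "\<bar>(\<Sum>(x, K)\<in>D. measure lborel K * case_prod W x) - graphon_integral W\<bar> < e"
      by (rule d(2))
    also have "(\<Sum>(x, K)\<in>D. measure lborel K * case_prod W x)
        = (\<Sum>(i, j)\<in>{1..N} \<times> {1..N}. 1 / (real N)\<^sup>2 * W (x i j) (y i j))"
      unfolding D_def by (subst sum.reindex[OF inj]) (simp add: split_def Q_def measure_cell_prod[OF N1(1)])
    also have "\<dots> = (\<Sum>i=1..N. \<Sum>j=1..N. W (x i j) (y i j)) / (real N)\<^sup>2"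
      by (simp add: sum.cartesian_product[symmetric] sum_divide_distrib[symmetric] sum_distrib_left[symmetric])
    finally show "\<bar>(\<Sum>i=1..N. \<Sum>j=1..N. W (x i j) (y i j)) / (real N)\<^sup>2 - graphon_integral W\<bar> < e" .
  qed
qed

lemma grid_points_in_cell: "N \<ge> 1 \<Longrightarrow> real i / real N \<in> cell N i"
  by (simp add: cell_def divide_right_mono)

lemma grid_sum_tendsto:
  assumes "graphon W" and "case_prod W Riemann_integrable_on ({0..1} \<times> {0..1})"
  shows "(\<lambda>N. (\<Sum>i=1..N. \<Sum>j=1..N. W (real i / real N) (real j / real N)) / (real N)\<^sup>2) \<longlonglongrightarrow> graphon_integral W"
proof (rule tendstoI)
  fix e :: real assume e: "e > 0"
  show "\<forall>\<^sub>F N in sequentially. dist ((\<Sum>i=1..N. \<Sum>j=1..N. W (real i / real N) (real j / real N)) / (real N)\<^sup>2) (graphon_integral W) < e"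
    using eventually_grid_Riemann_sum[OF assms e] eventually_ge_at_top[of 1]
    by eventually_elim (auto simp: dist_real_def grid_points_in_cell)
qed

text \<open>
  If \<open>c i j\<close> lies, up to a small error, between values of \<open>W\<close> on the cell \<open>(i, j)\<close>, then \<open>c\<close> is close
  to the sampled matrix in \<open>\<ell>\<^sup>1\<close>: compare two Riemann sums whose tags realise the differences.
\<close>
lemma eventually_grid_l1_close:
  assumes W: "graphon W" and R: "case_prod W Riemann_integrable_on ({0..1} \<times> {0..1})" and e: "e > 0"
  shows "\<forall>\<^sub>F N in sequentially. \<forall>c.
    (\<forall>i\<in>{1..N}. \<forall>j\<in>{1..N}. (\<exists>s\<in>cell N i. \<exists>t\<in>cell N j. W s t \<le> c i j + e) \<and> (\<exists>s\<in>cell N i. \<exists>t\<in>cell N j. c i j - e \<le> W s t)) \<longrightarrow>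
    (\<Sum>i=1..N. \<Sum>j=1..N. \<bar>W (real i / real N) (real j / real N) - c i j\<bar>) \<le> 3 * e * (real N)\<^sup>2"
  using eventually_grid_Riemann_sum[OF W R e] eventually_ge_at_top[of 1]
proof eventually_elim
  case (elim N)
  show ?case
  proof (intro allI impI)
    fix c :: "nat \<Rightarrow> nat \<Rightarrow> real"
    assume c: "\<forall>i\<in>{1..N}. \<forall>j\<in>{1..N}. (\<exists>s\<in>cell N i. \<exists>t\<in>cell N j. W s t \<le> c i j + e) \<and> (\<exists>s\<in>cell N i. \<exists>t\<in>cell N j. c i j - e \<le> W s t)"
    define w where "w = (\<lambda>i j. W (real i / real N) (real j / real N))"
    have "\<exists>x y x' y'. x \<in> cell N i \<and> y \<in> cell N j \<and> x' \<in> cell N i \<and> y' \<in> cell N j \<and> \<bar>w i j - c i j\<bar> \<le> W x y - W x' y' + e"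
      if ij: "i \<in> {1..N}" "j \<in> {1..N}" for i j
    proof (cases "w i j \<ge> c i j")
      case True
      from c ij obtain s t where "s \<in> cell N i" "t \<in> cell N j" "W s t \<le> c i j + e" by blast
      with True e elim(2) show ?thesis
        by (intro exI[of _ "real i / real N"] exI[of _ "real j / real N"] exI[of _ s] exI[of _ t])
           (auto simp: w_def grid_points_in_cell)
    next
      case False
      from c ij obtain s t where "s \<in> cell N i" "t \<in> cell N j" "c i j - e \<le> W s t" by blast
      with False e elim(2) show ?thesis
        by (intro exI[of _ s] exI[of _ t] exI[of _ "real i / real N"] exI[of _ "real j / real N"])
           (auto simp: w_def grid_points_in_cell)
    qed
    then obtain x y x' y' where X: "\<And>i j. i \<in> {1..N} \<Longrightarrow> j \<in> {1..N} \<Longrightarrow> x i j \<in> cell N i \<and> y i j \<in> cell N j \<and> x' i j \<in> cell N i \<and> y' i j \<in> cell N j \<and> \<bar>w i j - c i j\<bar> \<le> W (x i j) (y i j) - W (x' i j) (y' i j) + e"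
      by metis
    have "(\<Sum>i=1..N. \<Sum>j=1..N. \<bar>w i j - c i j\<bar>) \<le> (\<Sum>i=1..N. \<Sum>j=1..N. W (x i j) (y i j) - W (x' i j) (y' i j) + e)"
      by (intro sum_mono) (use X in blast)
    also have "\<dots> = (\<Sum>i=1..N. \<Sum>j=1..N. W (x i j) (y i j)) - (\<Sum>i=1..N. \<Sum>j=1..N. W (x' i j) (y' i j)) + e * (real N)\<^sup>2"
      by (simp add: sum.distrib sum_subtractf power2_eq_square)
    also have "\<dots> \<le> 2 * e * (real N)\<^sup>2 + e * (real N)\<^sup>2"
    proof -
      have "\<bar>(\<Sum>i=1..N. \<Sum>j=1..N. W (x i j) (y i j)) / (real N)\<^sup>2 - graphon_integral W\<bar> < e"
        "\<bar>(\<Sum>i=1..N. \<Sum>j=1..N. W (x' i j) (y' i j)) / (real N)\<^sup>2 - graphon_integral W\<bar> < e"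
        by (rule elim(1)[rule_format]; use X in blast)+
      hence "((\<Sum>i=1..N. \<Sum>j=1..N. W (x i j) (y i j)) - (\<Sum>i=1..N. \<Sum>j=1..N. W (x' i j) (y' i j))) / (real N)\<^sup>2 \<le> 2 * e"
        unfolding diff_divide_distrib by linarith
      thus ?thesis using elim(2) by (simp add: pos_divide_le_eq)
    qed
    finally show "(\<Sum>i=1..N. \<Sum>j=1..N. \<bar>W (real i / real N) (real j / real N) - c i j\<bar>) \<le> 3 * e * (real N)\<^sup>2"
      by (simp add: w_def)
  qed
qed

text \<open>The pointwise bound \<open>\<bar>T\<^sub>W f\<bar> \<le> (1 + \<parallel>f\<parallel>\<^sup>2) / 2\<close> shows that the supremum defining the operator norm is
  over a bounded set.\<close>
lemma L2_norm_graphon_op_le: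
  assumes W: "graphon W" and f: "f \<in> L2_fun" "L2_norm f \<le> 1"
  shows "L2_norm (graphon_op W f) \<le> graphon_op_norm W"
  unfolding graphon_op_norm_def
proof (rule cSUP_upper)
  show "f \<in> {f \<in> L2_fun. L2_norm f \<le> 1}" using f by simp
  show "bdd_above ((\<lambda>f. L2_norm (graphon_op W f)) ` {f \<in> L2_fun. L2_norm f \<le> 1})"
  proof (rule bdd_aboveI2)
    fix g assume "g \<in> {f \<in> L2_fun. L2_norm f \<le> 1}"
    hence g: "g \<in> borel_measurable (lebesgue_on {0..1})" "integrable (lebesgue_on {0..1}) (\<lambda>x. (g x)\<^sup>2)"
      "(LINT x|lebesgue_on {0..1}. (g x)\<^sup>2) \<le> 1"
      by (auto simp: L2_fun_def L2_norm_def)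
    have fin: "finite_measure (lebesgue_on {0..1::real})"
      by (rule finite_measureI) (simp add: emeasure_restrict_space)
    interpret finite_measure "lebesgue_on {0..1::real}" by fact
    have m1: "measure (lebesgue_on {0..1::real}) {0..1} = 1"
      by (simp add: measure_restrict_space)
    have bd: "\<bar>graphon_op W g x\<bar> \<le> 1" if x: "x \<in> {0..1}" for x
    proof (cases "integrable (lebesgue_on {0..1}) (\<lambda>y. W x y * g y)")
      case True
      have int: "integrable (lebesgue_on {0..1}) (\<lambda>y. (1 + (g y)\<^sup>2) / 2)" using g(2) by simp
      have "\<bar>LINT y|lebesgue_on {0..1}. W x y * g y\<bar> \<le> (LINT y|lebesgue_on {0..1}. (1 + (g y)\<^sup>2) / 2)"
      proof (rule integral_abs_bound_integral[OF True int])
        fix y assume "y \<in> space (lebesgue_on {0..1::real})"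
        hence "\<bar>W x y\<bar> \<le> 1" using W x by (auto simp: graphon_def abs_le_iff)
        hence "\<bar>W x y * g y\<bar> \<le> \<bar>g y\<bar>" by (simp add: abs_mult mult_left_le_one_le)
        also have "\<dots> \<le> (1 + (g y)\<^sup>2) / 2"
          using sum_squares_bound[of 1 "\<bar>g y\<bar>"] by simp
        finally show "\<bar>W x y * g y\<bar> \<le> (1 + (g y)\<^sup>2) / 2" .
      qed
      also have "\<dots> = (1 + (LINT y|lebesgue_on {0..1}. (g y)\<^sup>2)) / 2" using g(2) m1 by simp
      finally show ?thesis using g(3) by (simp add: graphon_op_def)
    qed (simp add: graphon_op_def not_integrable_integral_eq)
    have "(LINT x|lebesgue_on {0..1}. (graphon_op W g x)\<^sup>2) \<le> 1"
    proof (cases "integrable (lebesgue_on {0..1}) (\<lambda>x. (graphon_op W g x)\<^sup>2)")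
      case True
      have "(LINT x|lebesgue_on {0..1}. (graphon_op W g x)\<^sup>2) \<le> (LINT x|lebesgue_on {0..1::real}. 1)"
        by (rule integral_mono[OF True]) (use bd in \<open>auto simp: abs_square_le_1\<close>)
      thus ?thesis using m1 by simp
    qed (simp add: not_integrable_integral_eq)
    thus "L2_norm (graphon_op W g) \<le> 1" by (simp add: L2_norm_def)
  qed
qed

text \<open>A Borel modification \<open>V\<close> of the graphon gives access to Fubini-type measurability.\<close>
lemma graphon_Borel_modification:
  assumes W: "graphon W"
  obtains V where "V \<in> borel_measurable (borel :: (real \<times> real) measure)"
    "\<And>p. 0 \<le> V p \<and> V p \<le> 1"
    "AE x in lborel. x \<in> {0..1} \<longrightarrow> (AE y in lborel. y \<in> {0..1} \<longrightarrow> W x y = V (x, y))"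
proof -
  have S: "{0..1::real} \<times> {0..1::real} = cbox (0, 0) (1, 1)" by (simp add: cbox_Pair_eq)
  have SL: "{0..1::real} \<times> {0..1::real} \<in> sets lebesgue" unfolding S by simp
  have "(\<lambda>p. indicator ({0..1} \<times> {0..1}) p *\<^sub>R case_prod W p) \<in> borel_measurable lebesgue"
    using W SL by (subst borel_measurable_restrict_space_iff[symmetric]) (auto simp: graphon_def)
  from completion_ex_borel_measurable_real[OF this[unfolded real_scaleR_def]]
  obtain V0 where V0: "V0 \<in> borel_measurable (lborel :: (real \<times> real) measure)"
    "AE p in lborel. indicator ({0..1} \<times> {0..1}) p * case_prod W p = V0 p" by blast
  define V where "V = (\<lambda>p. max 0 (min 1 (V0 p)))"
  have "AE p in lborel \<Otimes>\<^sub>M lborel. p \<in> {0..1} \<times> {0..1} \<longrightarrow> case_prod W p = V p"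
    unfolding lborel_prod using V0(2)
  proof (rule AE_mp, intro AE_I2 impI)
    fix p :: "real \<times> real"
    assume "indicator ({0..1} \<times> {0..1}) p * case_prod W p = V0 p" "p \<in> {0..1} \<times> {0..1}"
    moreover from this(2) have "0 \<le> case_prod W p" "case_prod W p \<le> 1"
      using W by (auto simp: graphon_def)
    ultimately show "case_prod W p = V p" by (auto simp: V_def)
  qed
  hence "AE x in lborel. AE y in lborel. (x, y) \<in> {0..1} \<times> {0..1} \<longrightarrow> W x y = V (x, y)"
    using lborel_pair.AE_pair by fastforce
  hence "AE x in lborel. x \<in> {0..1} \<longrightarrow> (AE y in lborel. y \<in> {0..1} \<longrightarrow> W x y = V (x, y))"
    by (rule AE_mp) auto
  moreover have "V \<in> borel_measurable borel" using V0(1) unfolding V_def by simp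
  moreover have "0 \<le> V p \<and> V p \<le> 1" for p by (auto simp: V_def)
  ultimately show ?thesis using that by blast
qed

text \<open>
  The values of \<open>T\<^sub>W f\<close> agree only almost everywhere with a Borel function, obtained from a Borel modification of \<open>W\<close>; completeness of
  Lebesgue measure makes \<open>T\<^sub>W f\<close> measurable and its integrals computable.
\<close>
lemma integral_lebesgue_on_eq_lborel:
  fixes f g :: "real \<Rightarrow> real"
  assumes [measurable]: "g \<in> borel_measurable borel" and ae: "AE x in lborel. x \<in> {0..1} \<longrightarrow> f x = g x"
  shows "(LINT x|lebesgue_on {0..1}. f x) = (LINT x|lborel. indicator {0..1} x * g x)"
proof -
  have m: "(\<lambda>x. indicator {0..1} x * g x) \<in> borel_measurable borel" by simp
  have m': "(\<lambda>x. indicator {0..1} x * g x) \<in> borel_measurable lebesgue"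
    using m by (simp add: measurable_completion)
  have ae': "AE x in lebesgue. indicator {0..1} x * g x = indicator {0..1} x * f x"
    using AE_completion[OF ae] by (rule AE_mp) (auto simp: indicator_def)
  have "(LINT x|lebesgue_on {0..1}. f x) = (LINT x|lebesgue. indicator {0..1} x * f x)"
    by (subst integral_restrict_space) simp_all
  also have "\<dots> = (LINT x|lebesgue. indicator {0..1} x * g x)"
    by (rule integral_cong_AE[OF borel_measurable_AE[OF m' ae'] m']) (use ae' in auto)
  also have "\<dots> = (LINT x|lborel. indicator {0..1} x * g x)"
    using m by (subst integral_completion) auto
  finally show ?thesis .
qed

lemma ocell_borel [measurable]: "ocell N i \<in> sets borel"
  by (simp add: ocell_def)

lemma measure_ocell: "N \<ge> 1 \<Longrightarrow> measure lborel (ocell N i) = 1 / real N"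
  by (simp add: ocell_def divide_right_mono diff_divide_distrib[symmetric])

lemma ocell_subset: "i \<in> {1..N} \<Longrightarrow> ocell N i \<subseteq> {0..1}"
  using cell_subset ocell_subset_cell by blast

lemma integrable_indicator_ocell_mult:
  fixes g :: "real \<Rightarrow> real"
  assumes "g \<in> borel_measurable borel" "\<And>x. \<bar>g x\<bar> \<le> B"
  shows "integrable lborel (\<lambda>x. indicator (ocell N i) x * g x)"
proof -
  have e: "emeasure lborel (ocell N i) < \<infinity>" by (cases "(real i - 1) / real N \<le> real i / real N") (auto simp: ocell_def)
  have "integrable lborel (\<lambda>x. indicator (ocell N i) x *\<^sub>R g x)"
    by (rule integrableI_bounded_set_indicator[where B = B]) (use assms e in auto)
  thus ?thesis by simp
qed

lemma sum_disjoint_indicator_square: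
  fixes a :: "nat \<Rightarrow> real"
  assumes "finite I" "\<And>i j. i \<in> I \<Longrightarrow> j \<in> I \<Longrightarrow> i \<noteq> j \<Longrightarrow> A i \<inter> A j = {}"
  shows "(\<Sum>i\<in>I. a i * indicator (A i) x)\<^sup>2 = (\<Sum>i\<in>I. (a i)\<^sup>2 * indicator (A i) x)"
  using assms
proof (induction I rule: finite_induct)
  case (insert i I)
  have "(\<Sum>j\<in>I. a j * indicator (A j) x) * indicator (A i) x = 0"
    using insert by (cases "x \<in> A i") (fastforce simp: indicator_def intro!: sum.neutral)+
  hence "a i * indicator (A i) x * (\<Sum>j\<in>I. a j * indicator (A j) x) = 0" by (simp add: mult_ac)
  moreover have "(a i * indicator (A i) x)\<^sup>2 = (a i)\<^sup>2 * indicator (A i) x" by (auto simp: indicator_def)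
  moreover have "(\<Sum>j\<in>I. a j * indicator (A j) x)\<^sup>2 = (\<Sum>j\<in>I. (a j)\<^sup>2 * indicator (A j) x)"
    by (rule insert.IH) (use insert.prems in auto)
  ultimately show ?case
    unfolding sum.insert[OF insert.hyps] power2_sum by simp
qed simp

text \<open>
  Cell averages of \<open>W\<close> form the matrix of the compression of \<open>T\<^sub>W\<close> to step functions on the grid, so its
  operator norm is at most that of \<open>T\<^sub>W\<close>.
\<close>
lemma graphon_cell_averages:
  assumes W: "graphon W" and N: "N \<ge> 1" and e: "e > 0"
  obtains c where "\<And>i j. i \<in> {1..N} \<Longrightarrow> j \<in> {1..N} \<Longrightarrow> 0 \<le> c i j \<and> c i j \<le> 1"
    "\<And>i j. i \<in> {1..N} \<Longrightarrow> j \<in> {1..N} \<Longrightarrow> \<exists>s\<in>cell N i. \<exists>t\<in>cell N j. W s t \<le> c i j + e"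
    "\<And>i j. i \<in> {1..N} \<Longrightarrow> j \<in> {1..N} \<Longrightarrow> \<exists>s\<in>cell N i. \<exists>t\<in>cell N j. c i j - e \<le> W s t"
    "\<And>u. (\<Sum>i=1..N. (u i)\<^sup>2) = 1 \<Longrightarrow> L2_set (\<lambda>i. \<Sum>j=1..N. c i j / real N * u j) {1..N} \<le> graphon_op_norm W"
proof -
  obtain V where V[measurable]: "V \<in> borel_measurable (borel :: (real \<times> real) measure)"
    and V01: "\<And>p. 0 \<le> V p \<and> V p \<le> 1"
    and VW: "AE x in lborel. x \<in> {0..1} \<longrightarrow> (AE y in lborel. y \<in> {0..1} \<longrightarrow> W x y = V (x, y))"
    using graphon_Borel_modification[OF W] by blast
  have V2[measurable]: "V \<in> borel_measurable (borel \<Otimes>\<^sub>M borel)" using V unfolding borel_prod .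
  have Vx: "(\<lambda>y. V (x, y)) \<in> borel_measurable borel" for x by measurable
  define G where "G = (\<lambda>j x. LINT y|lborel. indicator (ocell N j) y * V (x, y))"
  have G[measurable]: "G j \<in> borel_measurable borel" for j
    unfolding G_def by measurable
  have intV: "integrable lborel (\<lambda>y. indicator (ocell N j) y * V (x, y))" for x j
    by (rule integrable_indicator_ocell_mult[where B = 1]) (use Vx V01 in \<open>auto simp: abs_le_iff intro: order_trans[of _ 0]\<close>)
  have int1: "(LINT y|lborel. indicator (ocell N j) y * b) = b / real N" for j and b :: real
    using N by (simp add: measure_ocell)
  have intc: "integrable lborel (\<lambda>y. indicator (ocell N j) y * b)" for j and b :: real
    by (rule integrable_indicator_ocell_mult[where B = "\<bar>b\<bar>"]) auto
  have G01: "0 \<le> G j x \<and> G j x \<le> 1 / real N" for j x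
  proof -
    have "G j x \<le> (LINT y|lborel. indicator (ocell N j) y * 1)"
      unfolding G_def by (rule integral_mono[OF intV intc]) (use V01 in \<open>auto simp: indicator_def\<close>)
    moreover have "0 \<le> G j x" unfolding G_def by (rule Bochner_Integration.integral_nonneg) (use V01 in auto)
    ultimately show ?thesis using int1[of j 1] by simp
  qed
  have G1: "\<bar>G j x\<bar> \<le> 1 / real N" for j x using G01[of j x] by simp
  have intG: "integrable lborel (\<lambda>x. indicator (ocell N i) x * G j x)" for i j
    by (rule integrable_indicator_ocell_mult[OF G G1])
  define c where "c = (\<lambda>i j. (real N)\<^sup>2 * (LINT x|lborel. indicator (ocell N i) x * G j x))"
  have c01: "0 \<le> c i j \<and> c i j \<le> 1" for i j
  proof -
    have "(LINT x|lborel. indicator (ocell N i) x * G j x) \<le> (LINT x|lborel. indicator (ocell N i) x * (1 / real N))"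
      by (rule integral_mono[OF intG intc]) (use G01 in \<open>auto simp: indicator_def\<close>)
    moreover have "0 \<le> (LINT x|lborel. indicator (ocell N i) x * G j x)"
      by (rule Bochner_Integration.integral_nonneg) (use G01 in auto)
    ultimately show ?thesis unfolding int1 c_def using N by (simp add: power2_eq_square field_simps)
  qed
  have lower: "\<exists>s\<in>cell N i. \<exists>t\<in>cell N j. W s t \<le> c i j + e" if ij: "i \<in> {1..N}" "j \<in> {1..N}" for i j
  proof (rule ccontr)
    assume "\<not> ?thesis"
    hence ge: "c i j + e \<le> W s t" if "s \<in> cell N i" "t \<in> cell N j" for s t using that by fastforce
    have "AE x in lborel. indicator (ocell N i) x * ((c i j + e) / real N) \<le> indicator (ocell N i) x * G j x"
      using VW
    proof (rule AE_mp, intro AE_I2 impI)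
      fix x assume x: "x \<in> {0..1} \<longrightarrow> (AE y in lborel. y \<in> {0..1} \<longrightarrow> W x y = V (x, y))"
      show "indicator (ocell N i) x * ((c i j + e) / real N) \<le> indicator (ocell N i) x * G j x"
      proof (cases "x \<in> ocell N i")
        case True
        hence WV: "AE y in lborel. y \<in> {0..1} \<longrightarrow> W x y = V (x, y)" using x ocell_subset[OF ij(1)] by blast
        have *: "c i j + e \<le> W x y \<and> y \<in> {0..1}" if "y \<in> ocell N j" for y
          using ge[of x y] True that ocell_subset[OF ij(2)] ocell_subset_cell by blast
        from WV have "AE y in lborel. indicator (ocell N j) y * (c i j + e) \<le> indicator (ocell N j) y * V (x, y)"
          by eventually_elim (use * in \<open>fastforce simp: indicator_def\<close>)
        hence "(LINT y|lborel. indicator (ocell N j) y * (c i j + e)) \<le> G j x"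
          unfolding G_def by (rule integral_mono_AE[OF intc intV])
        thus ?thesis using True unfolding int1 by simp
      qed simp
    qed
    hence "(LINT x|lborel. indicator (ocell N i) x * ((c i j + e) / real N)) \<le> (LINT x|lborel. indicator (ocell N i) x * G j x)"
      by (rule integral_mono_AE[OF intc intG])
    hence "c i j + e \<le> c i j" unfolding int1 using N by (simp add: c_def power2_eq_square field_simps)
    thus False using e by simp
  qed
  have upper: "\<exists>s\<in>cell N i. \<exists>t\<in>cell N j. c i j - e \<le> W s t" if ij: "i \<in> {1..N}" "j \<in> {1..N}" for i j
  proof (rule ccontr)
    assume "\<not> ?thesis"
    hence ge: "W s t \<le> c i j - e" if "s \<in> cell N i" "t \<in> cell N j" for s t using that by fastforce
    have "AE x in lborel. indicator (ocell N i) x * G j x \<le> indicator (ocell N i) x * ((c i j - e) / real N)"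
      using VW
    proof (rule AE_mp, intro AE_I2 impI)
      fix x assume x: "x \<in> {0..1} \<longrightarrow> (AE y in lborel. y \<in> {0..1} \<longrightarrow> W x y = V (x, y))"
      show "indicator (ocell N i) x * G j x \<le> indicator (ocell N i) x * ((c i j - e) / real N)"
      proof (cases "x \<in> ocell N i")
        case True
        hence WV: "AE y in lborel. y \<in> {0..1} \<longrightarrow> W x y = V (x, y)" using x ocell_subset[OF ij(1)] by blast
        have *: "W x y \<le> c i j - e \<and> y \<in> {0..1}" if "y \<in> ocell N j" for y
          using ge[of x y] True that ocell_subset[OF ij(2)] ocell_subset_cell by blast
        from WV have "AE y in lborel. indicator (ocell N j) y * V (x, y) \<le> indicator (ocell N j) y * (c i j - e)"
          by eventually_elim (use * in \<open>fastforce simp: indicator_def\<close>)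
        hence "G j x \<le> (LINT y|lborel. indicator (ocell N j) y * (c i j - e))"
          unfolding G_def by (rule integral_mono_AE[OF intV intc])
        thus ?thesis using True unfolding int1 by simp
      qed simp
    qed
    hence "(LINT x|lborel. indicator (ocell N i) x * G j x) \<le> (LINT x|lborel. indicator (ocell N i) x * ((c i j - e) / real N))"
      by (rule integral_mono_AE[OF intG intc])
    hence "c i j \<le> c i j - e" unfolding int1 using N by (simp add: c_def power2_eq_square field_simps)
    thus False using e by simp
  qed
  have norm: "L2_set (\<lambda>i. \<Sum>j=1..N. c i j / real N * u j) {1..N} \<le> graphon_op_norm W"
    if u: "(\<Sum>i=1..N. (u i)\<^sup>2) = 1" for u
  proof -
    define f where "f = (\<lambda>y. \<Sum>j=1..N. sqrt (real N) * u j * indicator (ocell N j) y)"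
    have f[measurable]: "f \<in> borel_measurable borel" unfolding f_def by measurable
    have fsq: "(f y)\<^sup>2 = (\<Sum>j=1..N. (sqrt (real N) * u j)\<^sup>2 * indicator (ocell N j) y)" for y
      unfolding f_def by (rule sum_disjoint_indicator_square) (auto simp: ocell_disjoint)
    have fsup: "indicator {0..1} y * f y = f y" "indicator {0..1} y * (f y)\<^sup>2 = (f y)\<^sup>2" for y
    proof -
      have "f y = 0" if "y \<notin> {0..1}"
      proof -
        have "indicator (ocell N j) y = (0::real)" if "j \<in> {1..N}" for j
          using ocell_subset[OF that] \<open>y \<notin> {0..1}\<close> by (simp only: indicator_def) auto
        thus ?thesis unfolding f_def by (intro sum.neutral) simp
      qed
      thus "indicator {0..1} y * f y = f y" "indicator {0..1} y * (f y)\<^sup>2 = (f y)\<^sup>2"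
        by (auto simp: indicator_def)
    qed
    have fint: "has_bochner_integral lborel (\<lambda>y. (f y)\<^sup>2) 1"
    proof -
      have "has_bochner_integral lborel (\<lambda>y. \<Sum>j=1..N. (sqrt (real N) * u j)\<^sup>2 * indicator (ocell N j) y)
        (\<Sum>j=1..N. (sqrt (real N) * u j)\<^sup>2 * (1 / real N))"
      proof (rule has_bochner_integral_sum)
        fix j
        have "has_bochner_integral lborel (\<lambda>y. indicator (ocell N j) y * (sqrt (real N) * u j)\<^sup>2) ((sqrt (real N) * u j)\<^sup>2 / real N)"
          using has_bochner_integral_integrable[OF intc] int1 by metis
        thus "has_bochner_integral lborel (\<lambda>y. (sqrt (real N) * u j)\<^sup>2 * indicator (ocell N j) y) ((sqrt (real N) * u j)\<^sup>2 * (1 / real N))"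
          by (simp add: mult.commute)
      qed
      moreover have "(\<Sum>j=1..N. (sqrt (real N) * u j)\<^sup>2 * (1 / real N)) = 1"
        using N u by (simp add: power_mult_distrib)
      ultimately show ?thesis by (simp add: fsq)
    qed
    have fm: "f \<in> borel_measurable (lebesgue_on {0..1})"
      by (rule measurable_restrict_space1) (simp add: measurable_completion)
    have fL2: "f \<in> L2_fun"
      unfolding L2_fun_def
    proof (intro CollectI conjI fm)
      have "integrable lebesgue (\<lambda>y. (f y)\<^sup>2)"
        using fint by (subst integrable_completion) (auto simp: has_bochner_integral_iff)
      thus "integrable (lebesgue_on {0..1}) (\<lambda>x. (f x)\<^sup>2)"
        by (subst integrable_restrict_space) (simp_all add: fsup)
    qed
    have fn: "L2_norm f \<le> 1"
    proof -
      have "(LINT x|lebesgue_on {0..1}. (f x)\<^sup>2) = (LINT x|lborel. indicator {0..1} x * (f x)\<^sup>2)"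
        by (rule integral_lebesgue_on_eq_lborel) auto
      thus ?thesis using fint by (simp add: L2_norm_def fsup has_bochner_integral_iff)
    qed
    define g where "g = (\<lambda>x. \<Sum>j=1..N. sqrt (real N) * u j * G j x)"
    have g[measurable]: "g \<in> borel_measurable borel" unfolding g_def by measurable
    have "AE x in lborel. x \<in> {0..1} \<longrightarrow> graphon_op W f x = g x"
      using VW
    proof (rule AE_mp, intro AE_I2 impI)
      fix x :: real assume x: "x \<in> {0..1} \<longrightarrow> (AE y in lborel. y \<in> {0..1} \<longrightarrow> W x y = V (x, y))" "x \<in> {0..1}"
      have "graphon_op W f x = (LINT y|lborel. indicator {0..1} y * (V (x, y) * f y))"
        unfolding graphon_op_def
      proof (rule integral_lebesgue_on_eq_lborel)
        show "(\<lambda>y. V (x, y) * f y) \<in> borel_measurable borel" using Vx f by measurable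
        show "AE y in lborel. y \<in> {0..1} \<longrightarrow> W x y * f y = V (x, y) * f y"
          using x(1)[rule_format, OF x(2)] by eventually_elim simp
      qed
      also have "\<dots> = (LINT y|lborel. (\<Sum>j=1..N. sqrt (real N) * u j * (indicator (ocell N j) y * V (x, y))))"
      proof (rule Bochner_Integration.integral_cong[OF refl])
        fix y
        have "indicator {0..1} y * (V (x, y) * f y) = V (x, y) * f y"
          using fsup(1)[of y] by (simp add: mult.left_commute)
        also have "\<dots> = (\<Sum>j=1..N. sqrt (real N) * u j * (indicator (ocell N j) y * V (x, y)))"
          by (simp add: f_def sum_distrib_left mult_ac)
        finally show "indicator {0..1} y * (V (x, y) * f y) = (\<Sum>j=1..N. sqrt (real N) * u j * (indicator (ocell N j) y * V (x, y)))" .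
      qed
      also have "\<dots> = g x"
        using intV by (subst Bochner_Integration.integral_sum) (auto simp: g_def G_def)
      finally show "graphon_op W f x = g x" .
    qed
    hence "AE x in lborel. x \<in> {0..1} \<longrightarrow> (graphon_op W f x)\<^sup>2 = (g x)\<^sup>2" by (rule AE_mp) auto
    hence gn: "L2_norm (graphon_op W f) = sqrt (LINT x|lborel. indicator {0..1} x * (g x)\<^sup>2)"
      unfolding L2_norm_def by (subst integral_lebesgue_on_eq_lborel) auto
    define B where "B = (\<Sum>j=1..N. \<bar>sqrt (real N) * u j\<bar> * (1 / real N))"
    have gB: "\<bar>g x\<bar> \<le> B" for x
    proof -
      have "\<bar>g x\<bar> \<le> (\<Sum>j=1..N. \<bar>sqrt (real N) * u j * G j x\<bar>)" unfolding g_def by (rule sum_abs)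
      also have "\<dots> \<le> B" unfolding B_def abs_mult[of _ "G _ _"] by (intro sum_mono mult_left_mono G1) auto
      finally show ?thesis .
    qed
    have gB2: "\<bar>(g x)\<^sup>2\<bar> \<le> B\<^sup>2" for x using power_mono[OF gB[of x], of 2] by simp
    have intg: "integrable lborel (\<lambda>x. indicator (ocell N i) x * g x)" for i
      by (rule integrable_indicator_ocell_mult[OF g gB])
    have intg2: "integrable lborel (\<lambda>x. indicator (ocell N i) x * (g x)\<^sup>2)" for i
      by (rule integrable_indicator_ocell_mult[OF _ gB2]) simp
    have v: "(\<Sum>j=1..N. c i j / real N * u j) = sqrt (real N) * (LINT x|lborel. indicator (ocell N i) x * g x)" for i
    proof -
      have "(LINT x|lborel. indicator (ocell N i) x * g x)
          = (LINT x|lborel. (\<Sum>j=1..N. sqrt (real N) * u j * (indicator (ocell N i) x * G j x)))"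
        by (rule Bochner_Integration.integral_cong[OF refl]) (simp add: g_def sum_distrib_left mult_ac)
      also have "\<dots> = (\<Sum>j=1..N. sqrt (real N) * u j * (c i j / (real N)\<^sup>2))"
        using intG N by (subst Bochner_Integration.integral_sum) (auto simp: c_def)
      finally have "sqrt (real N) * (LINT x|lborel. indicator (ocell N i) x * g x)
          = sqrt (real N) * (\<Sum>j=1..N. sqrt (real N) * u j * (c i j / (real N)\<^sup>2))" by simp
      also have "\<dots> = (\<Sum>j=1..N. c i j / real N * u j)"
        unfolding sum_distrib_left
      proof (rule sum.cong[OF refl])
        fix j
        have "sqrt (real N) * (sqrt (real N) * u j * (c i j / (real N)\<^sup>2)) = (sqrt (real N) * sqrt (real N)) * (u j * (c i j / (real N)\<^sup>2))"
          by (simp only: mult_ac)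
        thus "sqrt (real N) * (sqrt (real N) * u j * (c i j / (real N)\<^sup>2)) = c i j / real N * u j"
          using N by (simp add: power2_eq_square)
      qed
      finally show ?thesis by simp
    qed
    have cs: "real N * (LINT x|lborel. indicator (ocell N i) x * g x)\<^sup>2 \<le> (LINT x|lborel. indicator (ocell N i) x * (g x)\<^sup>2)" for i
    proof -
      define a where "a = (LINT x|lborel. indicator (ocell N i) x * g x)"
      define m where "m = real N * a"
      have "0 \<le> (LINT x|lborel. indicator (ocell N i) x * (g x)\<^sup>2 - 2 * m * (indicator (ocell N i) x * g x) + indicator (ocell N i) x * m\<^sup>2)"
      proof (rule Bochner_Integration.integral_nonneg)
        fix x
        have "indicator (ocell N i) x * (g x)\<^sup>2 - 2 * m * (indicator (ocell N i) x * g x) + indicator (ocell N i) x * m\<^sup>2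
          = indicator (ocell N i) x * (g x - m)\<^sup>2" by (simp add: power2_diff algebra_simps)
        thus "0 \<le> indicator (ocell N i) x * (g x)\<^sup>2 - 2 * m * (indicator (ocell N i) x * g x) + indicator (ocell N i) x * m\<^sup>2"
          by simp
      qed
      also have "\<dots> = (LINT x|lborel. indicator (ocell N i) x * (g x)\<^sup>2) - 2 * m * a + m\<^sup>2 / real N"
        using intg intg2 intc by (simp add: measure_ocell[OF N] a_def)
      finally have "a * (a * real N) \<le> (LINT x|lborel. indicator (ocell N i) x * (g x)\<^sup>2)"
        using N by (simp add: m_def power2_eq_square field_simps)
      thus ?thesis unfolding a_def[symmetric] by (simp add: power2_eq_square mult_ac)
    qed
    have "(\<Sum>i=1..N. (\<Sum>j=1..N. c i j / real N * u j)\<^sup>2)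
        = (\<Sum>i=1..N. real N * (LINT x|lborel. indicator (ocell N i) x * g x)\<^sup>2)"
      unfolding v by (simp add: power_mult_distrib)
    also have "\<dots> \<le> (\<Sum>i=1..N. (LINT x|lborel. indicator (ocell N i) x * (g x)\<^sup>2))" by (intro sum_mono cs)
    also have "\<dots> = (LINT x|lborel. (\<Sum>i=1..N. indicator (ocell N i) x * (g x)\<^sup>2))"
      using intg2 by (subst Bochner_Integration.integral_sum) auto
    also have "\<dots> \<le> (LINT x|lborel. indicator {0..1} x * (g x)\<^sup>2)"
    proof (rule integral_mono)
      show "integrable lborel (\<lambda>x. \<Sum>i=1..N. indicator (ocell N i) x * (g x)\<^sup>2)"
        by (intro Bochner_Integration.integrable_sum intg2)
      have "integrable lborel (\<lambda>x. indicator {0..1::real} x *\<^sub>R (g x)\<^sup>2)"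
        by (rule integrableI_bounded_set_indicator[where B = "B\<^sup>2"]) (use gB2 in auto)
      thus "integrable lborel (\<lambda>x. indicator {0..1::real} x * (g x)\<^sup>2)" by simp
      fix x
      have "(\<Sum>i=1..N. indicator (ocell N i) x) \<le> (indicator {0..1} x :: real)"
      proof (cases "\<exists>k\<in>{1..N}. x \<in> ocell N k")
        case True
        then obtain k where k: "k \<in> {1..N}" "x \<in> ocell N k" by blast
        have "(\<Sum>i=1..N. indicator (ocell N i) x) = (\<Sum>i=1..N. if i = k then 1 else 0 :: real)"
        proof (rule sum.cong[OF refl])
          fix i show "indicator (ocell N i) x = (if i = k then 1 else 0 :: real)"
            using k(2) ocell_disjoint[of i k N] by (cases "i = k") (auto simp: indicator_def)
        qed
        also have "\<dots> = 1" using k(1) by simp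
        also have "1 = (indicator {0..1} x :: real)" using k ocell_subset[OF k(1)] by (simp add: indicator_def subset_iff)
        finally show ?thesis by simp
      next
        case False
        hence "(\<Sum>i=1..N. indicator (ocell N i) x) = (0 :: real)" by (intro sum.neutral) (simp only: indicator_def, simp)
        thus ?thesis by simp
      qed
      hence "(\<Sum>i=1..N. indicator (ocell N i) x) * (g x)\<^sup>2 \<le> indicator {0..1} x * (g x)\<^sup>2"
        by (rule mult_right_mono) simp
      thus "(\<Sum>i=1..N. indicator (ocell N i) x * (g x)\<^sup>2) \<le> indicator {0..1} x * (g x)\<^sup>2"
        by (simp only: sum_distrib_right)
    qed
    finally have "L2_set (\<lambda>i. \<Sum>j=1..N. c i j / real N * u j) {1..N} \<le> L2_norm (graphon_op W f)"
      unfolding L2_set_def gn by (rule real_sqrt_le_mono)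
    also have "\<dots> \<le> graphon_op_norm W" by (rule L2_norm_graphon_op_le[OF W fL2 fn])
    finally show ?thesis .
  qed
  show ?thesis by (rule that[of c]) (use c01 lower upper norm in auto)
qed

text \<open>
  The sampled matrix differs from the matrix of cell averages by a matrix of small Frobenius norm, as
  its entries are bounded and small in \<open>\<ell>\<^sup>1\<close>; deleting the diagonal costs \<open>1 / N\<close>.
\<close>
lemma eventually_sampled_op_norm:
  assumes W: "graphon W" and R: "case_prod W Riemann_integrable_on ({0..1} \<times> {0..1})" and e: "e > 0"
  shows "\<forall>\<^sub>F N in sequentially. \<forall>u.
    (\<Sum>i=1..N. (\<Sum>j=1..N. (if i = j then 0 else W (real i / real N) (real j / real N) / real N) * u j)\<^sup>2)
      \<le> (graphon_op_norm W + e)\<^sup>2 * (\<Sum>i=1..N. (u i)\<^sup>2)"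
proof -
  define d where "d = e\<^sup>2 / 12"
  have d: "d > 0" using e by (simp add: d_def)
  obtain N0 :: nat where N0: "real N0 > 2 / e" using reals_Archimedean2 by blast
  show ?thesis
    using eventually_grid_l1_close[OF W R d] eventually_ge_at_top[of "max 1 N0"]
  proof eventually_elim
    case (elim N)
    have N: "N \<ge> 1" using elim by simp
    have "real N > 2 / e" using elim N0 by simp
    hence Ne: "1 / real N \<le> e / 2" using e N by (simp add: field_simps)
    obtain c where c: "\<And>i j. i \<in> {1..N} \<Longrightarrow> j \<in> {1..N} \<Longrightarrow> 0 \<le> c i j \<and> c i j \<le> 1"
      "\<And>i j. i \<in> {1..N} \<Longrightarrow> j \<in> {1..N} \<Longrightarrow> \<exists>s\<in>cell N i. \<exists>t\<in>cell N j. W s t \<le> c i j + d"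
      "\<And>i j. i \<in> {1..N} \<Longrightarrow> j \<in> {1..N} \<Longrightarrow> \<exists>s\<in>cell N i. \<exists>t\<in>cell N j. c i j - d \<le> W s t"
      "\<And>u. (\<Sum>i=1..N. (u i)\<^sup>2) = 1 \<Longrightarrow> L2_set (\<lambda>i. \<Sum>j=1..N. c i j / real N * u j) {1..N} \<le> graphon_op_norm W"
      using graphon_cell_averages[OF W N d] by blast
    define w where "w = (\<lambda>i j. W (real i / real N) (real j / real N))"
    define m where "m = (\<lambda>i j. if i = j then 0 else w i j / real N)"
    have w01: "0 \<le> w i j \<and> w i j \<le> 1" if "i \<in> {1..N}" "j \<in> {1..N}" for i j
      using that W by (auto simp: w_def graphon_def)
    have l1: "(\<Sum>i=1..N. \<Sum>j=1..N. \<bar>w i j - c i j\<bar>) \<le> 3 * d * (real N)\<^sup>2"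
      unfolding w_def using c(2,3) by (intro elim(1)[rule_format]) blast
    have unit: "L2_set (\<lambda>i. \<Sum>j=1..N. m i j * u j) {1..N} \<le> graphon_op_norm W + e"
      if u: "(\<Sum>i=1..N. (u i)\<^sup>2) = 1" for u
    proof -
      define a where "a = (\<lambda>i. \<Sum>j=1..N. c i j / real N * u j)"
      define b where "b = (\<lambda>i. \<Sum>j=1..N. (w i j - c i j) / real N * u j)"
      define f where "f = (\<lambda>i. - (w i i / real N) * u i)"
      have split: "(\<Sum>j=1..N. m i j * u j) = a i + b i + f i" if i: "i \<in> {1..N}" for i
      proof -
        have "(\<Sum>j=1..N. m i j * u j) = (\<Sum>j=1..N. c i j / real N * u j + (w i j - c i j) / real N * u j + (if i = j then f j else 0))"
          by (rule sum.cong) (auto simp: m_def f_def diff_divide_distrib algebra_simps)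
        thus ?thesis using i by (simp add: a_def b_def sum.distrib)
      qed
      have "L2_set (\<lambda>i. \<Sum>j=1..N. m i j * u j) {1..N} = L2_set (\<lambda>i. a i + b i + f i) {1..N}"
        unfolding L2_set_def by (intro arg_cong[where f = sqrt] sum.cong refl arg_cong[where f = "\<lambda>t. t\<^sup>2"] split)
      also have "\<dots> \<le> L2_set (\<lambda>i. a i + b i) {1..N} + L2_set f {1..N}" by (rule L2_set_triangle_ineq)
      also have "L2_set (\<lambda>i. a i + b i) {1..N} \<le> L2_set a {1..N} + L2_set b {1..N}" by (rule L2_set_triangle_ineq)
      also have "L2_set a {1..N} \<le> graphon_op_norm W" unfolding a_def by (rule c(4)[OF u])
      also have "L2_set b {1..N} \<le> e / 2"
      proof -
        have "(\<Sum>i=1..N. (b i)\<^sup>2) \<le> (\<Sum>i=1..N. \<Sum>j=1..N. \<bar>w i j - c i j\<bar> / (real N)\<^sup>2)"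
        proof (rule sum_mono)
          fix i assume i: "i \<in> {1..N}"
          have "(b i)\<^sup>2 \<le> (\<Sum>j=1..N. ((w i j - c i j) / real N)\<^sup>2) * (\<Sum>j=1..N. (u j)\<^sup>2)"
            unfolding b_def by (rule Cauchy_Schwarz_ineq_sum)
          also have "\<dots> = (\<Sum>j=1..N. (w i j - c i j)\<^sup>2 / (real N)\<^sup>2)" unfolding u by (simp add: power_divide)
          also have "\<dots> \<le> (\<Sum>j=1..N. \<bar>w i j - c i j\<bar> / (real N)\<^sup>2)"
          proof (intro sum_mono divide_right_mono)
            fix j assume "j \<in> {1..N}"
            hence "\<bar>w i j - c i j\<bar> \<le> 1" using w01[OF i, of j] c(1)[OF i, of j] by linarith
            hence "\<bar>w i j - c i j\<bar> * \<bar>w i j - c i j\<bar> \<le> 1 * \<bar>w i j - c i j\<bar>" by (rule mult_right_mono) simp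
            thus "(w i j - c i j)\<^sup>2 \<le> \<bar>w i j - c i j\<bar>" by (simp add: power2_eq_square)
          qed simp
          finally show "(b i)\<^sup>2 \<le> (\<Sum>j=1..N. \<bar>w i j - c i j\<bar> / (real N)\<^sup>2)" .
        qed
        also have "\<dots> = (\<Sum>i=1..N. \<Sum>j=1..N. \<bar>w i j - c i j\<bar>) / (real N)\<^sup>2"
          by (simp add: sum_divide_distrib)
        also have "\<dots> \<le> 3 * d" using l1 N by (simp add: pos_divide_le_eq)
        also have "\<dots> = (e / 2)\<^sup>2" by (simp add: d_def power2_eq_square)
        finally have "L2_set b {1..N} \<le> sqrt ((e / 2)\<^sup>2)" unfolding L2_set_def by (rule real_sqrt_le_mono)
        thus ?thesis using e by (simp only: real_sqrt_abs)
      qed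
      also have "L2_set f {1..N} \<le> e / 2"
      proof -
        have "(\<Sum>i=1..N. (f i)\<^sup>2) \<le> (\<Sum>i=1..N. (e / 2)\<^sup>2 * (u i)\<^sup>2)"
        proof (rule sum_mono)
          fix i assume i: "i \<in> {1..N}"
          have "w i i / real N \<le> 1 / real N" using w01[OF i i] by (simp add: divide_right_mono)
          hence "w i i / real N \<le> e / 2" using Ne by linarith
          moreover have "0 \<le> w i i / real N" using w01[OF i i] by simp
          ultimately have "(w i i / real N)\<^sup>2 \<le> (e / 2)\<^sup>2" by (rule power_mono)
          hence "(w i i / real N)\<^sup>2 * (u i)\<^sup>2 \<le> (e / 2)\<^sup>2 * (u i)\<^sup>2" by (rule mult_right_mono) simp
          moreover have "(f i)\<^sup>2 = (w i i / real N)\<^sup>2 * (u i)\<^sup>2"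
            by (simp only: f_def power_mult_distrib power2_minus)
          ultimately show "(f i)\<^sup>2 \<le> (e / 2)\<^sup>2 * (u i)\<^sup>2" by simp
        qed
        also have "\<dots> = (e / 2)\<^sup>2" using u by (simp add: sum_distrib_left[symmetric])
        finally have "L2_set f {1..N} \<le> sqrt ((e / 2)\<^sup>2)" unfolding L2_set_def by (rule real_sqrt_le_mono)
        thus ?thesis using e by (simp only: real_sqrt_abs)
      qed
      finally show ?thesis by simp
    qed
    show ?case
    proof
      fix u :: "nat \<Rightarrow> real"
      define r where "r = sqrt (\<Sum>i=1..N. (u i)\<^sup>2)"
      have rr: "r\<^sup>2 = (\<Sum>i=1..N. (u i)\<^sup>2)" by (simp add: r_def sum_nonneg)
      have "(\<Sum>i=1..N. (\<Sum>j=1..N. m i j * u j)\<^sup>2) \<le> (graphon_op_norm W + e)\<^sup>2 * (\<Sum>i=1..N. (u i)\<^sup>2)"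
      proof (cases "r = 0")
        case True
        hence "(\<Sum>i=1..N. (u i)\<^sup>2) = 0" using rr by simp
        hence "\<forall>i\<in>{1..N}. u i = 0" by (simp add: sum_nonneg_eq_0_iff)
        thus ?thesis by simp
      next
        case False
        have "(\<Sum>i=1..N. (u i / r)\<^sup>2) = 1"
          unfolding power_divide sum_divide_distrib[symmetric] rr[symmetric] using False by simp
        from unit[OF this] have "sqrt (\<Sum>i=1..N. (\<Sum>j=1..N. m i j * (u j / r))\<^sup>2) \<le> graphon_op_norm W + e"
          by (simp add: L2_set_def)
        hence "(\<Sum>i=1..N. (\<Sum>j=1..N. m i j * (u j / r))\<^sup>2) \<le> (graphon_op_norm W + e)\<^sup>2"
          by (rule sqrt_le_D)
        also have "(\<Sum>i=1..N. (\<Sum>j=1..N. m i j * (u j / r))\<^sup>2) = (\<Sum>i=1..N. (\<Sum>j=1..N. m i j * u j)\<^sup>2) / r\<^sup>2"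
          by (simp add: sum_divide_distrib[symmetric] power_divide)
        finally have *: "(\<Sum>i=1..N. (\<Sum>j=1..N. m i j * u j)\<^sup>2) / r\<^sup>2 \<le> (graphon_op_norm W + e)\<^sup>2" .
        have r2: "r\<^sup>2 > 0" using False by simp
        from *[unfolded pos_divide_le_eq[OF r2]] show ?thesis unfolding rr .
      qed
      thus "(\<Sum>i=1..N. (\<Sum>j=1..N. (if i = j then 0 else W (real i / real N) (real j / real N) / real N) * u j)\<^sup>2)
        \<le> (graphon_op_norm W + e)\<^sup>2 * (\<Sum>i=1..N. (u i)\<^sup>2)"
        by (simp only: m_def w_def)
    qed
  qed
qed

section \<open>Convergence in probability\<close>

text \<open>
  The common core of the calculus below: a large deviation of \<open>Z\<close> forces one of \<open>X\<close> or of \<open>Y\<close>.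
\<close>
lemma tendsto_in_prob_squeeze:
  assumes "\<And>\<epsilon>. \<epsilon> > 0 \<Longrightarrow> \<exists>\<delta>>0. \<forall>\<^sub>F N in sequentially. \<forall>\<omega>\<in>set_pmf (p N).
      \<bar>Z N \<omega> - c\<bar> > \<epsilon> \<longrightarrow> \<bar>X N \<omega> - a\<bar> > \<delta> \<or> \<bar>Y N \<omega> - b\<bar> > \<delta>"
    and X: "tendsto_in_prob p X a" and Y: "tendsto_in_prob p Y b"
  shows "tendsto_in_prob p Z c"
  unfolding tendsto_in_prob_def
proof (intro allI impI)
  fix \<epsilon> :: real assume "\<epsilon> > 0"
  from assms(1)[OF this] obtain \<delta> where \<delta>: "\<delta> > 0" and ev: "\<forall>\<^sub>F N in sequentially. \<forall>\<omega>\<in>set_pmf (p N).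
      \<bar>Z N \<omega> - c\<bar> > \<epsilon> \<longrightarrow> \<bar>X N \<omega> - a\<bar> > \<delta> \<or> \<bar>Y N \<omega> - b\<bar> > \<delta>" by blast
  show "(\<lambda>N. measure_pmf.prob (p N) {\<omega>. \<epsilon> < \<bar>Z N \<omega> - c\<bar>}) \<longlonglongrightarrow> 0"
  proof (rule tendsto_sandwich)
    show "\<forall>\<^sub>F N in sequentially. 0 \<le> measure_pmf.prob (p N) {\<omega>. \<epsilon> < \<bar>Z N \<omega> - c\<bar>}" by simp
    show "(\<lambda>N. measure_pmf.prob (p N) {\<omega>. \<delta> < \<bar>X N \<omega> - a\<bar>} + measure_pmf.prob (p N) {\<omega>. \<delta> < \<bar>Y N \<omega> - b\<bar>}) \<longlonglongrightarrow> 0"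
      using X Y \<delta> unfolding tendsto_in_prob_def by (auto intro: tendsto_eq_intros)
    show "\<forall>\<^sub>F N in sequentially. measure_pmf.prob (p N) {\<omega>. \<epsilon> < \<bar>Z N \<omega> - c\<bar>}
      \<le> measure_pmf.prob (p N) {\<omega>. \<delta> < \<bar>X N \<omega> - a\<bar>} + measure_pmf.prob (p N) {\<omega>. \<delta> < \<bar>Y N \<omega> - b\<bar>}"
      using ev
    proof eventually_elim
      case (elim N)
      have "measure_pmf.prob (p N) {\<omega>. \<epsilon> < \<bar>Z N \<omega> - c\<bar>} = measure_pmf.prob (p N) ({\<omega>. \<epsilon> < \<bar>Z N \<omega> - c\<bar>} \<inter> set_pmf (p N))"
        by (simp add: measure_Int_set_pmf)
      also have "\<dots> \<le> measure_pmf.prob (p N) ({\<omega>. \<delta> < \<bar>X N \<omega> - a\<bar>} \<union> {\<omega>. \<delta> < \<bar>Y N \<omega> - b\<bar>})"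
        by (rule measure_pmf.finite_measure_mono) (use elim in auto)
      also have "\<dots> \<le> measure_pmf.prob (p N) {\<omega>. \<delta> < \<bar>X N \<omega> - a\<bar>} + measure_pmf.prob (p N) {\<omega>. \<delta> < \<bar>Y N \<omega> - b\<bar>}"
        by (rule measure_Un_le) auto
      finally show ?case .
    qed
  qed simp
qed

lemma tendsto_in_prob_const:
  assumes "a \<longlonglongrightarrow> c"
  shows "tendsto_in_prob p (\<lambda>N \<omega>. a N) c"
  unfolding tendsto_in_prob_def
proof (intro allI impI)
  fix \<epsilon> :: real assume "\<epsilon> > 0"
  hence "\<forall>\<^sub>F N in sequentially. \<bar>a N - c\<bar> < \<epsilon>"
    using assms by (simp add: tendsto_iff dist_real_def)
  hence "\<forall>\<^sub>F N in sequentially. measure_pmf.prob (p N) {\<omega>. \<epsilon> < \<bar>a N - c\<bar>} = 0"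
    by eventually_elim simp
  thus "(\<lambda>N. measure_pmf.prob (p N) {\<omega>. \<epsilon> < \<bar>a N - c\<bar>}) \<longlonglongrightarrow> 0"
    by (rule tendsto_eventually)
qed

text \<open>
  Continuous mapping. The arithmetic rules are instances.
\<close>
lemma tendsto_in_prob_cont2:
  fixes f :: "real \<Rightarrow> real \<Rightarrow> real"
  assumes X: "tendsto_in_prob p X a" and Y: "tendsto_in_prob p Y b"
    and f: "isCont (\<lambda>z. f (fst z) (snd z)) (a, b)"
  shows "tendsto_in_prob p (\<lambda>N \<omega>. f (X N \<omega>) (Y N \<omega>)) (f a b)"
proof (rule tendsto_in_prob_squeeze[OF _ X Y])
  fix \<epsilon> :: real assume "\<epsilon> > 0"
  with f obtain \<delta> where \<delta>: "\<delta> > 0" "\<And>z. dist z (a, b) < \<delta> \<Longrightarrow> dist (f (fst z) (snd z)) (f a b) < \<epsilon>"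
    unfolding continuous_at_eps_delta by (auto simp: dist_commute)
  have "\<bar>f x y - f a b\<bar> < \<epsilon>" if "\<bar>x - a\<bar> \<le> \<delta> / 3" "\<bar>y - b\<bar> \<le> \<delta> / 3" for x y
  proof -
    have "dist (x, y) (a, b) \<le> \<bar>x - a\<bar> + \<bar>y - b\<bar>"
      by (simp add: dist_prod_def dist_real_def sqrt_sum_squares_le_sum_abs)
    hence "dist (x, y) (a, b) < \<delta>" using that \<delta>(1) by linarith
    from \<delta>(2)[OF this] show ?thesis by (simp add: dist_real_def)
  qed
  thus "\<exists>\<delta>>0. \<forall>\<^sub>F N in sequentially. \<forall>\<omega>\<in>set_pmf (p N). \<epsilon> < \<bar>f (X N \<omega>) (Y N \<omega>) - f a b\<bar> \<longrightarrow>
      \<delta> < \<bar>X N \<omega> - a\<bar> \<or> \<delta> < \<bar>Y N \<omega> - b\<bar>"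
    using \<delta>(1) by (intro exI[of _ "\<delta> / 3"]) (auto simp: not_le[symmetric] intro!: always_eventually, fastforce)
qed

lemma tendsto_in_prob_add:
  "tendsto_in_prob p X a \<Longrightarrow> tendsto_in_prob p Y b \<Longrightarrow> tendsto_in_prob p (\<lambda>N \<omega>. X N \<omega> + Y N \<omega>) (a + b)"
  by (rule tendsto_in_prob_cont2) (auto intro!: continuous_intros)

lemma tendsto_in_prob_diff:
  "tendsto_in_prob p X a \<Longrightarrow> tendsto_in_prob p Y b \<Longrightarrow> tendsto_in_prob p (\<lambda>N \<omega>. X N \<omega> - Y N \<omega>) (a - b)"
  by (rule tendsto_in_prob_cont2) (auto intro!: continuous_intros)

lemma tendsto_in_prob_mult:
  "tendsto_in_prob p X a \<Longrightarrow> tendsto_in_prob p Y b \<Longrightarrow> tendsto_in_prob p (\<lambda>N \<omega>. X N \<omega> * Y N \<omega>) (a * b)"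
  by (rule tendsto_in_prob_cont2) (auto intro!: continuous_intros)

lemma tendsto_in_prob_divide:
  "tendsto_in_prob p X a \<Longrightarrow> tendsto_in_prob p Y b \<Longrightarrow> b \<noteq> 0 \<Longrightarrow> tendsto_in_prob p (\<lambda>N \<omega>. X N \<omega> / Y N \<omega>) (a / b)"
  by (rule tendsto_in_prob_cont2) (auto intro!: continuous_intros)

lemma tendsto_in_prob_max:
  "tendsto_in_prob p X a \<Longrightarrow> tendsto_in_prob p Y b \<Longrightarrow> tendsto_in_prob p (\<lambda>N \<omega>. max (X N \<omega>) (Y N \<omega>)) (max a b)"
  by (rule tendsto_in_prob_cont2) (auto intro!: continuous_intros)

lemma tendsto_in_prob_exp:
  "tendsto_in_prob p X a \<Longrightarrow> tendsto_in_prob p (\<lambda>N \<omega>. exp (X N \<omega>)) (exp a)"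
  using tendsto_in_prob_cont2[of p X a X a "\<lambda>x y. exp x"] by (auto intro!: continuous_intros)

lemma tendsto_in_prob_cong:
  assumes "\<forall>\<^sub>F N in sequentially. \<forall>\<omega>\<in>set_pmf (p N). X N \<omega> = Y N \<omega>" and "tendsto_in_prob p Y c"
  shows "tendsto_in_prob p X c"
proof (rule tendsto_in_prob_squeeze[OF _ assms(2,2)])
  fix \<epsilon> :: real assume e: "\<epsilon> > 0"
  show "\<exists>\<delta>>0. \<forall>\<^sub>F N in sequentially. \<forall>\<omega>\<in>set_pmf (p N). \<epsilon> < \<bar>X N \<omega> - c\<bar> \<longrightarrow>
      \<delta> < \<bar>Y N \<omega> - c\<bar> \<or> \<delta> < \<bar>Y N \<omega> - c\<bar>"
    by (intro exI[of _ \<epsilon>] conjI e, rule eventually_mono[OF assms(1)]) simp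
qed

lemma tendsto_in_prob_dominated:
  assumes "\<forall>\<^sub>F N in sequentially. \<forall>\<omega>\<in>set_pmf (p N). \<bar>X N \<omega> - c\<bar> \<le> Y N \<omega>" and "tendsto_in_prob p Y 0"
  shows "tendsto_in_prob p X c"
proof (rule tendsto_in_prob_squeeze[OF _ assms(2,2)])
  fix \<epsilon> :: real assume e: "\<epsilon> > 0"
  show "\<exists>\<delta>>0. \<forall>\<^sub>F N in sequentially. \<forall>\<omega>\<in>set_pmf (p N). \<epsilon> < \<bar>X N \<omega> - c\<bar> \<longrightarrow>
      \<delta> < \<bar>Y N \<omega> - 0\<bar> \<or> \<delta> < \<bar>Y N \<omega> - 0\<bar>"
    by (intro exI[of _ \<epsilon>] conjI e, rule eventually_mono[OF assms(1)]) force
qed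

lemma tendsto_in_prob_sum:
  assumes "finite I" "\<And>i. i \<in> I \<Longrightarrow> tendsto_in_prob p (X i) (a i)"
  shows "tendsto_in_prob p (\<lambda>N \<omega>. \<Sum>i\<in>I. X i N \<omega>) (\<Sum>i\<in>I. a i)"
  using assms by (induction I rule: finite_induct) (auto intro: tendsto_in_prob_const tendsto_in_prob_add)

lemma tendsto_in_prob_Max:
  assumes "finite I" "I \<noteq> {}" "\<And>i. i \<in> I \<Longrightarrow> tendsto_in_prob p (X i) a"
  shows "tendsto_in_prob p (\<lambda>N \<omega>. Max ((\<lambda>i. X i N \<omega>) ` I)) a"
  using assms
proof (induction I rule: finite_ne_induct)
  case (insert i I)
  have "tendsto_in_prob p (\<lambda>N \<omega>. max (X i N \<omega>) (Max ((\<lambda>i. X i N \<omega>) ` I))) (max a a)"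
    by (rule tendsto_in_prob_max) (use insert in auto)
  thus ?case using insert by simp
qed simp

lemma tendsto_in_prob_markov:
  assumes fin: "\<forall>\<^sub>F N in sequentially. finite (set_pmf (p N))"
    and nn: "\<forall>\<^sub>F N in sequentially. \<forall>\<omega>\<in>set_pmf (p N). 0 \<le> X N \<omega>"
    and lim: "(\<lambda>N. measure_pmf.expectation (p N) (X N)) \<longlonglongrightarrow> 0"
  shows "tendsto_in_prob p X 0"
  unfolding tendsto_in_prob_def
proof (intro allI impI)
  fix \<epsilon> :: real assume e: "\<epsilon> > 0"
  show "(\<lambda>N. measure_pmf.prob (p N) {\<omega>. \<epsilon> < \<bar>X N \<omega> - 0\<bar>}) \<longlonglongrightarrow> 0"
  proof (rule tendsto_sandwich)
    show "\<forall>\<^sub>F N in sequentially. 0 \<le> measure_pmf.prob (p N) {\<omega>. \<epsilon> < \<bar>X N \<omega> - 0\<bar>}" by simp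
    show "(\<lambda>N. measure_pmf.expectation (p N) (X N) / \<epsilon>) \<longlonglongrightarrow> 0" using tendsto_divide[OF lim tendsto_const, of \<epsilon>] e by simp
    show "\<forall>\<^sub>F N in sequentially. measure_pmf.prob (p N) {\<omega>. \<epsilon> < \<bar>X N \<omega> - 0\<bar>} \<le> measure_pmf.expectation (p N) (X N) / \<epsilon>"
      using fin nn
    proof eventually_elim
      case (elim N)
      have "\<epsilon> * measure_pmf.prob (p N) {\<omega>. \<epsilon> < \<bar>X N \<omega> - 0\<bar>} = measure_pmf.expectation (p N) (\<lambda>\<omega>. \<epsilon> * indicator {\<omega>. \<epsilon> < \<bar>X N \<omega> - 0\<bar>} \<omega>)"
        by simp
      also have "\<dots> \<le> measure_pmf.expectation (p N) (X N)"
        by (rule integral_mono_AE)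
           (use elim in \<open>auto intro!: integrable_measure_pmf_finite simp: AE_measure_pmf_iff indicator_def\<close>)
      finally show ?case using e by (simp add: pos_le_divide_eq mult.commute)
    qed
  qed simp
qed

lemma tendsto_in_prob_chebyshev:
  assumes fin: "\<forall>\<^sub>F N in sequentially. finite (set_pmf (p N))"
    and lim: "(\<lambda>N. measure_pmf.expectation (p N) (\<lambda>\<omega>. (X N \<omega> - m N)\<^sup>2)) \<longlonglongrightarrow> 0" and m: "m \<longlonglongrightarrow> c"
  shows "tendsto_in_prob p X c"
proof -
  have "tendsto_in_prob p (\<lambda>N \<omega>. (X N \<omega> - m N)\<^sup>2) 0"
    by (rule tendsto_in_prob_markov[OF fin _ lim]) simp
  moreover have "tendsto_in_prob p (\<lambda>N \<omega>. m N) c" by (rule tendsto_in_prob_const[OF m])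
  ultimately show ?thesis
  proof (rule tendsto_in_prob_squeeze[rotated])
    fix \<epsilon> :: real assume e: "\<epsilon> > 0"
    define \<delta> where "\<delta> = min (\<epsilon> / 2) ((\<epsilon> / 2)\<^sup>2)"
    have d: "\<delta> > 0" using e by (simp add: \<delta>_def)
    have "(x - y)\<^sup>2 > \<delta> \<or> \<bar>y - c\<bar> > \<delta>" if "\<bar>x - c\<bar> > \<epsilon>" for x y
    proof (rule ccontr)
      assume "\<not> ?thesis"
      moreover have "\<delta> \<le> \<epsilon> / 2" "\<delta> \<le> (\<epsilon> / 2)\<^sup>2" by (simp_all add: \<delta>_def)
      ultimately have "(x - y)\<^sup>2 \<le> (\<epsilon> / 2)\<^sup>2" "\<bar>y - c\<bar> \<le> \<epsilon> / 2" by linarith+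
      from this(1) have "\<bar>x - y\<bar> \<le> \<epsilon> / 2" using e by (simp add: abs_le_square_iff[symmetric])
      with \<open>\<bar>y - c\<bar> \<le> \<epsilon> / 2\<close> that show False by linarith
    qed
    thus "\<exists>\<delta>>0. \<forall>\<^sub>F N in sequentially. \<forall>\<omega>\<in>set_pmf (p N).
      \<epsilon> < \<bar>X N \<omega> - c\<bar> \<longrightarrow> \<delta> < \<bar>(X N \<omega> - m N)\<^sup>2 - 0\<bar> \<or> \<delta> < \<bar>m N - c\<bar>"
      using d by (intro exI[of _ \<delta>]) simp
  qed
qed

section \<open>Moments of the random graph\<close>

lemma finite_vertex_pairs:
  "finite {(i, j). 1 \<le> i \<and> i \<le> j \<and> j \<le> (N::nat)}" "finite {(i, j). Suc 0 \<le> i \<and> i \<le> j \<and> j \<le> (N::nat)}"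
  by (rule finite_subset[of _ "{..N} \<times> {..N}"]; auto)+

lemma finite_set_graph_pmf: "finite (set_pmf (graph_pmf N \<theta> W))"
proof -
  have "finite (set_pmf (Pi_pmf {(i, j). 1 \<le> i \<and> i \<le> j \<and> j \<le> N} False
        (\<lambda>(i, j). bernoulli_pmf (\<theta> * W (real i / real N) (real j / real N)))))"
    by (rule finite_subset[OF set_Pi_pmf_subset'[OF finite_vertex_pairs(1)]])
       (auto intro!: finite_PiE_dflt finite_vertex_pairs)
  thus ?thesis by (simp add: graph_pmf_def)
qed

lemma graph_pmf_entries:
  assumes "A \<in> set_pmf (graph_pmf N \<theta> W)"
  shows "A i j = 0 \<or> A i j = 1" "A i j = A j i"
  using assms by (auto simp: graph_pmf_def min.commute max.commute)

lemma integrable_graph_pmf [simp]: "integrable (measure_pmf (graph_pmf N \<theta> W)) f" for f :: "_ \<Rightarrow> real"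
  by (rule integrable_measure_pmf_finite[OF finite_set_graph_pmf])

abbreviation grid_value :: "(real \<Rightarrow> real \<Rightarrow> real) \<Rightarrow> nat \<Rightarrow> nat \<Rightarrow> nat \<Rightarrow> real" where
  "grid_value W N i j \<equiv> W (real i / real N) (real j / real N)"

lemma grid_value_bounds:
  assumes "graphon W" "i \<in> {1..N}" "j \<in> {1..N}"
  shows "0 \<le> grid_value W N i j" "grid_value W N i j \<le> 1" "grid_value W N i j = grid_value W N j i"
proof -
  have "real i / real N \<in> {0..1}" "real j / real N \<in> {0..1}" using assms by auto
  thus "0 \<le> grid_value W N i j" "grid_value W N i j \<le> 1" "grid_value W N i j = grid_value W N j i"
    using assms(1) unfolding graphon_def by fastforce+
qed

text \<open>
  Independence of the entries above the diagonal.
\<close>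
lemma expectation_prod_graph:
  fixes f :: "nat \<Rightarrow> nat \<Rightarrow> real \<Rightarrow> real"
  assumes W: "graphon W" and \<theta>: "0 \<le> \<theta>" "\<theta> \<le> 1"
    and f: "\<And>i j. (i, j) \<in> edges N \<Longrightarrow> 0 \<le> f i j 0 \<and> 0 \<le> f i j 1"
  shows "measure_pmf.expectation (graph_pmf N \<theta> W) (\<lambda>A. \<Prod>(i, j)\<in>edges N. f i j (A i j))
    = (\<Prod>(i, j)\<in>edges N. \<theta> * grid_value W N i j * f i j 1 + (1 - \<theta> * grid_value W N i j) * f i j 0)"
proof -
  define P where "P = {(i, j). 1 \<le> i \<and> i \<le> j \<and> j \<le> N}"
  define g where "g = (\<lambda>(i, j) x. if i < j then f i j (of_bool x) else 1)"
  have fin: "finite P" unfolding P_def by (rule finite_vertex_pairs(1))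
  have sub: "edges N \<subseteq> P" by (auto simp: edges_def P_def)
  have mem: "(i, j) \<in> edges N" if "(i, j) \<in> P" "i < j" for i j using that by (auto simp: edges_def P_def)
  have pr: "0 \<le> \<theta> * grid_value W N i j \<and> \<theta> * grid_value W N i j \<le> 1" if "(i, j) \<in> P" for i j
    using that grid_value_bounds[OF W, of i N j] \<theta> by (auto simp: P_def intro!: mult_le_one)
  have "measure_pmf.expectation (graph_pmf N \<theta> W) (\<lambda>A. \<Prod>(i, j)\<in>edges N. f i j (A i j))
      = measure_pmf.expectation (Pi_pmf P False (\<lambda>(i, j). bernoulli_pmf (\<theta> * grid_value W N i j)))
          (\<lambda>\<omega>. \<Prod>(i, j)\<in>edges N. f i j (of_bool (\<omega> (min i j, max i j))))"
    by (simp add: graph_pmf_def P_def)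
  also have "(\<lambda>\<omega>. \<Prod>(i, j)\<in>edges N. f i j (of_bool (\<omega> (min i j, max i j)))) = (\<lambda>\<omega>. \<Prod>x\<in>P. g x (\<omega> x))"
  proof
    fix \<omega> :: "nat \<times> nat \<Rightarrow> bool"
    have "(\<Prod>x\<in>P. g x (\<omega> x)) = (\<Prod>x\<in>edges N. g x (\<omega> x))"
      by (rule prod.mono_neutral_right[OF fin sub]) (use mem in \<open>auto simp: g_def\<close>)
    also have "\<dots> = (\<Prod>(i, j)\<in>edges N. f i j (of_bool (\<omega> (min i j, max i j))))"
      by (rule prod.cong) (auto simp: g_def edges_def)
    finally show "(\<Prod>(i, j)\<in>edges N. f i j (of_bool (\<omega> (min i j, max i j)))) = (\<Prod>x\<in>P. g x (\<omega> x))" by simp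
  qed
  also have "measure_pmf.expectation (Pi_pmf P False (\<lambda>(i, j). bernoulli_pmf (\<theta> * grid_value W N i j))) (\<lambda>\<omega>. \<Prod>x\<in>P. g x (\<omega> x))
    = (\<Prod>x\<in>P. measure_pmf.expectation ((\<lambda>(i, j). bernoulli_pmf (\<theta> * grid_value W N i j)) x) (g x))"
    by (rule expectation_prod_Pi_pmf[OF fin])
       (use f mem in \<open>auto simp: g_def split_def intro!: integrable_measure_pmf_finite\<close>)
  also have "\<dots> = (\<Prod>x\<in>edges N. measure_pmf.expectation ((\<lambda>(i, j). bernoulli_pmf (\<theta> * grid_value W N i j)) x) (g x))"
  proof (rule prod.mono_neutral_right[OF fin sub], safe)
    fix i j assume ij: "(i, j) \<in> P" "(i, j) \<notin> edges N"
    hence "\<not> i < j" using mem by blast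
    thus "measure_pmf.expectation (bernoulli_pmf (\<theta> * grid_value W N i j)) (g (i, j)) = 1"
      by (simp add: g_def)
  qed
  also have "\<dots> = (\<Prod>(i, j)\<in>edges N. \<theta> * grid_value W N i j * f i j 1 + (1 - \<theta> * grid_value W N i j) * f i j 0)"
  proof (rule prod.cong[OF refl], safe)
    fix i j assume ij: "(i, j) \<in> edges N"
    hence "i < j" by (simp add: edges_def)
    moreover have "0 \<le> \<theta> * grid_value W N i j" "\<theta> * grid_value W N i j \<le> 1" using pr ij sub by blast+
    ultimately show "measure_pmf.expectation (bernoulli_pmf (\<theta> * grid_value W N i j)) (g (i, j))
      = \<theta> * grid_value W N i j * f i j 1 + (1 - \<theta> * grid_value W N i j) * f i j 0"
      by (simp add: g_def mult.commute)
  qed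
  finally show ?thesis .
qed

lemma expectation_loop:
  assumes W: "graphon W" and \<theta>: "0 \<le> \<theta>" "\<theta> \<le> 1" and i: "i \<in> {1..N}"
  shows "measure_pmf.expectation (graph_pmf N \<theta> W) (\<lambda>A. A i i) = \<theta> * grid_value W N i i"
proof -
  define P where "P = {(i, j). 1 \<le> i \<and> i \<le> j \<and> j \<le> N}"
  have "measure_pmf.expectation (graph_pmf N \<theta> W) (\<lambda>A. A i i)
      = measure_pmf.expectation (map_pmf (\<lambda>\<omega>. \<omega> (i, i)) (Pi_pmf P False (\<lambda>(i, j). bernoulli_pmf (\<theta> * grid_value W N i j)))) of_bool"
    by (simp add: graph_pmf_def P_def)
  also have "map_pmf (\<lambda>\<omega>. \<omega> (i, i)) (Pi_pmf P False (\<lambda>(i, j). bernoulli_pmf (\<theta> * grid_value W N i j)))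
      = bernoulli_pmf (\<theta> * grid_value W N i i)"
    using i by (subst Pi_pmf_component) (auto simp: P_def finite_vertex_pairs)
  also have "measure_pmf.expectation \<dots> of_bool = \<theta> * grid_value W N i i"
    using grid_value_bounds[OF W i i] \<theta> by (simp add: mult_le_one)
  finally show ?thesis .
qed

definition edge_count :: "nat \<Rightarrow> (nat \<Rightarrow> nat \<Rightarrow> real) \<Rightarrow> real" where
  "edge_count N A = (\<Sum>(i, j)\<in>edges N. A i j)"

definition loop_count :: "nat \<Rightarrow> (nat \<Rightarrow> nat \<Rightarrow> real) \<Rightarrow> real" where
  "loop_count N A = (\<Sum>i=1..N. A i i)"

lemma expectation_loop_count:
  assumes "graphon W" "0 \<le> \<theta>" "\<theta> \<le> 1"
  shows "measure_pmf.expectation (graph_pmf N \<theta> W) (loop_count N) \<le> real N * \<theta>"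
proof -
  have "measure_pmf.expectation (graph_pmf N \<theta> W) (loop_count N) = (\<Sum>i=1..N. \<theta> * grid_value W N i i)"
    unfolding loop_count_def by (subst Bochner_Integration.integral_sum) (simp_all add: expectation_loop[OF assms])
  also have "\<dots> \<le> (\<Sum>i=1..N. \<theta> * 1)"
    using grid_value_bounds(2)[OF assms(1)] assms(2) by (intro sum_mono mult_left_mono) auto
  finally show ?thesis by simp
qed

lemma expectation_edge:
  assumes "graphon W" "0 \<le> \<theta>" "\<theta> \<le> 1" "(i, j) \<in> edges N" "(k, l) \<in> edges N"
  shows "measure_pmf.expectation (graph_pmf N \<theta> W) (\<lambda>A. A i j) = \<theta> * grid_value W N i j"
    and "(k, l) \<noteq> (i, j) \<Longrightarrow> measure_pmf.expectation (graph_pmf N \<theta> W) (\<lambda>A. A i j * A k l)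
      = (\<theta> * grid_value W N i j) * (\<theta> * grid_value W N k l)"
proof -
  have m1: "measure_pmf.expectation (graph_pmf N \<theta> W) (\<lambda>A. \<Prod>(i', j')\<in>edges N. (if (i', j') \<in> E then A i' j' else 1))
    = (\<Prod>(i', j')\<in>edges N. if (i', j') \<in> E then \<theta> * grid_value W N i' j' else 1)" for E
    using expectation_prod_graph[OF assms(1-3), where f = "\<lambda>i' j' x. if (i', j') \<in> E then x else 1" and N = N]
    by (simp add: if_distrib split_def cong: if_cong)
  have m2: "(\<Prod>(i', j')\<in>edges N. (if (i', j') \<in> E then F i' j' else 1)) = (\<Prod>(i', j')\<in>E. F i' j')" if "E \<subseteq> edges N"
    for E and F :: "nat \<Rightarrow> nat \<Rightarrow> real"
    using that by (simp add: split_def prod.inter_restrict[OF finite_edges, symmetric] Int_absorb1)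
  have E: "measure_pmf.expectation (graph_pmf N \<theta> W) (\<lambda>A. \<Prod>(i', j')\<in>E. A i' j')
    = (\<Prod>(i', j')\<in>E. \<theta> * grid_value W N i' j')" if "E \<subseteq> edges N" for E
    unfolding m2[OF that, symmetric] by (rule m1)
  show "measure_pmf.expectation (graph_pmf N \<theta> W) (\<lambda>A. A i j) = \<theta> * grid_value W N i j"
    using E[of "{(i, j)}"] assms by simp
  show "measure_pmf.expectation (graph_pmf N \<theta> W) (\<lambda>A. A i j * A k l)
      = (\<theta> * grid_value W N i j) * (\<theta> * grid_value W N k l)" if "(k, l) \<noteq> (i, j)"
    using E[of "{(i, j), (k, l)}"] assms that by (auto simp: mult_ac)
qed

text \<open>
  The edges are pairwise independent, so the variance is at most the sum of the edge probabilities.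
\<close>
lemma edge_count_moments:
  assumes "graphon W" "0 \<le> \<theta>" "\<theta> \<le> 1"
  shows "measure_pmf.expectation (graph_pmf N \<theta> W) (edge_count N) = \<theta> * (\<Sum>(i, j)\<in>edges N. grid_value W N i j)"
    and "measure_pmf.expectation (graph_pmf N \<theta> W) (\<lambda>A. (edge_count N A - \<theta> * (\<Sum>(i, j)\<in>edges N. grid_value W N i j))\<^sup>2)
      \<le> (real N)\<^sup>2 / 2 * \<theta>"
proof -
  define q where "q = (\<lambda>x. \<theta> * grid_value W N (fst x) (snd x))"
  define X where "X = (\<lambda>x (A :: nat \<Rightarrow> nat \<Rightarrow> real). A (fst x) (snd x))"
  let ?E = "measure_pmf.expectation (graph_pmf N \<theta> W)"
  have q01: "0 \<le> q x" "q x \<le> \<theta>" if "x \<in> edges N" for x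
    using that grid_value_bounds[OF assms(1), of "fst x" N "snd x"] assms(2) edges_memD[of "fst x" "snd x" N]
    by (auto simp: q_def intro!: mult_left_le)
  have EX: "?E (X x) = q x" if "x \<in> edges N" for x
    using expectation_edge(1)[OF assms, of "fst x" "snd x" N "fst x" "snd x"] that by (simp add: X_def q_def)
  have EXX: "?E (\<lambda>A. X x A * X y A) = q x * q y" if "x \<in> edges N" "y \<in> edges N" "x \<noteq> y" for x y
    using expectation_edge(2)[OF assms, of "fst x" "snd x" N "fst y" "snd y"] that
    by (auto simp: X_def q_def prod_eq_iff)
  have EX2: "?E (\<lambda>A. X x A * X x A) = q x" if "x \<in> edges N" for x
  proof -
    have "?E (\<lambda>A. X x A * X x A) = ?E (X x)"
      by (rule integral_cong_AE) (auto simp: AE_measure_pmf_iff X_def dest!: graph_pmf_entries(1)[of _ _ _ _ "fst x" "snd x"])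
    thus ?thesis using EX[OF that] by simp
  qed
  have ec: "edge_count N A = (\<Sum>x\<in>edges N. X x A)" for A by (simp add: edge_count_def X_def split_def)
  have qs: "\<theta> * (\<Sum>(i, j)\<in>edges N. grid_value W N i j) = (\<Sum>x\<in>edges N. q x)"
    by (simp add: q_def split_def sum_distrib_left)
  have E1: "?E (edge_count N) = (\<Sum>x\<in>edges N. q x)"
    unfolding ec by (subst Bochner_Integration.integral_sum) (simp_all add: EX)
  thus "?E (edge_count N) = \<theta> * (\<Sum>(i, j)\<in>edges N. grid_value W N i j)" by (simp add: qs)
  have "?E (\<lambda>A. (edge_count N A - (\<Sum>x\<in>edges N. q x))\<^sup>2)
      = ?E (\<lambda>A. \<Sum>x\<in>edges N. \<Sum>y\<in>edges N. X x A * X y A - q x * X y A - q y * X x A + q x * q y)"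
  proof (rule Bochner_Integration.integral_cong[OF refl])
    fix A
    have "(edge_count N A - (\<Sum>x\<in>edges N. q x))\<^sup>2 = (\<Sum>x\<in>edges N. X x A - q x) * (\<Sum>y\<in>edges N. X y A - q y)"
      by (simp add: ec sum_subtractf power2_eq_square)
    also have "\<dots> = (\<Sum>x\<in>edges N. \<Sum>y\<in>edges N. X x A * X y A - q x * X y A - q y * X x A + q x * q y)"
      by (simp add: sum_product algebra_simps)
    finally show "(edge_count N A - (\<Sum>x\<in>edges N. q x))\<^sup>2 = \<dots>" .
  qed
  also have "\<dots> = (\<Sum>x\<in>edges N. \<Sum>y\<in>edges N. ?E (\<lambda>A. X x A * X y A) - q x * q y)"
    by (simp add: Bochner_Integration.integral_sum EX)
  also have "\<dots> = (\<Sum>x\<in>edges N. \<Sum>y\<in>edges N. if y = x then q x - q x * q x else 0)"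
    by (intro sum.cong refl) (auto simp: EX2 EXX)
  also have "\<dots> = (\<Sum>x\<in>edges N. q x - q x * q x)" by (simp add: finite_edges)
  also have "\<dots> \<le> (\<Sum>(i, j)\<in>edges N. q (i, j))" by (auto intro!: sum_mono)
  also have "\<dots> \<le> (real N)\<^sup>2 / 2 * \<theta>" by (rule sum_edges_bound) (use q01 assms in auto)
  finally show "?E (\<lambda>A. (edge_count N A - \<theta> * (\<Sum>(i, j)\<in>edges N. grid_value W N i j))\<^sup>2) \<le> (real N)\<^sup>2 / 2 * \<theta>"
    by (simp add: qs)
qed

text \<open>
  For \<open>t = tanh x\<close> and a graph without loops this is the spin average of the Gibbs weight \<open>exp (x \<Sum> A\<^sub>i\<^sub>j \<sigma>\<^sub>i \<sigma>\<^sub>j)\<close> divided by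
  \<open>cosh x\<close> for every edge.
\<close>
definition reduced_Z :: "nat \<Rightarrow> real \<Rightarrow> (nat \<Rightarrow> nat \<Rightarrow> real) \<Rightarrow> real" where
  "reduced_Z N t A = spin_avg N (edge_prod N (\<lambda>i j. t * A i j))"

lemma expectation_spin_avg:
  "measure_pmf.expectation (graph_pmf N \<theta> W) (\<lambda>A. spin_avg N (\<lambda>\<sigma>. F \<sigma> A))
    = spin_avg N (\<lambda>\<sigma>. measure_pmf.expectation (graph_pmf N \<theta> W) (F \<sigma>))"
  unfolding spin_avg_def by (simp add: Bochner_Integration.integral_sum)

text \<open>
  For signs \<open>e\<close> and \<open>f\<close> an edge contributes \<open>1 + \<theta> W (t e + t f + t\<^sup>2 e f) = (1 + a e) (1 + a f) + r e f\<close> to the second moment.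
  The replica interaction \<open>r\<close> is the variance of \<open>t A\<^sub>i\<^sub>j\<close>.
\<close>
lemma reduced_Z_moments:
  fixes N :: nat
  assumes W: "graphon W" and \<theta>: "0 \<le> \<theta>" "\<theta> \<le> 1" and t: "0 \<le> t" "t \<le> 1"
  defines "a \<equiv> \<lambda>i j. t * \<theta> * grid_value W N i j"
    and "r \<equiv> \<lambda>i j. t\<^sup>2 * \<theta> * grid_value W N i j * (1 - \<theta> * grid_value W N i j)"
  shows "measure_pmf.expectation (graph_pmf N \<theta> W) (reduced_Z N t) = spin_avg N (edge_prod N a)"
    and "measure_pmf.expectation (graph_pmf N \<theta> W) (\<lambda>A. (reduced_Z N t A)\<^sup>2)
      = spin_avg N (\<lambda>\<sigma>. spin_avg N (\<lambda>\<tau>. \<Prod>(i, j)\<in>edges N.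
           (1 + a i j * \<sigma> i * \<sigma> j) * (1 + a i j * \<tau> i * \<tau> j) + r i j * (\<sigma> i * \<sigma> j) * (\<tau> i * \<tau> j)))"
proof -
  let ?E = "measure_pmf.expectation (graph_pmf N \<theta> W)"
  have nn: "0 \<le> 1 + t * x * \<sigma> i * \<sigma> j" if "\<sigma> \<in> spins N" "(i, j) \<in> edges N" "x = 0 \<or> x = 1" for \<sigma> i j x
    using edges_spins_cases[OF that(2,1)] that(3) t by (auto simp: mult.assoc)
  have "?E (reduced_Z N t) = spin_avg N (\<lambda>\<sigma>. ?E (\<lambda>A. edge_prod N (\<lambda>i j. t * A i j) \<sigma>))"
    unfolding reduced_Z_def by (rule expectation_spin_avg)
  also have "\<dots> = spin_avg N (edge_prod N a)"
  proof (rule spin_avg_cong)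
    fix \<sigma> assume \<sigma>: "\<sigma> \<in> spins N"
    have "?E (\<lambda>A. edge_prod N (\<lambda>i j. t * A i j) \<sigma>) = (\<Prod>(i, j)\<in>edges N. \<theta> * grid_value W N i j * (1 + t * 1 * \<sigma> i * \<sigma> j) + (1 - \<theta> * grid_value W N i j) * (1 + t * 0 * \<sigma> i * \<sigma> j))"
      unfolding edge_prod_def by (rule expectation_prod_graph[OF W \<theta>]) (use nn[OF \<sigma>] in blast)
    also have "\<dots> = edge_prod N a \<sigma>"
      unfolding edge_prod_def by (rule prod.cong) (auto simp: a_def algebra_simps)
    finally show "?E (\<lambda>A. edge_prod N (\<lambda>i j. t * A i j) \<sigma>) = edge_prod N a \<sigma>" .
  qed
  finally show "?E (reduced_Z N t) = spin_avg N (edge_prod N a)" .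
  have "?E (\<lambda>A. (reduced_Z N t A)\<^sup>2) = ?E (\<lambda>A. spin_avg N (\<lambda>\<sigma>. spin_avg N (\<lambda>\<tau>. \<Prod>(i, j)\<in>edges N. (1 + t * A i j * \<sigma> i * \<sigma> j) * (1 + t * A i j * \<tau> i * \<tau> j))))"
    by (simp add: reduced_Z_def edge_prod_def[abs_def] split_def prod.distrib spin_avg_cmult spin_avg_multc power2_eq_square)
  also have "\<dots> = spin_avg N (\<lambda>\<sigma>. spin_avg N (\<lambda>\<tau>. ?E (\<lambda>A. \<Prod>(i, j)\<in>edges N. (1 + t * A i j * \<sigma> i * \<sigma> j) * (1 + t * A i j * \<tau> i * \<tau> j))))"
    by (simp only: expectation_spin_avg)
  also have "\<dots> = spin_avg N (\<lambda>\<sigma>. spin_avg N (\<lambda>\<tau>. \<Prod>(i, j)\<in>edges N.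
           (1 + a i j * \<sigma> i * \<sigma> j) * (1 + a i j * \<tau> i * \<tau> j) + r i j * (\<sigma> i * \<sigma> j) * (\<tau> i * \<tau> j)))"
  proof (intro spin_avg_cong)
    fix \<sigma> \<tau> assume \<sigma>: "\<sigma> \<in> spins N" and \<tau>: "\<tau> \<in> spins N"
    have "?E (\<lambda>A. \<Prod>(i, j)\<in>edges N. (1 + t * A i j * \<sigma> i * \<sigma> j) * (1 + t * A i j * \<tau> i * \<tau> j))
      = (\<Prod>(i, j)\<in>edges N. \<theta> * grid_value W N i j * ((1 + t * 1 * \<sigma> i * \<sigma> j) * (1 + t * 1 * \<tau> i * \<tau> j)) + (1 - \<theta> * grid_value W N i j) * ((1 + t * 0 * \<sigma> i * \<sigma> j) * (1 + t * 0 * \<tau> i * \<tau> j)))"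
      by (rule expectation_prod_graph[OF W \<theta>]) (use nn[OF \<sigma>] nn[OF \<tau>] in \<open>blast intro: mult_nonneg_nonneg\<close>)
    also have "\<dots> = (\<Prod>(i, j)\<in>edges N.
           (1 + a i j * \<sigma> i * \<sigma> j) * (1 + a i j * \<tau> i * \<tau> j) + r i j * (\<sigma> i * \<sigma> j) * (\<tau> i * \<tau> j))"
      by (rule prod.cong) (auto simp: a_def r_def algebra_simps power2_eq_square)
    finally show "?E (\<lambda>A. \<Prod>(i, j)\<in>edges N. (1 + t * A i j * \<sigma> i * \<sigma> j) * (1 + t * A i j * \<tau> i * \<tau> j))
      = (\<Prod>(i, j)\<in>edges N.
           (1 + a i j * \<sigma> i * \<sigma> j) * (1 + a i j * \<tau> i * \<tau> j) + r i j * (\<sigma> i * \<sigma> j) * (\<tau> i * \<tau> j))" .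
  qed
  finally show "?E (\<lambda>A. (reduced_Z N t A)\<^sup>2) = spin_avg N (\<lambda>\<sigma>. spin_avg N (\<lambda>\<tau>. \<Prod>(i, j)\<in>edges N.
           (1 + a i j * \<sigma> i * \<sigma> j) * (1 + a i j * \<tau> i * \<tau> j) + r i j * (\<sigma> i * \<sigma> j) * (\<tau> i * \<tau> j)))" .
qed

section \<open>Hyperbolic functions\<close>

lemma DERIV_id_minus_tanh: "((\<lambda>x. x - tanh x) has_real_derivative (tanh x)\<^sup>2) (at x)" for x :: real
  by (auto intro!: derivative_eq_intros simp: cosh_real_nonzero)

lemma id_minus_tanh_mono: "x \<le> y \<Longrightarrow> x - tanh x \<le> y - tanh y" for x y :: real
  using DERIV_nonneg_imp_nondecreasing[of x y "\<lambda>x. x - tanh x"] DERIV_id_minus_tanh by (meson zero_le_power2)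

lemma tanh_le_self: "0 \<le> x \<Longrightarrow> tanh x \<le> x" for x :: real
  using id_minus_tanh_mono[of 0 x] by simp

lemma abs_tanh_diff_le: "\<bar>tanh x - tanh y\<bar> \<le> \<bar>x - y\<bar>" for x y :: real
proof -
  have "\<bar>tanh x - tanh y\<bar> \<le> \<bar>x - y\<bar>" if "y \<le> x" for x y :: real
    using id_minus_tanh_mono[OF that] that by (auto simp: abs_if)
  from this[of x y] this[of y x] show ?thesis by (cases "y \<le> x") (auto simp: abs_minus_commute)
qed

lemma id_minus_tanh_le_cube: "0 \<le> x \<Longrightarrow> x - tanh x \<le> x ^ 3" for x :: real
proof -
  assume x: "0 \<le> x"
  define f where "f = (\<lambda>y::real. y ^ 3 - (y - tanh y))"
  have "f 0 \<le> f x"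
  proof (rule DERIV_nonneg_imp_nondecreasing[OF x])
    fix y :: real assume y: "0 \<le> y" "y \<le> x"
    have "(f has_real_derivative (3 * y\<^sup>2 - (tanh y)\<^sup>2)) (at y)"
      unfolding f_def by (auto intro!: derivative_eq_intros DERIV_id_minus_tanh)
    moreover have "(tanh y)\<^sup>2 \<le> y\<^sup>2" using tanh_le_self[OF y(1)] y(1) by (intro power_mono) auto
    hence "3 * y\<^sup>2 - (tanh y)\<^sup>2 \<ge> 0" using zero_le_power2[of y] by linarith
    ultimately show "\<exists>d. (f has_real_derivative d) (at y) \<and> d \<ge> 0" by blast
  qed
  thus ?thesis by (simp add: f_def)
qed

lemma ln_cosh_quadratic_approx:
  fixes x y m :: real
  assumes "0 \<le> x" "x \<le> m" "0 \<le> y" "y \<le> m"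
  shows "\<bar>(ln (cosh y) - y\<^sup>2 / 2) - (ln (cosh x) - x\<^sup>2 / 2)\<bar> \<le> m ^ 3 * \<bar>y - x\<bar>"
proof -
  define g where "g = (\<lambda>y::real. ln (cosh y) - y\<^sup>2 / 2)"
  have D: "(g has_real_derivative (tanh z - z)) (at z)" for z
    unfolding g_def by (auto intro!: derivative_eq_intros simp: cosh_real_pos tanh_def)
  have "\<bar>g y - g x\<bar> \<le> m ^ 3 * \<bar>y - x\<bar>" if xy: "0 \<le> x" "x < y" "y \<le> m" for x y
  proof -
    from MVT2[OF xy(2), of g "\<lambda>z. tanh z - z"] D obtain z where z: "x < z" "z < y" "g y - g x = (y - x) * (tanh z - z)" by blast
    have "\<bar>tanh z - z\<bar> \<le> z ^ 3" using id_minus_tanh_le_cube[of z] tanh_le_self[of z] z xy by auto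
    also have "\<dots> \<le> m ^ 3" using z xy by (intro power_mono) auto
    finally have "(y - x) * \<bar>tanh z - z\<bar> \<le> (y - x) * m ^ 3" using xy by (intro mult_left_mono) auto
    thus ?thesis using xy by (simp add: z(3) abs_mult mult.commute)
  qed
  from this[of x y] this[of y x] assms show ?thesis
    unfolding g_def by (cases x y rule: linorder_cases) (auto simp: abs_minus_commute)
qed

lemma exp_eq_cosh_tanh: "e = 1 \<or> e = -1 \<Longrightarrow> exp (x * e) = cosh x * (1 + tanh x * e)" for x e :: real
proof -
  assume e: "e = 1 \<or> e = -1"
  have "cosh x * (1 + tanh x * e) = cosh x + sinh x * e"
    using cosh_real_nonzero[of x] by (simp add: tanh_def field_simps)
  thus ?thesis using e cosh_plus_sinh[of x] cosh_minus_sinh[of x] by auto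
qed

text \<open>
  The entries \<open>A\<^sub>i\<^sub>j\<close> are \<open>0\<close> or \<open>1\<close> and the spins are signs, so \<open>exp (x A\<^sub>i\<^sub>j \<sigma>\<^sub>i \<sigma>\<^sub>j) = cosh x ^ A\<^sub>i\<^sub>j \<cdot> (1 + tanh x \<cdot> A\<^sub>i\<^sub>j \<sigma>\<^sub>i \<sigma>\<^sub>j)\<close>. Loops
  contribute a factor independent of the spins.
\<close>
lemma partition_fun_reduced:
  fixes N :: nat and \<theta> b :: real
  assumes A: "A \<in> set_pmf (graph_pmf N \<theta> W)" and N: "N \<ge> 1"
  defines "x \<equiv> b / (real N * \<theta>)"
  shows "partition_fun N \<theta> A b = exp (x * loop_count N A / 2 + edge_count N A * ln (cosh x)) * reduced_Z N (tanh x) A"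
proof -
  have "partition_fun N \<theta> A b = spin_avg N (\<lambda>\<sigma>. exp (- b * hamiltonian N \<theta> A \<sigma>))"
    by (simp add: partition_fun_def spin_avg_def)
  also have "\<dots> = spin_avg N (\<lambda>\<sigma>. exp (x * loop_count N A / 2 + edge_count N A * ln (cosh x)) * edge_prod N (\<lambda>i j. tanh x * A i j) \<sigma>)"
  proof (rule spin_avg_cong)
    fix \<sigma> assume \<sigma>: "\<sigma> \<in> spins N"
    have "(\<Sum>i=1..N. \<Sum>j=1..N. A i j * \<sigma> i * \<sigma> j) = 2 * (\<Sum>(i, j)\<in>edges N. A i j * \<sigma> i * \<sigma> j) + (\<Sum>i=1..N. A i i * \<sigma> i * \<sigma> i)"
      by (rule sum_full_eq_edges) (simp add: graph_pmf_entries(2)[OF A] mult_ac)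
    also have "(\<Sum>i=1..N. A i i * \<sigma> i * \<sigma> i) = loop_count N A"
      unfolding loop_count_def by (rule sum.cong) (use spins_square[OF \<sigma>] in \<open>auto simp: mult.assoc\<close>)
    finally have LS: "(\<Sum>i=1..N. \<Sum>j=1..N. A i j * \<sigma> i * \<sigma> j) = 2 * (\<Sum>(i, j)\<in>edges N. A i j * \<sigma> i * \<sigma> j) + loop_count N A" .
    have "(\<Sum>(i, j)\<in>edges N. x * (A i j * \<sigma> i * \<sigma> j)) = x * (\<Sum>(i, j)\<in>edges N. A i j * \<sigma> i * \<sigma> j)"
      by (simp add: sum_distrib_left split_def)
    moreover have "- b * (- (1 / (2 * n)) * (2 * P + D)) = b / n * D / 2 + b / n * P" for n P D :: real
      by (cases "n = 0") (simp_all add: field_simps)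
    ultimately have "- b * hamiltonian N \<theta> A \<sigma> = x * loop_count N A / 2 + (\<Sum>(i, j)\<in>edges N. x * (A i j * \<sigma> i * \<sigma> j))"
      unfolding hamiltonian_def LS x_def mult.assoc[of 2] by (simp only:)
    hence "exp (- b * hamiltonian N \<theta> A \<sigma>) = exp (x * loop_count N A / 2) * (\<Prod>(i, j)\<in>edges N. exp (x * (A i j * \<sigma> i * \<sigma> j)))"
      by (simp add: exp_add exp_sum[OF finite_edges] split_def)
    also have "(\<Prod>(i, j)\<in>edges N. exp (x * (A i j * \<sigma> i * \<sigma> j)))
        = (\<Prod>(i, j)\<in>edges N. exp (A i j * ln (cosh x)) * (1 + tanh x * A i j * \<sigma> i * \<sigma> j))"
    proof (rule prod.cong[OF refl], safe)
      fix i j assume ij: "(i, j) \<in> edges N"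
      show "exp (x * (A i j * \<sigma> i * \<sigma> j)) = exp (A i j * ln (cosh x)) * (1 + tanh x * A i j * \<sigma> i * \<sigma> j)"
        using graph_pmf_entries(1)[OF A, of i j] exp_eq_cosh_tanh[OF edges_spins_cases[OF ij \<sigma>], of x]
        by (auto simp: cosh_real_pos mult.assoc)
    qed
    also have "\<dots> = exp (edge_count N A * ln (cosh x)) * edge_prod N (\<lambda>i j. tanh x * A i j) \<sigma>"
      by (simp add: edge_prod_def edge_count_def prod.distrib split_def exp_sum[OF finite_edges, symmetric] sum_distrib_right)
    finally show "exp (- b * hamiltonian N \<theta> A \<sigma>) = exp (x * loop_count N A / 2 + edge_count N A * ln (cosh x)) * edge_prod N (\<lambda>i j. tanh x * A i j) \<sigma>"
      by (simp add: exp_add mult.assoc)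
  qed
  finally show ?thesis by (simp add: spin_avg_cmult reduced_Z_def)
qed

section \<open>The high-temperature regime\<close>

locale high_temperature =
  fixes W :: "real \<Rightarrow> real \<Rightarrow> real" and \<beta> :: real and \<theta> :: "nat \<Rightarrow> real"
  assumes W: "graphon W"
    and R: "case_prod W Riemann_integrable_on ({0..1} \<times> {0..1})"
    and W_pos: "graphon_integral W > 0"
    and \<beta>: "0 < \<beta>" and \<beta>_less: "\<beta> < 1 / graphon_op_norm W"
    and \<theta>: "\<And>N. N \<ge> 1 \<Longrightarrow> 0 < \<theta> N \<and> \<theta> N < 1"
    and growth: "\<exists>C>0. \<forall>\<^sub>F N in sequentially. real N powr (2 / 3) * \<theta> N \<ge> C"
    and \<theta>_0: "\<theta> \<longlonglongrightarrow> 0"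
begin

lemma op_norm: "graphon_op_norm W > 0" "\<beta> * graphon_op_norm W < 1"
proof -
  show *: "graphon_op_norm W > 0" using \<beta> \<beta>_less by (metis less_trans zero_less_divide_1_iff)
  show "\<beta> * graphon_op_norm W < 1" using \<beta>_less * by (simp add: pos_less_divide_eq)
qed

lemma inverse_degree_tendsto: "(\<lambda>N. 1 / (real N * \<theta> N)) \<longlonglongrightarrow> 0"
proof -
  obtain C where C: "C > 0" "\<forall>\<^sub>F N in sequentially. real N powr (2 / 3) * \<theta> N \<ge> C" using growth by blast
  have "(\<lambda>N. real N powr (- (1 / 3)) / C) \<longlonglongrightarrow> 0"
    using C(1) by real_asymp
  moreover have "\<forall>\<^sub>F N in sequentially. norm (1 / (real N * \<theta> N)) \<le> real N powr (- (1 / 3)) / C"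
    using C(2) eventually_ge_at_top[of 1]
  proof eventually_elim
    case (elim N)
    have N: "real N > 0" "\<theta> N > 0" using elim \<theta> by auto
    have "C * real N powr (1 / 3) \<le> (real N powr (2 / 3) * \<theta> N) * real N powr (1 / 3)"
      using elim by (intro mult_right_mono) auto
    also have "\<dots> = real N * \<theta> N" using N by (simp add: powr_add[symmetric] mult.assoc mult.left_commute mult.commute)
    finally have "1 / (real N * \<theta> N) \<le> 1 / (C * real N powr (1 / 3))"
      using N C(1) by (intro divide_left_mono) auto
    also have "\<dots> = real N powr (- (1 / 3)) / C" using N by (simp add: powr_minus divide_simps)
    finally show ?case using N by simp
  qed
  ultimately show ?thesis by (rule Lim_null_comparison[rotated])
qed

text \<open>
  The cube of the lower bound on \<open>N\<^bsup>2/3\<^esup> \<theta>\<close> says that \<open>N\<^sup>2 \<theta>\<^sup>3\<close> is bounded below.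
\<close>
lemma sqrt_sparsity_over_cube_tendsto: "(\<lambda>N. sqrt (\<theta> N) / ((real N)\<^sup>2 * \<theta> N ^ 3)) \<longlonglongrightarrow> 0"
proof -
  obtain C where C: "C > 0" "\<forall>\<^sub>F N in sequentially. real N powr (2 / 3) * \<theta> N \<ge> C" using growth by blast
  have "(\<lambda>N. sqrt (\<theta> N) / C ^ 3) \<longlonglongrightarrow> sqrt 0 / C ^ 3"
    by (intro tendsto_intros \<theta>_0) (use C in auto)
  hence "(\<lambda>N. sqrt (\<theta> N) / C ^ 3) \<longlonglongrightarrow> 0" by simp
  moreover have "\<forall>\<^sub>F N in sequentially. norm (sqrt (\<theta> N) / ((real N)\<^sup>2 * \<theta> N ^ 3)) \<le> sqrt (\<theta> N) / C ^ 3"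
    using C(2) eventually_ge_at_top[of 1]
  proof eventually_elim
    case (elim N)
    have N: "real N > 0" "\<theta> N > 0" using elim \<theta> by auto
    have "C ^ 3 \<le> (real N powr (2 / 3) * \<theta> N) ^ 3" using elim C(1) by (intro power_mono) auto
    also have "\<dots> = (real N powr (2 / 3)) ^ 3 * \<theta> N ^ 3" by (rule power_mult_distrib)
    also have "(real N powr (2 / 3)) ^ 3 = real N powr 2" using N by (simp add: powr_power)
    also have "\<dots> = (real N)\<^sup>2" using N by (simp add: powr_numeral)
    finally have "sqrt (\<theta> N) / ((real N)\<^sup>2 * \<theta> N ^ 3) \<le> sqrt (\<theta> N) / C ^ 3"
      using N C(1) by (intro divide_left_mono mult_pos_pos) auto
    thus ?case using N by simp
  qed
  ultimately show ?thesis by (rule Lim_null_comparison[rotated])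
qed

text \<open>
  The expected value of \<open>t A\<^sub>i\<^sub>j\<close>: the couplings of the mean-field model that arises by averaging over the graph.
\<close>
definition coupling :: "nat \<Rightarrow> real \<Rightarrow> nat \<Rightarrow> nat \<Rightarrow> real" where
  "coupling N b i j = tanh (b / (real N * \<theta> N)) * \<theta> N * grid_value W N i j"

lemma coupling_bounds:
  assumes N: "N \<ge> 1" and b: "0 \<le> b" and ij: "i \<in> {1..N}" "j \<in> {1..N}"
  shows "0 \<le> coupling N b i j" "coupling N b i j \<le> b / real N"
    "0 \<le> tanh (b / (real N * \<theta> N)) * \<theta> N" "tanh (b / (real N * \<theta> N)) * \<theta> N \<le> b / real N"
proof -
  have th: "0 < \<theta> N" using \<theta> N by blast
  have t0: "0 \<le> tanh (b / (real N * \<theta> N))" using b th by simp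
  thus 1: "0 \<le> tanh (b / (real N * \<theta> N)) * \<theta> N" using th by simp
  have "tanh (b / (real N * \<theta> N)) * \<theta> N \<le> (b / (real N * \<theta> N)) * \<theta> N"
    using b th by (intro mult_right_mono tanh_le_self) auto
  thus 2: "tanh (b / (real N * \<theta> N)) * \<theta> N \<le> b / real N" using th by simp
  note g = grid_value_bounds[OF W ij]
  show "0 \<le> coupling N b i j" unfolding coupling_def using 1 g(1) by simp
  have "coupling N b i j \<le> tanh (b / (real N * \<theta> N)) * \<theta> N * 1"
    unfolding coupling_def using 1 g(2) by (intro mult_left_mono) auto
  thus "coupling N b i j \<le> b / real N" using 2 by simp
qed

lemma coupling_diff:
  assumes N: "N \<ge> 1" and ij: "i \<in> {1..N}" "j \<in> {1..N}"
  shows "\<bar>coupling N b' i j - coupling N b i j\<bar> \<le> \<bar>b' - b\<bar> / real N"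
proof -
  have th: "0 < \<theta> N" using \<theta> N by blast
  note g = grid_value_bounds[OF W ij]
  have "\<bar>coupling N b' i j - coupling N b i j\<bar> = \<bar>tanh (b' / (real N * \<theta> N)) - tanh (b / (real N * \<theta> N))\<bar> * (\<theta> N * grid_value W N i j)"
    using th g by (simp add: coupling_def abs_mult left_diff_distrib[symmetric] mult.assoc)
  also have "\<dots> \<le> \<bar>b' / (real N * \<theta> N) - b / (real N * \<theta> N)\<bar> * (\<theta> N * 1)"
    using th g by (intro mult_mono abs_tanh_diff_le) auto
  also have "\<dots> = \<bar>b' - b\<bar> / real N"
    using th N by (simp add: diff_divide_distrib[symmetric] abs_mult)
  finally show ?thesis .
qed

text \<open>Room to spare below the critical temperature: exponential moments of a slightly amplified energy
  are bounded uniformly in \<open>N\<close> and in \<open>b\<close> near \<open>\<beta>\<close>.\<close>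
lemma exponential_moment_bound:
  obtains p b1 K where "p > 1" "b1 > \<beta>"
    "\<forall>\<^sub>F N in sequentially. \<forall>b. 0 \<le> b \<and> b \<le> b1 \<longrightarrow> spin_avg N (\<lambda>\<sigma>. exp (p * pair_energy N (coupling N b) \<sigma>)) \<le> K"
proof -
  define n where "n = graphon_op_norm W"
  define r where "r = \<beta> * n"
  have r: "0 < r" "r < 1" using op_norm \<beta> by (auto simp: r_def n_def)
  \<comment> \<open>One factor \<open>f\<close> is spent on the exponent \<open>p\<close>, one on the range of \<open>b\<close>, one on the error in the operator norm.
    The constant \<open>7\<close> makes \<open>f ^ 3 \<le> 1 + 7 (f - 1) = 2 - r\<close>, hence \<open>f ^ 3 * r \<le> 1 - (1 - r)\<^sup>2 < 1\<close>.\<close>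
  define f where "f = 1 + (1 - r) / 7"
  have f: "f > 1" "f \<le> 2" using r by (auto simp: f_def)
  define \<rho> where "\<rho> = f * (f * \<beta>) * (n + (f - 1) * n)"
  have \<rho>_eq: "\<rho> = f ^ 3 * r" by (simp add: \<rho>_def r_def power3_eq_cube algebra_simps)
  have \<rho>: "0 < \<rho>" "\<rho> < 1"
  proof -
    show "0 < \<rho>" using f r by (simp add: \<rho>_eq)
    define h where "h = f - 1"
    have h: "0 \<le> h" "h \<le> 1" using f by (auto simp: h_def)
    have "h * h \<le> h" "h * h * h \<le> h" using h mult_left_le[of h h] mult_left_le[of "h * h" h] mult_le_one[of h h]
      by (auto simp: mult.assoc intro: order_trans mult_left_le)
    moreover have "f ^ 3 = 1 + 3 * h + 3 * (h * h) + h * h * h"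
      by (simp add: h_def power3_eq_cube algebra_simps)
    ultimately have "f ^ 3 \<le> 1 + 7 * h" by linarith
    also have "\<dots> = 2 - r" by (simp add: h_def f_def)
    finally have "\<rho> \<le> (2 - r) * r" unfolding \<rho>_eq using r by (intro mult_right_mono) auto
    also have "\<dots> = 1 - (1 - r)\<^sup>2" by (simp add: power2_eq_square algebra_simps)
    also have "\<dots> < 1" using r by simp
    finally show "\<rho> < 1" .
  qed
  define B where "B = f * (f * \<beta>)"
  have B: "B > 0" using f \<beta> by (simp add: B_def)
  have e: "(f - 1) * n > 0" using f op_norm by (simp add: n_def)
  have "\<forall>\<^sub>F N in sequentially. \<forall>b. 0 \<le> b \<and> b \<le> f * \<beta> \<longrightarrow> spin_avg N (\<lambda>\<sigma>. exp (f * pair_energy N (coupling N b) \<sigma>)) \<le> exp ((B\<^sup>2 + B ^ 3) / (2 * (1 - \<rho>)))"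
    using eventually_sampled_op_norm[OF W R e] eventually_ge_at_top[of 1]
  proof eventually_elim
    case (elim N)
    show ?case
    proof (intro allI impI)
      fix b assume b: "0 \<le> b \<and> b \<le> f * \<beta>"
      define k where "k = f * (tanh (b / (real N * \<theta> N)) * \<theta> N)"
      define M where "M = (\<lambda>i j. if i = j then 0 else k * grid_value W N i j)"
      have N1: "(1::nat) \<in> {1..N}" using elim by simp
      have k: "0 \<le> k" "k \<le> B / real N"
      proof -
        show "0 \<le> k" unfolding k_def using f coupling_bounds(3)[OF elim(2) _ N1 N1] b by simp
        have "k \<le> f * (b / real N)" unfolding k_def using f coupling_bounds(4)[OF elim(2) _ N1 N1] b by (intro mult_left_mono) auto
        also have "\<dots> \<le> f * (f * \<beta> / real N)" using b f by (intro mult_left_mono divide_right_mono) auto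
        finally show "k \<le> B / real N" by (simp add: B_def)
      qed
      have "spin_avg N (\<lambda>\<sigma>. exp (pair_energy N M \<sigma>)) \<le> exp ((B\<^sup>2 + B ^ 3) / (2 * (1 - \<rho>)))"
      proof (rule spin_avg_exp_energy_le[OF elim(2) _ _ _ _ \<rho>])
        fix i j assume ij: "i \<in> {1..N}" "j \<in> {1..N}"
        note g = grid_value_bounds[OF W ij]
        show "M i j = M j i" using g(3) by (simp add: M_def)
        show "M i i = 0" by (simp add: M_def)
        have "k * grid_value W N i j \<le> B / real N * 1" using g k by (intro mult_mono) auto
        moreover have "0 \<le> k * grid_value W N i j" using g k by simp
        moreover have "0 \<le> B / real N" using B by simp
        ultimately show "\<bar>M i j\<bar> \<le> B / real N" by (simp add: M_def)
      next
        fix u :: "nat \<Rightarrow> real"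
        have I: "(\<Sum>j=1..N. M i j * u j) = (k * real N) * (\<Sum>j=1..N. (if i = j then 0 else grid_value W N i j / real N) * u j)" for i
          unfolding sum_distrib_left by (rule sum.cong) (use elim in \<open>auto simp: M_def\<close>)
        have "(\<Sum>i=1..N. (\<Sum>j=1..N. M i j * u j)\<^sup>2)
          = (k * real N)\<^sup>2 * (\<Sum>i=1..N. (\<Sum>j=1..N. (if i = j then 0 else grid_value W N i j / real N) * u j)\<^sup>2)"
          unfolding I power_mult_distrib[of "k * real N"] sum_distrib_left[symmetric] ..
        also have "\<dots> \<le> (k * real N)\<^sup>2 * ((n + (f - 1) * n)\<^sup>2 * (\<Sum>i=1..N. (u i)\<^sup>2))"
          using elim(1) unfolding n_def by (intro mult_left_mono) auto
        also have "\<dots> \<le> B\<^sup>2 * ((n + (f - 1) * n)\<^sup>2 * (\<Sum>i=1..N. (u i)\<^sup>2))"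
          using k elim(2) by (intro mult_right_mono power_mono mult_nonneg_nonneg sum_nonneg) (auto simp: pos_le_divide_eq)
        also have "\<dots> = \<rho>\<^sup>2 * (\<Sum>i=1..N. (u i)\<^sup>2)" by (simp add: \<rho>_def B_def power_mult_distrib mult_ac)
        finally show "(\<Sum>i=1..N. (\<Sum>j=1..N. M i j * u j)\<^sup>2) \<le> \<rho>\<^sup>2 * (\<Sum>i=1..N. (u i)\<^sup>2)" .
      qed
      moreover have "pair_energy N M \<sigma> = f * pair_energy N (coupling N b) \<sigma>" for \<sigma>
      proof -
        have "pair_energy N M \<sigma> = pair_energy N (\<lambda>i j. f * coupling N b i j) \<sigma>"
          unfolding pair_energy_def by (rule sum.cong) (auto simp: M_def k_def coupling_def edges_def)
        thus ?thesis by (simp only: pair_energy_cmult)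
      qed
      ultimately show "spin_avg N (\<lambda>\<sigma>. exp (f * pair_energy N (coupling N b) \<sigma>)) \<le> exp ((B\<^sup>2 + B ^ 3) / (2 * (1 - \<rho>)))"
        by simp
    qed
  qed
  thus ?thesis using f \<beta> by (intro that[of f "f * \<beta>"]) auto
qed

definition mean_Z :: "nat \<Rightarrow> real \<Rightarrow> real" where
  "mean_Z N b = spin_avg N (edge_prod N (coupling N b))"

abbreviation tilt :: "nat \<Rightarrow> real \<Rightarrow> real" where
  "tilt N b \<equiv> tanh (b / (real N * \<theta> N))"

lemma mean_Z_ge:
  assumes N: "N \<ge> 1" and b: "0 \<le> b" "b \<le> B" "B / real N \<le> 1 / 2"
  shows "exp (- (B\<^sup>2)) \<le> mean_Z N b"
  unfolding mean_Z_def
proof (rule spin_avg_edge_prod_ge[OF _ b(3) N])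
  fix i j assume "(i, j) \<in> edges N"
  hence ij: "i \<in> {1..N}" "j \<in> {1..N}" by (auto dest: edges_memD)
  have "b / real N \<le> B / real N" using b by (intro divide_right_mono) auto
  thus "\<bar>coupling N b i j\<bar> \<le> B / real N" using coupling_bounds(1,2)[OF N b(1) ij] by linarith
qed (use b in auto)

text \<open>
  Second moment method. The replica interaction has entries at most \<open>b\<^sup>2 / (N\<^sup>2 \<theta>)\<close>, which is \<open>\<delta> / N\<close> with \<open>\<delta> \<longlongrightarrow> 0\<close>, so the second
  moment is asymptotic to the square of the first.
\<close>
lemma reduced_Z_concentration:
  assumes b: "b \<longlonglongrightarrow> \<beta>"
  shows "tendsto_in_prob (\<lambda>N. graph_pmf N (\<theta> N) W) (\<lambda>N A. reduced_Z N (tilt N (b N)) A / mean_Z N (b N)) 1"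
proof -
  obtain p B K where p: "p > 1" and B: "B > \<beta>" and K: "\<forall>\<^sub>F N in sequentially. \<forall>b. 0 \<le> b \<and> b \<le> B \<longrightarrow>
      spin_avg N (\<lambda>\<sigma>. exp (p * pair_energy N (coupling N b) \<sigma>)) \<le> K" by (rule exponential_moment_bound) blast
  define q where "q = p / (p - 1)"
  have q: "q > 0" using p by (simp add: q_def)
  define \<delta> where "\<delta> = (\<lambda>N. B\<^sup>2 / (real N * \<theta> N))"
  have \<delta>0: "\<delta> \<longlonglongrightarrow> 0"
    using tendsto_mult[OF tendsto_const inverse_degree_tendsto, of "B\<^sup>2"] by (simp add: \<delta>_def)
  define U where "U = (\<lambda>N. exp (3 * B * \<delta> N) * (1 + 2 * q * \<delta> N * (K\<^sup>2 + exp 1) * exp (2 * B\<^sup>2)) - 1)"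
  have "U \<longlonglongrightarrow> exp (3 * B * 0) * (1 + 2 * q * 0 * (K\<^sup>2 + exp 1) * exp (2 * B\<^sup>2)) - 1"
    unfolding U_def by (intro tendsto_intros \<delta>0)
  hence U0: "U \<longlonglongrightarrow> 0" by simp
  have BN: "(\<lambda>N. B / real N) \<longlonglongrightarrow> 0" by real_asymp
  have q': "0 < min (1 / 4) (1 / (2 * q))" using q by simp
  note ev = order_tendstoD(1)[OF b \<beta>] order_tendstoD(2)[OF b B] order_tendstoD(2)[OF \<delta>0 q']
    order_tendstoD(2)[OF BN half_gt_zero[OF zero_less_one]]
  let ?G = "\<lambda>N. graph_pmf N (\<theta> N) W"
  show ?thesis
  proof (rule tendsto_in_prob_chebyshev[where m = "\<lambda>_. 1"])
    show "\<forall>\<^sub>F N in sequentially. finite (set_pmf (?G N))" by (simp add: finite_set_graph_pmf)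
    show "(\<lambda>N. measure_pmf.expectation (?G N) (\<lambda>A. (reduced_Z N (tilt N (b N)) A / mean_Z N (b N) - 1)\<^sup>2)) \<longlonglongrightarrow> 0"
    proof (rule Lim_null_comparison[OF _ U0])
      show "\<forall>\<^sub>F N in sequentially. norm (measure_pmf.expectation (?G N) (\<lambda>A. (reduced_Z N (tilt N (b N)) A / mean_Z N (b N) - 1)\<^sup>2)) \<le> U N"
        using ev K eventually_ge_at_top[of 1]
      proof eventually_elim
        case (elim N)
        define t where "t = tilt N (b N)"
        define m where "m = mean_Z N (b N)"
        have N: "N \<ge> 1" and th: "0 < \<theta> N" "\<theta> N < 1" using elim(6) \<theta> by auto
        have b0: "0 \<le> b N" "b N \<le> B" using elim by auto
        have t: "0 \<le> t" "t \<le> 1" "t \<le> b N / (real N * \<theta> N)"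
          using b0 th by (auto simp: t_def tanh_le_self intro!: less_imp_le tanh_real_lt_1)
        have \<delta>N: "0 < \<delta> N" using N th B \<beta> by (auto simp: \<delta>_def)
        define r where "r = (\<lambda>i j. t\<^sup>2 * \<theta> N * grid_value W N i j * (1 - \<theta> N * grid_value W N i j))"
        have r: "0 \<le> r i j \<and> r i j \<le> \<delta> N / real N" if "(i, j) \<in> edges N" for i j
        proof -
          have ij: "i \<in> {1..N}" "j \<in> {1..N}" using edges_memD[OF that] by auto
          note g = grid_value_bounds[OF W ij]
          have gt: "0 \<le> \<theta> N * grid_value W N i j" "\<theta> N * grid_value W N i j \<le> 1" using g th by (auto simp: mult_le_one)
          have "r i j \<le> t\<^sup>2 * \<theta> N * 1 * 1"
            unfolding r_def using g gt th by (intro mult_mono) auto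
          also have "\<dots> \<le> (b N / (real N * \<theta> N))\<^sup>2 * \<theta> N"
            using t th by (simp add: power_mono mult_right_mono)
          also have "\<dots> \<le> (B / (real N * \<theta> N))\<^sup>2 * \<theta> N"
            using b0 th by (intro mult_right_mono power_mono divide_right_mono) auto
          also have "\<dots> = \<delta> N / real N" using th N by (simp add: \<delta>_def power2_eq_square)
          finally show ?thesis using g gt th by (simp add: r_def)
        qed
        have wp: "weak_perturbation N (coupling N (b N)) r p q K (\<delta> N)"
        proof
          show "spin_avg N (\<lambda>\<sigma>. exp (p * pair_energy N (coupling N (b N)) \<sigma>)) \<le> K" using elim b0 by blast
          show "\<bar>r i j\<bar> \<le> \<delta> N / real N" if "(i, j) \<in> edges N" for i j using r[OF that] by simp
          show "2 * q * \<delta> N \<le> 1" using elim(3) q by (simp add: field_simps)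
        qed (use N p \<delta>N in \<open>auto simp: q_def\<close>)
        have cp: "0 \<le> coupling N (b N) i j \<and> coupling N (b N) i j \<le> B / real N" if "(i, j) \<in> edges N" for i j
        proof -
          have ij: "i \<in> {1..N}" "j \<in> {1..N}" using edges_memD[OF that] by auto
          have "b N / real N \<le> B / real N" using b0 by (intro divide_right_mono) auto
          thus ?thesis using coupling_bounds(1,2)[OF N b0(1) ij] by linarith
        qed
        note mom = reduced_Z_moments[OF W less_imp_le[OF th(1)] less_imp_le[OF th(2)] t(1,2), of N]
        have E1: "measure_pmf.expectation (?G N) (reduced_Z N t) = m"
          unfolding m_def mean_Z_def coupling_def[abs_def] t_def by (rule mom(1)[unfolded t_def])
        have E2: "measure_pmf.expectation (?G N) (\<lambda>A. (reduced_Z N t A)\<^sup>2)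
            \<le> exp (3 * B * \<delta> N) * (m\<^sup>2 + 2 * q * \<delta> N * (K\<^sup>2 + exp 1))"
        proof -
          have "measure_pmf.expectation (?G N) (\<lambda>A. (reduced_Z N t A)\<^sup>2)
            = spin_avg N (\<lambda>\<sigma>. spin_avg N (\<lambda>\<tau>. \<Prod>(i, j)\<in>edges N.
               (1 + coupling N (b N) i j * \<sigma> i * \<sigma> j) * (1 + coupling N (b N) i j * \<tau> i * \<tau> j) + r i j * (\<sigma> i * \<sigma> j) * (\<tau> i * \<tau> j)))"
            unfolding coupling_def t_def r_def by (rule mom(2)[unfolded t_def])
          also have "\<dots> \<le> exp (3 * B * \<delta> N) * (m\<^sup>2 + 2 * q * \<delta> N * (K\<^sup>2 + exp 1))"
            unfolding m_def mean_Z_def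
            by (rule spin_avg_two_edge_prod[OF wp cp]) (use r elim B \<beta> in auto)
          finally show ?thesis .
        qed
        have m: "exp (- (B\<^sup>2)) \<le> m" unfolding m_def by (rule mean_Z_ge) (use N b0 elim in auto)
        hence m0: "m > 0" using exp_gt_zero[of "- (B\<^sup>2)"] by linarith
        have m2: "1 / m\<^sup>2 \<le> exp (2 * B\<^sup>2)"
        proof -
          have "(exp (- (B\<^sup>2)))\<^sup>2 \<le> m\<^sup>2" using m by (intro power_mono) auto
          hence "exp (- (2 * B\<^sup>2)) \<le> m\<^sup>2" by (simp add: exp_double[symmetric])
          thus ?thesis using m0 by (simp add: exp_minus field_simps)
        qed
        have "measure_pmf.expectation (?G N) (\<lambda>A. (reduced_Z N t A / m - 1)\<^sup>2)
           = measure_pmf.expectation (?G N) (\<lambda>A. (reduced_Z N t A)\<^sup>2 * (1 / m\<^sup>2) - reduced_Z N t A * (2 / m) + 1)"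
          by (rule Bochner_Integration.integral_cong) (use m0 in \<open>auto simp: power2_eq_square field_simps\<close>)
        also have "\<dots> = measure_pmf.expectation (?G N) (\<lambda>A. (reduced_Z N t A)\<^sup>2) * (1 / m\<^sup>2) - m * (2 / m) + 1"
          using E1 by simp
        also have "\<dots> \<le> (exp (3 * B * \<delta> N) * (m\<^sup>2 + 2 * q * \<delta> N * (K\<^sup>2 + exp 1))) * (1 / m\<^sup>2) - m * (2 / m) + 1"
          using E2 m0 by (intro add_right_mono diff_right_mono mult_right_mono) auto
        also have "\<dots> = exp (3 * B * \<delta> N) * (1 + 2 * q * \<delta> N * (K\<^sup>2 + exp 1) * (1 / m\<^sup>2)) - 1"
          using m0 by (simp add: field_simps)
        also have "\<dots> \<le> U N"
          unfolding U_def using m2 q \<delta>N by (intro diff_right_mono mult_left_mono add_left_mono) auto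
        finally have "measure_pmf.expectation (?G N) (\<lambda>A. (reduced_Z N t A / m - 1)\<^sup>2) \<le> U N" .
        moreover have "0 \<le> measure_pmf.expectation (?G N) (\<lambda>A. (reduced_Z N t A / m - 1)\<^sup>2)"
          by (rule Bochner_Integration.integral_nonneg) simp
        ultimately show ?case by (simp add: t_def m_def)
      qed
    qed
  qed simp
qed

text \<open>
  Changing \<open>b\<close> by \<open>o(1)\<close> changes the couplings by \<open>o(1/N)\<close>. The perturbation bound is applied in both directions.
\<close>
lemma mean_Z_ratio:
  assumes b: "b \<longlonglongrightarrow> \<beta>" and b': "b' \<longlonglongrightarrow> \<beta>"
  shows "(\<lambda>N. mean_Z N (b' N) / mean_Z N (b N)) \<longlonglongrightarrow> 1"
proof -
  obtain p B K where p: "p > 1" and B: "B > \<beta>" and K: "\<forall>\<^sub>F N in sequentially. \<forall>b. 0 \<le> b \<and> b \<le> B \<longrightarrow>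
      spin_avg N (\<lambda>\<sigma>. exp (p * pair_energy N (coupling N b) \<sigma>)) \<le> K" by (rule exponential_moment_bound) blast
  define q where "q = p / (p - 1)"
  have q: "q > 0" using p by (simp add: q_def)
  \<comment> \<open>The summand \<open>1 / N\<close> keeps \<open>\<delta>\<close> positive when \<open>b' N = b N\<close>.\<close>
  define \<delta> where "\<delta> = (\<lambda>N. \<bar>b' N - b N\<bar> + 1 / real N)"
  have "\<delta> \<longlonglongrightarrow> \<bar>\<beta> - \<beta>\<bar> + 0" unfolding \<delta>_def by (intro tendsto_intros b b')
  hence \<delta>0: "\<delta> \<longlonglongrightarrow> 0" by simp
  define u where "u = (\<lambda>N. exp (B * \<delta> N) * (1 + 2 * q * \<delta> N * (\<bar>K\<bar> + exp 1) * exp (B\<^sup>2)))"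
  have "u \<longlonglongrightarrow> exp (B * 0) * (1 + 2 * q * 0 * (\<bar>K\<bar> + exp 1) * exp (B\<^sup>2))"
    unfolding u_def by (intro tendsto_intros \<delta>0)
  hence u1: "u \<longlonglongrightarrow> 1" by simp
  have BN: "(\<lambda>N. B / real N) \<longlonglongrightarrow> 0" by real_asymp
  have q': "0 < 1 / (2 * q)" using q by simp
  note ev = order_tendstoD(1)[OF b \<beta>] order_tendstoD(2)[OF b B] order_tendstoD(1)[OF b' \<beta>] order_tendstoD(2)[OF b' B]
    order_tendstoD(2)[OF \<delta>0 q'] order_tendstoD(2)[OF BN half_gt_zero[OF zero_less_one]]
  have one: "mean_Z N y \<le> u N * mean_Z N x \<and> mean_Z N x > 0"
    if N: "N \<ge> 1" and KN: "\<forall>b. 0 \<le> b \<and> b \<le> B \<longrightarrow> spin_avg N (\<lambda>\<sigma>. exp (p * pair_energy N (coupling N b) \<sigma>)) \<le> K"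
      and x: "0 < x" "x < B" and y: "0 < y" "y < B" and xy: "\<bar>y - x\<bar> \<le> \<bar>b' N - b N\<bar>"
      and d: "\<delta> N < 1 / (2 * q)" and BN: "B / real N < 1 / 2" for N x y
  proof -
    have \<delta>N: "0 < \<delta> N" using N by (simp add: \<delta>_def add_nonneg_pos)
    have wp: "weak_perturbation N (coupling N x) (\<lambda>i j. coupling N y i j - coupling N x i j) p q K (\<delta> N)"
    proof
      show "spin_avg N (\<lambda>\<sigma>. exp (p * pair_energy N (coupling N x) \<sigma>)) \<le> K" using KN x by simp
      show "\<bar>coupling N y i j - coupling N x i j\<bar> \<le> \<delta> N / real N" if "(i, j) \<in> edges N" for i j
      proof -
        have ij: "i \<in> {1..N}" "j \<in> {1..N}" using edges_memD[OF that] by auto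
        have "\<bar>y - x\<bar> / real N \<le> \<delta> N / real N" using xy by (intro divide_right_mono) (auto simp: \<delta>_def add_increasing2)
        thus ?thesis using coupling_diff[OF N ij, of y x] by linarith
      qed
      show "2 * q * \<delta> N \<le> 1" using d q by (simp add: field_simps)
    qed (use N p \<delta>N in \<open>auto simp: q_def\<close>)
    have cp: "0 \<le> coupling N z i j \<and> coupling N z i j \<le> B / real N" if "(i, j) \<in> edges N" "0 < z" "z < B" for i j z
    proof -
      have ij: "i \<in> {1..N}" "j \<in> {1..N}" using edges_memD[OF that(1)] by auto
      have "z / real N \<le> B / real N" using that by (intro divide_right_mono) auto
      thus ?thesis using coupling_bounds(1,2)[OF N less_imp_le[OF that(2)] ij] by linarith
    qed
    have m: "exp (- (B\<^sup>2)) \<le> mean_Z N x" by (rule mean_Z_ge) (use N x BN in auto)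
    hence m0: "mean_Z N x > 0" using exp_gt_zero[of "- (B\<^sup>2)"] by linarith
    have m1: "1 \<le> exp (B\<^sup>2) * mean_Z N x" using m by (simp add: exp_minus field_simps)
    have "mean_Z N y \<le> exp (B * \<delta> N) * (mean_Z N x + 2 * q * \<delta> N * (K + exp 1))"
      unfolding mean_Z_def by (rule spin_avg_edge_prod_perturb[OF wp]) (use cp x y BN B \<beta> in auto)
    also have "\<dots> \<le> exp (B * \<delta> N) * (mean_Z N x + 2 * q * \<delta> N * (\<bar>K\<bar> + exp 1) * (exp (B\<^sup>2) * mean_Z N x))"
    proof (intro mult_left_mono add_left_mono)
      have "2 * q * \<delta> N * (K + exp 1) \<le> 2 * q * \<delta> N * (\<bar>K\<bar> + exp 1)" using q \<delta>N by (intro mult_left_mono) auto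
      also have "\<dots> = 2 * q * \<delta> N * (\<bar>K\<bar> + exp 1) * 1" by simp
      also have "\<dots> \<le> 2 * q * \<delta> N * (\<bar>K\<bar> + exp 1) * (exp (B\<^sup>2) * mean_Z N x)"
        using q \<delta>N m1 by (intro mult_left_mono mult_nonneg_nonneg) auto
      finally show "2 * q * \<delta> N * (K + exp 1) \<le> 2 * q * \<delta> N * (\<bar>K\<bar> + exp 1) * (exp (B\<^sup>2) * mean_Z N x)" .
    qed simp
    also have "\<dots> = u N * mean_Z N x" by (simp add: u_def algebra_simps)
    finally show ?thesis using m0 by simp
  qed
  have "\<forall>\<^sub>F N in sequentially. mean_Z N (b' N) / mean_Z N (b N) \<le> u N \<and> 1 / u N \<le> mean_Z N (b' N) / mean_Z N (b N)"
    using ev K eventually_ge_at_top[of 1]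
  proof eventually_elim
    case (elim N)
    have 1: "mean_Z N (b' N) \<le> u N * mean_Z N (b N) \<and> mean_Z N (b N) > 0"
      by (rule one) (use elim in auto)
    have 2: "mean_Z N (b N) \<le> u N * mean_Z N (b' N) \<and> mean_Z N (b' N) > 0"
      by (rule one) (use elim in auto)
    have "u N > 0" using 1 2 by (metis less_le_trans zero_less_mult_pos2)
    thus ?case using 1 2 by (simp add: pos_divide_le_eq pos_le_divide_eq divide_le_eq mult.commute)
  qed
  hence lo: "\<forall>\<^sub>F N in sequentially. 1 / u N \<le> mean_Z N (b' N) / mean_Z N (b N)"
    and up: "\<forall>\<^sub>F N in sequentially. mean_Z N (b' N) / mean_Z N (b N) \<le> u N"
    by (auto elim: eventually_mono)
  have "(\<lambda>N. 1 / u N) \<longlonglongrightarrow> 1" using tendsto_divide[OF tendsto_const u1, of 1] by simp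
  thus ?thesis by (rule tendsto_sandwich[OF lo up _ u1])
qed

end

context high_temperature
begin

text \<open>
  The second derivative in \<open>b\<close> of the leading term \<open>b\<^sup>2 c / 2\<close> of the logarithm of the partition function.
\<close>
definition curvature :: "nat \<Rightarrow> (nat \<Rightarrow> nat \<Rightarrow> real) \<Rightarrow> real" where
  "curvature N A = (\<Sum>i=1..N. \<Sum>j=1..N. A i j) / (2 * (real N)\<^sup>2 * (\<theta> N)\<^sup>2)"

definition local_par :: "nat \<Rightarrow> real \<Rightarrow> real" where
  "local_par N h = \<beta> + h * sqrt (\<theta> N)"

text \<open>
  The limiting Fisher information in the local parameter \<open>h\<close>, see \<open>curvature_tendsto\<close>.
\<close>
definition information :: real where
  "information = graphon_integral W / 2"

abbreviation G :: "nat \<Rightarrow> (nat \<Rightarrow> nat \<Rightarrow> real) pmf" where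
  "G N \<equiv> graph_pmf N (\<theta> N) W"

text \<open>
  The factor removes the linear term in \<open>h\<close> of \<open>(\<beta> + h \<surd>\<theta>)\<^sup>2 c / 2\<close>. Only the quadratic term is bounded.
\<close>
definition centered_Z_ratio :: "real \<Rightarrow> nat \<Rightarrow> (nat \<Rightarrow> nat \<Rightarrow> real) \<Rightarrow> real" where
  "centered_Z_ratio h N A = partition_fun N (\<theta> N) A (local_par N h) / partition_fun N (\<theta> N) A \<beta>
     * exp (- (\<beta> * h * sqrt (\<theta> N) * curvature N A))"

lemma information_pos: "information > 0"
  using W_pos by (simp add: information_def)

lemma curvature_eq:
  assumes "A \<in> set_pmf (G N)"
  shows "curvature N A = (2 * edge_count N A + loop_count N A) / (2 * (real N)\<^sup>2 * (\<theta> N)\<^sup>2)"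
  unfolding curvature_def edge_count_def loop_count_def
  using sum_full_eq_edges[of N A] graph_pmf_entries(2)[OF assms] by simp

lemma sqrt_\<theta>_tendsto: "(\<lambda>N. sqrt (\<theta> N)) \<longlonglongrightarrow> 0"
  using tendsto_real_sqrt[OF \<theta>_0] by simp

lemma local_par_tendsto: "(\<lambda>N. local_par N h) \<longlonglongrightarrow> \<beta>"
proof -
  have "(\<lambda>N. \<beta> + h * sqrt (\<theta> N)) \<longlonglongrightarrow> \<beta> + h * 0" by (intro tendsto_intros sqrt_\<theta>_tendsto)
  thus ?thesis by (simp add: local_par_def)
qed

lemma edge_value_sum_tendsto: "(\<lambda>N. (\<Sum>(i, j)\<in>edges N. grid_value W N i j) / (real N)\<^sup>2) \<longlonglongrightarrow> information"
proof -
  let ?d = "\<lambda>N. (\<Sum>i=1..N. grid_value W N i i) / (real N)\<^sup>2"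
  have "?d \<longlonglongrightarrow> 0"
  proof (rule Lim_null_comparison)
    show "\<forall>\<^sub>F N in sequentially. norm (?d N) \<le> 1 / real N"
      using eventually_ge_at_top[of 1]
    proof eventually_elim
      case (elim N)
      have "(\<Sum>i=1..N. grid_value W N i i) \<le> (\<Sum>i=1..N. 1)"
        by (rule sum_mono) (use grid_value_bounds[OF W] in auto)
      moreover have "0 \<le> (\<Sum>i=1..N. grid_value W N i i)"
        by (rule sum_nonneg) (use grid_value_bounds[OF W] in auto)
      ultimately have "norm (?d N) \<le> real N / (real N)\<^sup>2" by (simp add: divide_right_mono)
      also have "\<dots> = 1 / real N" using elim by (simp add: power2_eq_square)
      finally show ?case .
    qed
  qed real_asymp
  moreover have "(\<lambda>N. (\<Sum>i=1..N. \<Sum>j=1..N. grid_value W N i j) / (real N)\<^sup>2) \<longlonglongrightarrow> graphon_integral W"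
    by (rule grid_sum_tendsto[OF W R])
  ultimately have "(\<lambda>N. ((\<Sum>i=1..N. \<Sum>j=1..N. grid_value W N i j) / (real N)\<^sup>2 - ?d N) / 2) \<longlonglongrightarrow> (graphon_integral W - 0) / 2"
    by (intro tendsto_intros) auto
  moreover have "((\<Sum>i=1..N. \<Sum>j=1..N. grid_value W N i j) / (real N)\<^sup>2 - ?d N) / 2 = (\<Sum>(i, j)\<in>edges N. grid_value W N i j) / (real N)\<^sup>2" for N
  proof -
    have "(\<Sum>i=1..N. \<Sum>j=1..N. grid_value W N i j) = 2 * (\<Sum>(i, j)\<in>edges N. grid_value W N i j) + (\<Sum>i=1..N. grid_value W N i i)"
      by (rule sum_full_eq_edges) (rule grid_value_bounds(3)[OF W])
    thus ?thesis by (simp add: diff_divide_distrib add_divide_distrib)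
  qed
  ultimately show ?thesis by (simp add: information_def)
qed

lemma finite_G: "\<forall>\<^sub>F N in sequentially. finite (set_pmf (G N))"
  by (simp add: finite_set_graph_pmf)

lemma entry_nonneg: "A \<in> set_pmf (G N) \<Longrightarrow> 0 \<le> A i j"
  using graph_pmf_entries(1)[of A N "\<theta> N" W i j] by auto

lemma loop_count_nonneg: "A \<in> set_pmf (G N) \<Longrightarrow> 0 \<le> loop_count N A"
  unfolding loop_count_def by (rule sum_nonneg) (auto simp: entry_nonneg)

lemma edge_count_nonneg: "A \<in> set_pmf (G N) \<Longrightarrow> 0 \<le> edge_count N A"
  unfolding edge_count_def by (rule sum_nonneg) (auto simp: entry_nonneg)

text \<open>
  A law of large numbers for the edges. The loops are fewer by a factor \<open>N\<close>.
\<close>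
lemma curvature_tendsto: "tendsto_in_prob G (\<lambda>N A. \<theta> N * curvature N A) information"
proof -
  have th: "0 < \<theta> N" "\<theta> N < 1" if "N \<ge> 1" for N using \<theta> that by auto
  have e: "tendsto_in_prob G (\<lambda>N A. edge_count N A / ((real N)\<^sup>2 * \<theta> N)) information"
  proof (rule tendsto_in_prob_chebyshev[OF finite_G _ edge_value_sum_tendsto])
    show "(\<lambda>N. measure_pmf.expectation (G N) (\<lambda>A. (edge_count N A / ((real N)\<^sup>2 * \<theta> N)
        - (\<Sum>(i, j)\<in>edges N. grid_value W N i j) / (real N)\<^sup>2)\<^sup>2)) \<longlonglongrightarrow> 0"
    proof (rule Lim_null_comparison[OF _ inverse_degree_tendsto])
      show "\<forall>\<^sub>F N in sequentially. norm (measure_pmf.expectation (G N) (\<lambda>A. (edge_count N A / ((real N)\<^sup>2 * \<theta> N)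
        - (\<Sum>(i, j)\<in>edges N. grid_value W N i j) / (real N)\<^sup>2)\<^sup>2)) \<le> 1 / (real N * \<theta> N)"
        using eventually_ge_at_top[of 1]
      proof eventually_elim
        case (elim N)
        let ?s = "\<Sum>(i, j)\<in>edges N. grid_value W N i j"
        have "measure_pmf.expectation (G N) (\<lambda>A. (edge_count N A / ((real N)\<^sup>2 * \<theta> N) - ?s / (real N)\<^sup>2)\<^sup>2)
          = measure_pmf.expectation (G N) (\<lambda>A. (edge_count N A - \<theta> N * ?s)\<^sup>2 * (1 / ((real N)\<^sup>2 * \<theta> N)\<^sup>2))"
        proof (rule Bochner_Integration.integral_cong[OF refl])
          fix A
          have "edge_count N A / ((real N)\<^sup>2 * \<theta> N) - ?s / (real N)\<^sup>2 = (edge_count N A - \<theta> N * ?s) / ((real N)\<^sup>2 * \<theta> N)"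
            using th[OF elim] by (simp add: diff_divide_distrib)
          thus "(edge_count N A / ((real N)\<^sup>2 * \<theta> N) - ?s / (real N)\<^sup>2)\<^sup>2 = (edge_count N A - \<theta> N * ?s)\<^sup>2 * (1 / ((real N)\<^sup>2 * \<theta> N)\<^sup>2)"
            by (simp add: power_divide)
        qed
        also have "\<dots> = measure_pmf.expectation (G N) (\<lambda>A. (edge_count N A - \<theta> N * ?s)\<^sup>2) * (1 / ((real N)\<^sup>2 * \<theta> N)\<^sup>2)"
          by simp
        also have "\<dots> \<le> ((real N)\<^sup>2 / 2 * \<theta> N) * (1 / ((real N)\<^sup>2 * \<theta> N)\<^sup>2)"
          by (intro mult_right_mono edge_count_moments(2)[OF W]) (use th[OF elim] in auto)
        also have "\<dots> = 1 / (real N * \<theta> N) * (1 / (2 * real N))"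
          using th[OF elim] elim by (simp add: power2_eq_square)
        also have "\<dots> \<le> 1 / (real N * \<theta> N) * 1"
          using th[OF elim] elim by (intro mult_left_mono) auto
        finally show ?case by (simp add: Bochner_Integration.integral_nonneg)
      qed
    qed
  qed
  have l: "tendsto_in_prob G (\<lambda>N A. loop_count N A / (2 * (real N)\<^sup>2 * \<theta> N)) 0"
  proof (rule tendsto_in_prob_markov[OF finite_G])
    show "\<forall>\<^sub>F N in sequentially. \<forall>A\<in>set_pmf (G N). 0 \<le> loop_count N A / (2 * (real N)\<^sup>2 * \<theta> N)"
      using eventually_ge_at_top[of 1]
    proof eventually_elim
      case (elim N)
      show ?case using th[OF elim] by (auto simp: loop_count_nonneg)
    qed
    show "(\<lambda>N. measure_pmf.expectation (G N) (\<lambda>A. loop_count N A / (2 * (real N)\<^sup>2 * \<theta> N))) \<longlonglongrightarrow> 0"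
    proof (rule Lim_null_comparison)
      show "\<forall>\<^sub>F N in sequentially. norm (measure_pmf.expectation (G N) (\<lambda>A. loop_count N A / (2 * (real N)\<^sup>2 * \<theta> N))) \<le> 1 / real N"
        using eventually_ge_at_top[of 1]
      proof eventually_elim
        case (elim N)
        have "measure_pmf.expectation (G N) (\<lambda>A. loop_count N A / (2 * (real N)\<^sup>2 * \<theta> N))
            = measure_pmf.expectation (G N) (loop_count N) / (2 * (real N)\<^sup>2 * \<theta> N)" by simp
        also have "\<dots> \<le> (real N * \<theta> N) / (2 * (real N)\<^sup>2 * \<theta> N)"
          by (intro divide_right_mono expectation_loop_count[OF W]) (use th[OF elim] in auto)
        also have "\<dots> \<le> 1 / real N" using th[OF elim] elim by (simp add: power2_eq_square field_simps)
        finally have "measure_pmf.expectation (G N) (\<lambda>A. loop_count N A / (2 * (real N)\<^sup>2 * \<theta> N)) \<le> 1 / real N" .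
        moreover have "0 \<le> measure_pmf.expectation (G N) (\<lambda>A. loop_count N A / (2 * (real N)\<^sup>2 * \<theta> N))"
          by (rule integral_nonneg_AE) (use th[OF elim] in \<open>auto simp: AE_measure_pmf_iff loop_count_nonneg\<close>)
        ultimately show ?case by simp
      qed
    qed real_asymp
  qed
  have "\<forall>\<^sub>F N in sequentially. \<forall>A\<in>set_pmf (G N). \<theta> N * curvature N A
      = edge_count N A / ((real N)\<^sup>2 * \<theta> N) + loop_count N A / (2 * (real N)\<^sup>2 * \<theta> N)"
    using eventually_ge_at_top[of 1]
  proof eventually_elim
    case (elim N)
    show ?case
    proof
      fix A assume "A \<in> set_pmf (G N)"
      thus "\<theta> N * curvature N A = edge_count N A / ((real N)\<^sup>2 * \<theta> N) + loop_count N A / (2 * (real N)\<^sup>2 * \<theta> N)"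
        using th[OF elim] elim by (simp add: curvature_eq power2_eq_square field_simps)
    qed
  qed
  from tendsto_in_prob_cong[OF this tendsto_in_prob_add[OF e l]] show ?thesis by simp
qed

definition log_prefactor :: "nat \<Rightarrow> real \<Rightarrow> (nat \<Rightarrow> nat \<Rightarrow> real) \<Rightarrow> real" where
  "log_prefactor N b A = b / (real N * \<theta> N) * loop_count N A / 2 + edge_count N A * ln (cosh (b / (real N * \<theta> N)))"

text \<open>
  The exponential prefactor of the partition function is Gaussian in the inverse temperature, up to the loops
  and the fourth-order term of \<open>ln cosh\<close>; at the scale \<open>\<surd>\<theta>\<close> both are negligible, the latter because
  \<open>N\<^sup>2\<theta>\<^sup>3\<close> is bounded below.
\<close>
lemma log_prefactor_tendsto:
  "tendsto_in_prob G (\<lambda>N A. log_prefactor N (local_par N h) A - log_prefactor N \<beta> A - \<beta> * h * sqrt (\<theta> N) * curvature N A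
     - h\<^sup>2 / 2 * (\<theta> N * curvature N A)) 0"
proof -
  define B where "B = 2 * \<beta>"
  have B: "\<beta> < B" "0 < B" using \<beta> by (auto simp: B_def)
  have th: "0 < \<theta> N" "\<theta> N < 1" if "N \<ge> 1" for N using \<theta> that by auto
  \<comment> \<open>The loops enter through their linear and quadratic contributions, the edges through the error of the quadratic
    approximation of \<open>ln cosh\<close> on \<open>[0, B / (N\<theta>)]\<close>, times the change \<open>\<bar>h\<bar> \<surd>\<theta> / (N\<theta>)\<close> of the argument.\<close>
  define Y where "Y = (\<lambda>N A. \<bar>h\<bar> * sqrt (\<theta> N) * ((1 + B) * (loop_count N A / (real N * \<theta> N)) + B ^ 3 * (edge_count N A / (real N * \<theta> N) ^ 4)))"
  show ?thesis
  proof (rule tendsto_in_prob_dominated)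
    show "tendsto_in_prob G Y 0"
    proof (rule tendsto_in_prob_markov[OF finite_G])
      show "\<forall>\<^sub>F N in sequentially. \<forall>A\<in>set_pmf (G N). 0 \<le> Y N A"
        using eventually_ge_at_top[of 1]
      proof eventually_elim
        case (elim N)
        show ?case using th[OF elim] B by (auto simp: Y_def loop_count_nonneg edge_count_nonneg)
      qed
      define U where "U = (\<lambda>N. \<bar>h\<bar> * ((1 + B) * sqrt (\<theta> N) + B ^ 3 * (sqrt (\<theta> N) / ((real N)\<^sup>2 * \<theta> N ^ 3))))"
      have "U \<longlonglongrightarrow> \<bar>h\<bar> * ((1 + B) * 0 + B ^ 3 * 0)"
        unfolding U_def by (intro tendsto_intros sqrt_\<theta>_tendsto sqrt_sparsity_over_cube_tendsto)
      hence U: "U \<longlonglongrightarrow> 0" by simp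
      show "(\<lambda>N. measure_pmf.expectation (G N) (Y N)) \<longlonglongrightarrow> 0"
      proof (rule Lim_null_comparison[OF _ U])
        show "\<forall>\<^sub>F N in sequentially. norm (measure_pmf.expectation (G N) (Y N)) \<le> U N"
          using eventually_ge_at_top[of 1]
        proof eventually_elim
          case (elim N)
          note thN = th[OF elim]
          have D: "measure_pmf.expectation (G N) (loop_count N) / (real N * \<theta> N) \<le> 1"
            using expectation_loop_count[OF W, of "\<theta> N" N] thN elim by (simp add: pos_divide_le_eq)
          have E: "measure_pmf.expectation (G N) (edge_count N) / (real N * \<theta> N) ^ 4 \<le> 1 / ((real N)\<^sup>2 * \<theta> N ^ 3)"
          proof -
            have "measure_pmf.expectation (G N) (edge_count N) = \<theta> N * (\<Sum>(i, j)\<in>edges N. grid_value W N i j)"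
              using thN by (intro edge_count_moments(1)[OF W]) auto
            also have "\<dots> \<le> \<theta> N * ((real N)\<^sup>2 / 2 * 1)"
              using thN by (intro mult_left_mono sum_edges_bound) (auto dest!: edges_memD intro!: grid_value_bounds(2)[OF W])
            also have "\<dots> \<le> \<theta> N * (real N)\<^sup>2" using thN by simp
            finally have "measure_pmf.expectation (G N) (edge_count N) / (real N * \<theta> N) ^ 4 \<le> \<theta> N * (real N)\<^sup>2 / (real N * \<theta> N) ^ 4"
              using thN by (intro divide_right_mono) auto
            also have "\<dots> = 1 / ((real N)\<^sup>2 * \<theta> N ^ 3)"
              using thN elim by (simp add: power_mult_distrib power2_eq_square power3_eq_cube power4_eq_xxxx)
            finally show ?thesis .
          qed
          have "measure_pmf.expectation (G N) (Y N) = \<bar>h\<bar> * sqrt (\<theta> N) * ((1 + B) * (measure_pmf.expectation (G N) (loop_count N) / (real N * \<theta> N))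
              + B ^ 3 * (measure_pmf.expectation (G N) (edge_count N) / (real N * \<theta> N) ^ 4))"
            by (simp add: Y_def)
          also have "\<dots> \<le> \<bar>h\<bar> * sqrt (\<theta> N) * ((1 + B) * 1 + B ^ 3 * (1 / ((real N)\<^sup>2 * \<theta> N ^ 3)))"
            using B thN by (intro mult_left_mono add_mono D E) auto
          also have "\<dots> = U N" by (simp add: U_def algebra_simps)
          finally have "measure_pmf.expectation (G N) (Y N) \<le> U N" .
          moreover have "0 \<le> measure_pmf.expectation (G N) (Y N)"
            by (rule integral_nonneg_AE)
               (use thN B in \<open>auto simp: AE_measure_pmf_iff Y_def loop_count_nonneg edge_count_nonneg\<close>)
          ultimately show ?case by simp
        qed
      qed
    qed
    show "\<forall>\<^sub>F N in sequentially. \<forall>A\<in>set_pmf (G N). \<bar>log_prefactor N (local_par N h) A - log_prefactor N \<beta> A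
        - \<beta> * h * sqrt (\<theta> N) * curvature N A - h\<^sup>2 / 2 * (\<theta> N * curvature N A) - 0\<bar> \<le> Y N A"
      using eventually_ge_at_top[of 1] order_tendstoD(1)[OF local_par_tendsto[of h] \<beta>] order_tendstoD(2)[OF local_par_tendsto[of h] B(1)]
        order_tendstoD(2)[OF inverse_degree_tendsto zero_less_one]
    proof eventually_elim
      case (elim N)
      note thN = th[OF elim(1)]
      define n where "n = real N * \<theta> N"
      have n: "n > 0" "1 / n < 1" using thN elim by (auto simp: n_def)
      define x where "x = \<beta> / n"
      define y where "y = local_par N h / n"
      define m where "m = B / n"
      have xy: "0 \<le> x" "x \<le> m" "0 \<le> y" "y \<le> m"
        using elim n B \<beta> by (auto simp: x_def y_def m_def divide_right_mono)
      have yx: "\<bar>y - x\<bar> = \<bar>h\<bar> * sqrt (\<theta> N) / n"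
        using n thN by (simp add: x_def y_def local_par_def diff_divide_distrib[symmetric] abs_mult)
      show ?case
      proof
        fix A assume A: "A \<in> set_pmf (G N)"
        define E where "E = edge_count N A"
        define D where "D = loop_count N A"
        have ED: "0 \<le> E" "0 \<le> D" using A by (auto simp: E_def D_def edge_count_nonneg loop_count_nonneg)
        have c: "curvature N A = (2 * E + D) / (2 * n\<^sup>2)"
          by (simp add: curvature_eq[OF A] E_def D_def n_def power_mult_distrib)
        have bx: "\<beta> = x * n" "h * sqrt (\<theta> N) = (y - x) * n"
          using n by (auto simp: x_def y_def local_par_def diff_divide_distrib[symmetric])
        have h2: "h\<^sup>2 * \<theta> N = ((y - x) * n)\<^sup>2" unfolding bx(2)[symmetric] using thN by (simp add: power_mult_distrib)
        have c1: "\<beta> * h * sqrt (\<theta> N) * curvature N A = x * (y - x) * (2 * E + D) / 2"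
        proof -
          have "\<beta> * h * sqrt (\<theta> N) * curvature N A = (x * n) * ((y - x) * n) * ((2 * E + D) / (2 * n\<^sup>2))"
            unfolding c bx(2)[symmetric] bx(1)[symmetric] by simp
          thus ?thesis using n by (simp add: power2_eq_square)
        qed
        have c2: "h\<^sup>2 / 2 * (\<theta> N * curvature N A) = (y - x)\<^sup>2 * (2 * E + D) / 4"
        proof -
          have "h\<^sup>2 / 2 * (\<theta> N * curvature N A) = (h\<^sup>2 * \<theta> N) / 2 * curvature N A" by simp
          also have "\<dots> = ((y - x) * n)\<^sup>2 / 2 * ((2 * E + D) / (2 * n\<^sup>2))" unfolding h2 c ..
          finally show ?thesis using n by (simp add: power_mult_distrib)
        qed
        have "log_prefactor N (local_par N h) A - log_prefactor N \<beta> A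
          - \<beta> * h * sqrt (\<theta> N) * curvature N A - h\<^sup>2 / 2 * (\<theta> N * curvature N A)
          = (y - x) * D / 2 - (y - x) * ((x + y) / 4) * D + E * ((ln (cosh y) - y\<^sup>2 / 2) - (ln (cosh x) - x\<^sup>2 / 2))"
          unfolding c1 c2 log_prefactor_def n_def[symmetric] x_def[symmetric] y_def[symmetric] E_def[symmetric] D_def[symmetric]
          by (simp add: power2_eq_square field_simps)
        also have "\<bar>\<dots>\<bar> \<le> \<bar>(y - x) * D / 2\<bar> + \<bar>(y - x) * ((x + y) / 4) * D\<bar> + \<bar>E * ((ln (cosh y) - y\<^sup>2 / 2) - (ln (cosh x) - x\<^sup>2 / 2))\<bar>"
          by linarith
        also have "\<dots> \<le> \<bar>y - x\<bar> * D + \<bar>y - x\<bar> * B * D + E * (m ^ 3 * \<bar>y - x\<bar>)"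
        proof (intro add_mono)
          show "\<bar>(y - x) * D / 2\<bar> \<le> \<bar>y - x\<bar> * D" using ED by (simp add: abs_mult)
          have "m \<le> B * 1" unfolding m_def using mult_left_mono[of "1 / n" 1 B] n B by simp
          hence "\<bar>(x + y) / 4\<bar> \<le> B" using xy by simp
          hence "\<bar>y - x\<bar> * \<bar>(x + y) / 4\<bar> * D \<le> \<bar>y - x\<bar> * B * D" using ED by (intro mult_right_mono mult_left_mono) auto
          thus "\<bar>(y - x) * ((x + y) / 4) * D\<bar> \<le> \<bar>y - x\<bar> * B * D" using ED by (simp add: abs_mult)
          show "\<bar>E * ((ln (cosh y) - y\<^sup>2 / 2) - (ln (cosh x) - x\<^sup>2 / 2))\<bar> \<le> E * (m ^ 3 * \<bar>y - x\<bar>)"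
            unfolding abs_mult using ED ln_cosh_quadratic_approx[OF xy] by (simp add: mult_left_mono)
        qed
        also have "\<dots> = Y N A"
          unfolding Y_def n_def[symmetric] E_def[symmetric] D_def[symmetric] yx m_def
          using n by (simp add: power_divide field_simps power4_eq_xxxx power3_eq_cube)
        finally show "\<bar>log_prefactor N (local_par N h) A - log_prefactor N \<beta> A
          - \<beta> * h * sqrt (\<theta> N) * curvature N A - h\<^sup>2 / 2 * (\<theta> N * curvature N A) - 0\<bar> \<le> Y N A" by simp
      qed
    qed
  qed
qed

text \<open>
  Local asymptotic normality, in the form of a limit of Laplace transforms given the graph: the prefactor contributes the
  Gaussian limit, and the reduced partition functions cancel.
\<close>
lemma centered_Z_ratio_tendsto:
  "tendsto_in_prob G (centered_Z_ratio h) (exp (h\<^sup>2 / 2 * information))"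
proof -
  let ?b = "\<lambda>N. local_par N h"
  define err where "err = (\<lambda>N A. log_prefactor N (?b N) A - log_prefactor N \<beta> A - \<beta> * h * sqrt (\<theta> N) * curvature N A
     - h\<^sup>2 / 2 * (\<theta> N * curvature N A))"
  define zb where "zb = (\<lambda>N A. reduced_Z N (tilt N (?b N)) A / mean_Z N (?b N))"
  define z0 where "z0 = (\<lambda>N A. reduced_Z N (tilt N \<beta>) A / mean_Z N \<beta>)"
  define r where "r = (\<lambda>N. mean_Z N (?b N) / mean_Z N \<beta>)"
  have T: "tendsto_in_prob G (\<lambda>N A. exp (err N A + h\<^sup>2 / 2 * (\<theta> N * curvature N A)) * (zb N A * r N / z0 N A))
     (exp (0 + h\<^sup>2 / 2 * information) * (1 * 1 / 1))"
  proof -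
    have e: "tendsto_in_prob G err 0" unfolding err_def by (rule log_prefactor_tendsto)
    have c: "tendsto_in_prob G (\<lambda>N A. h\<^sup>2 / 2 * (\<theta> N * curvature N A)) (h\<^sup>2 / 2 * information)"
      by (rule tendsto_in_prob_mult[OF tendsto_in_prob_const[OF tendsto_const] curvature_tendsto])
    have zb: "tendsto_in_prob G zb 1" unfolding zb_def by (rule reduced_Z_concentration[OF local_par_tendsto])
    have z0: "tendsto_in_prob G z0 1" unfolding z0_def by (rule reduced_Z_concentration[OF tendsto_const])
    have r: "tendsto_in_prob G (\<lambda>N A. r N) 1" unfolding r_def
      by (rule tendsto_in_prob_const[OF mean_Z_ratio[OF tendsto_const local_par_tendsto]])
    show ?thesis
      by (rule tendsto_in_prob_mult[OF tendsto_in_prob_exp[OF tendsto_in_prob_add[OF e c]]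
        tendsto_in_prob_divide[OF tendsto_in_prob_mult[OF zb r] z0 one_neq_zero]])
  qed
  obtain B where B: "B > \<beta>" using gt_ex by blast
  have BN: "(\<lambda>N. B / real N) \<longlonglongrightarrow> 0" by real_asymp
  have "\<forall>\<^sub>F N in sequentially. \<forall>A\<in>set_pmf (G N). centered_Z_ratio h N A
      = exp (err N A + h\<^sup>2 / 2 * (\<theta> N * curvature N A)) * (zb N A * r N / z0 N A)"
    using eventually_ge_at_top[of 1] order_tendstoD(1)[OF local_par_tendsto[of h] \<beta>] order_tendstoD(2)[OF local_par_tendsto[of h] B]
      order_tendstoD(2)[OF BN half_gt_zero[OF zero_less_one]]
  proof eventually_elim
    case (elim N)
    show ?case
    proof
      fix A assume A: "A \<in> set_pmf (G N)"
      have "exp (- (B\<^sup>2)) \<le> mean_Z N (?b N)" "exp (- (B\<^sup>2)) \<le> mean_Z N \<beta>"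
        by (rule mean_Z_ge; use elim \<beta> B in simp)+
      hence m: "mean_Z N (?b N) > 0" "mean_Z N \<beta> > 0" using exp_gt_zero[of "- (B\<^sup>2)"] by linarith+
      have P: "partition_fun N (\<theta> N) A b = exp (log_prefactor N b A) * reduced_Z N (tilt N b) A" for b
        using partition_fun_reduced[OF A elim(1), of b] by (simp add: log_prefactor_def)
      have z: "reduced_Z N (tilt N \<beta>) A \<noteq> 0" using P[of \<beta>] partition_fun_pos[of N "\<theta> N" A \<beta>] by auto
      have e: "exp (err N A + h\<^sup>2 / 2 * (\<theta> N * curvature N A))
          = exp (log_prefactor N (?b N) A) / exp (log_prefactor N \<beta> A) * exp (- (\<beta> * h * sqrt (\<theta> N) * curvature N A))"
        unfolding err_def by (simp add: exp_diff[symmetric] exp_add[symmetric])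
      show "centered_Z_ratio h N A = exp (err N A + h\<^sup>2 / 2 * (\<theta> N * curvature N A)) * (zb N A * r N / z0 N A)"
        unfolding e centered_Z_ratio_def P zb_def z0_def r_def using m z by simp
    qed
  qed
  from tendsto_in_prob_cong[OF this T] show ?thesis by simp
qed

end

section \<open>Risk of the estimate given the graph\<close>

lemma set_ising_pmf: "set_pmf (ising_pmf N \<theta> A b) \<subseteq> spins N"
  by (auto simp: set_pmf_eq pmf_ising ising_prob_def split: if_splits)

lemma ising_expectation:
  "measure_pmf.expectation (ising_pmf N \<theta> A b) F = (\<Sum>\<sigma>\<in>spins N. ising_prob N \<theta> A b \<sigma> * F \<sigma>)" for F :: "_ \<Rightarrow> real"
  by (subst integral_measure_pmf_real[OF finite_spins]) (auto simp: pmf_ising mult.commute dest: subsetD[OF set_ising_pmf])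

lemma integrable_ising_pmf [simp]: "integrable (measure_pmf (ising_pmf N \<theta> A b)) F" for F :: "_ \<Rightarrow> real"
  by (rule integrable_measure_pmf_finite[OF finite_subset[OF set_ising_pmf finite_spins]])

lemma ising_laplace:
  "measure_pmf.expectation (ising_pmf N \<theta> A b) (\<lambda>\<sigma>. exp (- k * hamiltonian N \<theta> A \<sigma>))
    = partition_fun N \<theta> A (b + k) / partition_fun N \<theta> A b"
proof -
  have "measure_pmf.expectation (ising_pmf N \<theta> A b) (\<lambda>\<sigma>. exp (- k * hamiltonian N \<theta> A \<sigma>))
    = (\<Sum>\<sigma>\<in>spins N. 1 / (2 ^ N * partition_fun N \<theta> A b) * exp (- (b + k) * hamiltonian N \<theta> A \<sigma>))"
    unfolding ising_expectation
    by (rule sum.cong) (auto simp: ising_prob_def exp_add[symmetric] algebra_simps)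
  also have "\<dots> = partition_fun N \<theta> A (b + k) / partition_fun N \<theta> A b"
    unfolding sum_distrib_left[symmetric] by (simp add: partition_fun_def[of N \<theta> A "b + k"])
  finally show ?thesis .
qed

text \<open>
  The constant is \<open>2\<^sup>4 \<cdot> 4!\<close>, from \<open>z\<^sup>4 / 4! \<le> exp z\<close> at \<open>z = \<bar>y\<bar> / 2\<close>.
\<close>
lemma power4_le_exp: "y ^ 4 \<le> 384 * exp (\<bar>y\<bar> / 2)" for y :: real
proof -
  define z where "z = \<bar>y\<bar> / 2"
  have z: "z \<ge> 0" by (simp add: z_def)
  obtain t where "exp z = (\<Sum>m<5. z ^ m / fact m) + exp t / fact 5 * z ^ 5"
    using Maclaurin_exp_le[of z 5] by blast
  hence "exp z = 1 + z + z\<^sup>2 / 2 + z ^ 3 / 6 + z ^ 4 / 24 + exp t / fact 5 * z ^ 5"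
    by (simp add: eval_nat_numeral fact_numeral)
  moreover have "0 \<le> exp t / fact 5 * z ^ 5" "0 \<le> z\<^sup>2 / 2" "0 \<le> z ^ 3 / 6" using z by simp_all
  ultimately have "z ^ 4 / 24 \<le> exp z" using z by linarith
  thus ?thesis by (simp add: z_def power_divide)
qed

text \<open>
  Taylor expansion to fourth order; the odd terms cancel. The constant is \<open>384 / 12\<close>.
\<close>
lemma exp_even_part_bound:
  fixes \<eta> y :: real
  assumes "0 < \<eta>" "\<eta> \<le> 1 / 2"
  shows "\<bar>(exp (\<eta> * y) + exp (- \<eta> * y) - 2) / \<eta>\<^sup>2 - y\<^sup>2\<bar> \<le> 32 * \<eta>\<^sup>2 * (exp (1 * y) + exp (- 1 * y))"
proof -
  define u where "u = \<eta> * y"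
  obtain t where t: "\<bar>t\<bar> \<le> \<bar>u\<bar>" "exp u = (\<Sum>m<4. u ^ m / fact m) + exp t / fact 4 * u ^ 4"
    using Maclaurin_exp_le[of u 4] by blast
  obtain s where s: "\<bar>s\<bar> \<le> \<bar>u\<bar>" "exp (- u) = (\<Sum>m<4. (- u) ^ m / fact m) + exp s / fact 4 * (- u) ^ 4"
    using Maclaurin_exp_le[of "- u" 4] by auto
  have eq: "exp u + exp (- u) - 2 - u\<^sup>2 = (exp t + exp s) / 24 * u ^ 4"
    using t(2) s(2) by (simp add: eval_nat_numeral fact_numeral algebra_simps)
  have uy: "\<bar>u\<bar> \<le> \<bar>y\<bar> / 2" using assms mult_right_mono[of \<eta> "1/2" "\<bar>y\<bar>"] by (simp add: u_def abs_mult)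
  have "(exp t + exp s) / 24 * u ^ 4 \<le> exp (\<bar>y\<bar> / 2) / 12 * u ^ 4"
  proof (rule mult_right_mono)
    have "exp t \<le> exp (\<bar>y\<bar> / 2)" "exp s \<le> exp (\<bar>y\<bar> / 2)" using t(1) s(1) uy by auto
    moreover have "(a + b) / 24 \<le> c / 12" if "a \<le> c" "b \<le> c" for a b c :: real using that by simp
    ultimately show "(exp t + exp s) / 24 \<le> exp (\<bar>y\<bar> / 2) / 12" by blast
  qed simp
  also have "exp (\<bar>y\<bar> / 2) / 12 * u ^ 4 = exp (\<bar>y\<bar> / 2) / 12 * (\<eta> ^ 4 * y ^ 4)" by (simp add: u_def power_mult_distrib)
  also have "exp (\<bar>y\<bar> / 2) / 12 * (\<eta> ^ 4 * y ^ 4) \<le> exp (\<bar>y\<bar> / 2) / 12 * (\<eta> ^ 4 * (384 * exp (\<bar>y\<bar> / 2)))"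
    by (intro mult_left_mono power4_le_exp) auto
  also have "\<dots> = 32 * \<eta> ^ 4 * exp \<bar>y\<bar>" by (simp add: exp_add[symmetric])
  also have "\<dots> \<le> 32 * \<eta> ^ 4 * (exp (1 * y) + exp (- 1 * y))"
    by (intro mult_left_mono) (auto simp: abs_if)
  finally have ub: "exp u + exp (- u) - 2 - u\<^sup>2 \<le> 32 * \<eta> ^ 4 * (exp (1 * y) + exp (- 1 * y))" unfolding eq .
  have "0 \<le> exp u + exp (- u) - 2 - u\<^sup>2" unfolding eq by simp
  hence "\<bar>exp u + exp (- u) - 2 - u\<^sup>2\<bar> / \<eta>\<^sup>2 \<le> 32 * \<eta> ^ 4 * (exp (1 * y) + exp (- 1 * y)) / \<eta>\<^sup>2"
    using ub by (intro divide_right_mono) auto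
  also have "\<dots> = 32 * \<eta>\<^sup>2 * (exp (1 * y) + exp (- 1 * y))" using assms by (simp add: eval_nat_numeral)
  also have "\<bar>exp u + exp (- u) - 2 - u\<^sup>2\<bar> / \<eta>\<^sup>2 = \<bar>(exp u + exp (- u) - 2 - u\<^sup>2) / \<eta>\<^sup>2\<bar>" by simp
  also have "(exp u + exp (- u) - 2 - u\<^sup>2) / \<eta>\<^sup>2 = (exp (\<eta> * y) + exp (- \<eta> * y) - 2) / \<eta>\<^sup>2 - y\<^sup>2"
    using assms by (simp add: u_def diff_divide_distrib power_mult_distrib)
  finally show ?thesis .
qed

text \<open>
  Convergence of Laplace transforms to that of a centred Gaussian of variance \<open>v\<close> forces convergence of second
  moments: the second moment is a second difference quotient of the Laplace transform at \<open>0\<close>, with an error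
  controlled by the Laplace transform at \<open>\<plusminus>1\<close>.
\<close>
lemma tendsto_in_prob_second_moment:
  fixes M :: "real \<Rightarrow> nat \<Rightarrow> 'a \<Rightarrow> real"
  assumes v: "v > 0" and M: "\<And>k. tendsto_in_prob p (M k) (exp (k\<^sup>2 / 2 * v))"
    and Q: "\<And>N \<omega> \<eta>. 0 < \<eta> \<Longrightarrow> \<eta> \<le> 1 / 2 \<Longrightarrow>
      \<bar>(M \<eta> N \<omega> + M (- \<eta>) N \<omega> - 2) / \<eta>\<^sup>2 - Q N \<omega>\<bar> \<le> 32 * \<eta>\<^sup>2 * (M 1 N \<omega> + M (- 1) N \<omega>)"
  shows "tendsto_in_prob p Q v"
proof -
  define s where "s = exp (v / 2) + exp (v / 2)"
  have S: "tendsto_in_prob p (\<lambda>N \<omega>. M 1 N \<omega> + M (- 1) N \<omega>) s"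
    using tendsto_in_prob_add[OF M[of 1] M[of "-1"]] by (simp add: s_def)
  have s0: "s > 0" by (simp add: s_def add_pos_pos)
  have D: "tendsto_in_prob p (\<lambda>N \<omega>. (M \<eta> N \<omega> + M (- \<eta>) N \<omega> - 2) / \<eta>\<^sup>2) ((2 * exp (\<eta>\<^sup>2 / 2 * v) - 2) / \<eta>\<^sup>2)" if "\<eta> > 0" for \<eta>
  proof -
    have "tendsto_in_prob p (\<lambda>N \<omega>. (M \<eta> N \<omega> + M (- \<eta>) N \<omega> - 2) / \<eta>\<^sup>2) ((exp (\<eta>\<^sup>2 / 2 * v) + exp ((- \<eta>)\<^sup>2 / 2 * v) - 2) / \<eta>\<^sup>2)"
      by (intro tendsto_in_prob_divide tendsto_in_prob_diff tendsto_in_prob_add M tendsto_in_prob_const tendsto_const) (use that in auto)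
    thus ?thesis by simp
  qed
  have l1: "((\<lambda>\<eta>. (2 * exp (\<eta>\<^sup>2 / 2 * v) - 2) / \<eta>\<^sup>2) \<longlongrightarrow> v) (at_right 0)" using v by real_asymp
  have l2: "((\<lambda>\<eta>::real. 32 * \<eta>\<^sup>2 * (s + 1)) \<longlongrightarrow> 0) (at_right 0)" by real_asymp
  show ?thesis
    unfolding tendsto_in_prob_def
  proof (intro allI impI)
    fix \<epsilon> :: real assume e: "\<epsilon> > 0"
    hence e3: "\<epsilon> / 3 > 0" by simp
    have ev1: "\<forall>\<^sub>F \<eta> in at_right 0. dist ((2 * exp (\<eta>\<^sup>2 / 2 * v) - 2) / \<eta>\<^sup>2) v < \<epsilon> / 3"
      using tendstoD[OF l1 e3] .
    have ev2: "\<forall>\<^sub>F \<eta> in at_right 0. 32 * \<eta>\<^sup>2 * (s + 1) < \<epsilon> / 3" using order_tendstoD(2)[OF l2 e3] .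
    have ev3: "\<forall>\<^sub>F \<eta> in at_right (0::real). 0 < \<eta> \<and> \<eta> < 1 / 2"
      using eventually_at_right_real[of 0 "1/2"] by (simp add: eventually_mono)
    have "\<forall>\<^sub>F \<eta> in at_right (0::real). dist ((2 * exp (\<eta>\<^sup>2 / 2 * v) - 2) / \<eta>\<^sup>2) v < \<epsilon> / 3
        \<and> 32 * \<eta>\<^sup>2 * (s + 1) < \<epsilon> / 3 \<and> (0 < \<eta> \<and> \<eta> < 1 / 2)"
      by (rule eventually_conj[OF ev1 eventually_conj[OF ev2 ev3]])
    then obtain \<eta> where \<eta>: "\<bar>(2 * exp (\<eta>\<^sup>2 / 2 * v) - 2) / \<eta>\<^sup>2 - v\<bar> < \<epsilon> / 3" "32 * \<eta>\<^sup>2 * (s + 1) < \<epsilon> / 3" "0 < \<eta>" "\<eta> \<le> 1 / 2"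
      using eventually_happens'[OF trivial_limit_at_right_real] unfolding dist_real_def by (metis (lifting) less_imp_le)
    define d where "d = (2 * exp (\<eta>\<^sup>2 / 2 * v) - 2) / \<eta>\<^sup>2"
    have "tendsto_in_prob p (\<lambda>N \<omega>. if \<bar>Q N \<omega> - v\<bar> > \<epsilon> then 1 else 0) 0"
    proof (rule tendsto_in_prob_squeeze[OF _ D[OF \<eta>(3)] S])
      fix \<epsilon>' :: real assume "\<epsilon>' > 0"
      have "\<bar>D' - d\<bar> > min (\<epsilon> / 3) 1 \<or> \<bar>S' - s\<bar> > min (\<epsilon> / 3) 1" if "\<bar>q - v\<bar> > \<epsilon>" "\<bar>D' - q\<bar> \<le> 32 * \<eta>\<^sup>2 * S'" for q D' S'
      proof (rule ccontr)
        assume "\<not> ?thesis"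
        moreover have "min (\<epsilon> / 3) 1 \<le> \<epsilon> / 3" "min (\<epsilon> / 3) 1 \<le> 1" by simp_all
        ultimately have 1: "\<bar>D' - d\<bar> \<le> \<epsilon> / 3" "\<bar>S' - s\<bar> \<le> 1" by linarith+
        have "32 * \<eta>\<^sup>2 * S' \<le> 32 * \<eta>\<^sup>2 * (s + 1)" using 1 by (intro mult_left_mono) auto
        thus False using that 1 \<eta>(1,2) unfolding d_def[symmetric] by linarith
      qed
      thus "\<exists>\<delta>>0. \<forall>\<^sub>F N in sequentially. \<forall>\<omega>\<in>set_pmf (p N). \<epsilon>' < \<bar>(if \<epsilon> < \<bar>Q N \<omega> - v\<bar> then 1 else 0) - 0\<bar> \<longrightarrow>
          \<delta> < \<bar>(M \<eta> N \<omega> + M (- \<eta>) N \<omega> - 2) / \<eta>\<^sup>2 - (2 * exp (\<eta>\<^sup>2 / 2 * v) - 2) / \<eta>\<^sup>2\<bar> \<or>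
          \<delta> < \<bar>M 1 N \<omega> + M (- 1) N \<omega> - s\<bar>"
        using Q[OF \<eta>(3,4)] e \<open>\<epsilon>' > 0\<close> unfolding d_def
        by (intro exI[of _ "min (\<epsilon> / 3) 1"]) auto
    qed
    hence "(\<lambda>N. measure_pmf.prob (p N) {\<omega>. 1 / 2 < \<bar>(if \<epsilon> < \<bar>Q N \<omega> - v\<bar> then 1 else 0) - (0::real)\<bar>}) \<longlonglongrightarrow> 0"
      unfolding tendsto_in_prob_def by (elim allE[of _ "1/2"]) simp
    moreover have "{\<omega>. 1 / 2 < \<bar>(if \<epsilon> < \<bar>Q N \<omega> - v\<bar> then 1 else 0) - (0::real)\<bar>} = {\<omega>. \<epsilon> < \<bar>Q N \<omega> - v\<bar>}" for N
      by auto
    ultimately show "(\<lambda>N. measure_pmf.prob (p N) {\<omega>. \<epsilon> < \<bar>Q N \<omega> - v\<bar>}) \<longlonglongrightarrow> 0" by simp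
  qed
qed

context high_temperature
begin

text \<open>
  Given the graph, the derivative in \<open>h\<close> of the log-likelihood at \<open>h\<close> is this quantity up to centring at the exact mean.
\<close>
definition score :: "real \<Rightarrow> nat \<Rightarrow> (nat \<Rightarrow> nat \<Rightarrow> real) \<Rightarrow> (nat \<Rightarrow> real) \<Rightarrow> real" where
  "score h N A \<sigma> = sqrt (\<theta> N) * (- hamiltonian N (\<theta> N) A \<sigma> - local_par N h * curvature N A)"

abbreviation local_ising :: "real \<Rightarrow> nat \<Rightarrow> (nat \<Rightarrow> nat \<Rightarrow> real) \<Rightarrow> (nat \<Rightarrow> real) pmf" where
  "local_ising h N A \<equiv> ising_pmf N (\<theta> N) A (local_par N h)"

text \<open>
  In an exponential family the Laplace transform of the sufficient statistic is a ratio of partition functions. The residual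
  factor comes from centring at \<open>\<beta> + h \<surd>\<theta>\<close> instead of \<open>\<beta>\<close>.
\<close>
lemma score_laplace_eq:
  assumes N: "N \<ge> 1"
  shows "measure_pmf.expectation (local_ising h N A) (\<lambda>\<sigma>. exp (k * score h N A \<sigma>))
    = centered_Z_ratio (h + k) N A / centered_Z_ratio h N A * exp (- (k * h) * (\<theta> N * curvature N A))"
proof -
  have th: "\<theta> N > 0" using \<theta> N by auto
  define c where "c = curvature N A"
  define s where "s = sqrt (\<theta> N)"
  have s: "s * s = \<theta> N" using th by (simp add: s_def)
  have "measure_pmf.expectation (local_ising h N A) (\<lambda>\<sigma>. exp (k * score h N A \<sigma>))
     = measure_pmf.expectation (local_ising h N A) (\<lambda>\<sigma>. exp (- (k * s) * hamiltonian N (\<theta> N) A \<sigma>) * exp (- (k * s * local_par N h * c)))"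
    by (rule Bochner_Integration.integral_cong) (auto simp: score_def s_def c_def exp_add[symmetric] algebra_simps)
  also have "\<dots> = partition_fun N (\<theta> N) A (local_par N h + k * s) / partition_fun N (\<theta> N) A (local_par N h) * exp (- (k * s * local_par N h * c))"
    using ising_laplace[of N "\<theta> N" A "local_par N h" "k * s"] by simp
  also have "local_par N h + k * s = local_par N (h + k)" by (simp add: local_par_def s_def algebra_simps)
  also have "- (k * s * local_par N h * c) = - (\<beta> * (h + k) * s * c) - (- (\<beta> * h * s * c)) + (- (k * h) * (\<theta> N * c))"
    unfolding s[symmetric] by (simp add: local_par_def s_def[symmetric] algebra_simps)
  also have "partition_fun N (\<theta> N) A (local_par N (h + k)) / partition_fun N (\<theta> N) A (local_par N h) * exp \<dots>
    = centered_Z_ratio (h + k) N A / centered_Z_ratio h N A * exp (- (k * h) * (\<theta> N * c))"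
    unfolding centered_Z_ratio_def s_def[symmetric] c_def[symmetric] exp_add exp_diff
    using partition_fun_pos[of N "\<theta> N" A \<beta>] by simp
  finally show ?thesis by (simp add: c_def)
qed

lemma score_laplace_tendsto:
  "tendsto_in_prob G (\<lambda>N A. measure_pmf.expectation (local_ising h N A) (\<lambda>\<sigma>. exp (k * score h N A \<sigma>))) (exp (k\<^sup>2 / 2 * information))"
proof -
  have "tendsto_in_prob G (\<lambda>N A. centered_Z_ratio (h + k) N A / centered_Z_ratio h N A * exp (- (k * h) * (\<theta> N * curvature N A)))
    (exp ((h + k)\<^sup>2 / 2 * information) / exp (h\<^sup>2 / 2 * information) * exp (- (k * h) * information))"
    by (intro tendsto_in_prob_mult tendsto_in_prob_divide centered_Z_ratio_tendsto tendsto_in_prob_exp tendsto_in_prob_const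
        curvature_tendsto tendsto_const) simp
  also have "exp ((h + k)\<^sup>2 / 2 * information) / exp (h\<^sup>2 / 2 * information) * exp (- (k * h) * information) = exp (k\<^sup>2 / 2 * information)"
    by (simp add: exp_diff[symmetric] exp_add[symmetric] power2_eq_square algebra_simps add_divide_distrib)
  finally show ?thesis
    by (rule tendsto_in_prob_cong[rotated]) (use eventually_ge_at_top[of 1] in eventually_elim, simp add: score_laplace_eq)
qed

lemma score_second_moment_tendsto:
  "tendsto_in_prob G (\<lambda>N A. measure_pmf.expectation (local_ising h N A) (\<lambda>\<sigma>. (score h N A \<sigma>)\<^sup>2)) information"
proof (rule tendsto_in_prob_second_moment[OF information_pos score_laplace_tendsto])
  fix N A and \<eta> :: real assume \<eta>: "0 < \<eta>" "\<eta> \<le> 1 / 2"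
  let ?E = "measure_pmf.expectation (local_ising h N A)"
  let ?Y = "score h N A"
  define D where "D = (\<lambda>\<sigma>. (exp (\<eta> * ?Y \<sigma>) + exp (- \<eta> * ?Y \<sigma>) - 2) / \<eta>\<^sup>2 - (?Y \<sigma>)\<^sup>2)"
  define S where "S = (\<lambda>\<sigma>. 32 * \<eta>\<^sup>2 * (exp (1 * ?Y \<sigma>) + exp (- 1 * ?Y \<sigma>)))"
  have D: "?E D = (?E (\<lambda>\<sigma>. exp (\<eta> * ?Y \<sigma>)) + ?E (\<lambda>\<sigma>. exp (- \<eta> * ?Y \<sigma>)) - 2) / \<eta>\<^sup>2 - ?E (\<lambda>\<sigma>. (?Y \<sigma>)\<^sup>2)"
    unfolding D_def by simp
  have S: "?E S = 32 * \<eta>\<^sup>2 * (?E (\<lambda>\<sigma>. exp (1 * ?Y \<sigma>)) + ?E (\<lambda>\<sigma>. exp (- 1 * ?Y \<sigma>)))"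
    unfolding S_def by (simp only: Bochner_Integration.integral_mult_right_zero Bochner_Integration.integral_add[OF integrable_ising_pmf integrable_ising_pmf])
  have "\<bar>D \<sigma>\<bar> \<le> S \<sigma>" for \<sigma>
    unfolding D_def S_def by (rule exp_even_part_bound[OF \<eta>])
  hence "?E (\<lambda>\<sigma>. \<bar>D \<sigma>\<bar>) \<le> ?E S"
    by (rule integral_mono[OF integrable_ising_pmf integrable_ising_pmf])
  hence "\<bar>?E D\<bar> \<le> ?E S" by (rule order_trans[OF integral_abs_bound])
  thus "\<bar>(?E (\<lambda>\<sigma>. exp (\<eta> * ?Y \<sigma>)) + ?E (\<lambda>\<sigma>. exp (- \<eta> * ?Y \<sigma>)) - 2) / \<eta>\<^sup>2 - ?E (\<lambda>\<sigma>. (?Y \<sigma>)\<^sup>2)\<bar>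
    \<le> 32 * \<eta>\<^sup>2 * (?E (\<lambda>\<sigma>. exp (1 * ?Y \<sigma>)) + ?E (\<lambda>\<sigma>. exp (- 1 * ?Y \<sigma>)))"
    unfolding D S .
qed

lemma scaled_cond_mse_eq:
  assumes N: "N \<ge> 1" and c: "curvature N A \<noteq> 0"
  shows "1 / \<theta> N * cond_mse N (\<theta> N) A (tilde_beta N (\<theta> N)) (local_par N h)
    = measure_pmf.expectation (local_ising h N A) (\<lambda>\<sigma>. (score h N A \<sigma>)\<^sup>2) / (\<theta> N * curvature N A)\<^sup>2"
proof -
  have th: "\<theta> N > 0" using \<theta> N by auto
  have "tilde_beta N (\<theta> N) (\<sigma>, A) - local_par N h = score h N A \<sigma> / (sqrt (\<theta> N) * curvature N A)" for \<sigma>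
  proof -
    define H where "H = hamiltonian N (\<theta> N) A \<sigma>"
    define S where "S = (\<Sum>i=1..N. \<Sum>j=1..N. A i j)"
    have cS: "curvature N A = S / (2 * (real N)\<^sup>2 * (\<theta> N)\<^sup>2)" by (simp add: curvature_def S_def)
    have "S \<noteq> 0" using c unfolding cS by auto
    hence "tilde_beta N (\<theta> N) (\<sigma>, A) = - H / curvature N A"
      using th N unfolding tilde_beta_def cS S_def[symmetric] H_def[symmetric] prod.case by (simp add: field_simps)
    moreover have "score h N A \<sigma> / (sqrt (\<theta> N) * curvature N A) = (- H - local_par N h * curvature N A) / curvature N A"
      using th by (simp add: score_def H_def)
    ultimately show ?thesis using c by (simp add: diff_divide_distrib)
  qed
  hence "cond_mse N (\<theta> N) A (tilde_beta N (\<theta> N)) (local_par N h)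
     = measure_pmf.expectation (local_ising h N A) (\<lambda>\<sigma>. (score h N A \<sigma>)\<^sup>2) / (sqrt (\<theta> N) * curvature N A)\<^sup>2"
    by (simp add: cond_mse_def power_divide)
  thus ?thesis using th by (simp add: power_mult_distrib power2_eq_square)
qed

text \<open>
  The formula for the rescaled risk requires an edge; that the graph has one is implied by \<open>\<theta> c\<close> being close to its positive
  limit.
\<close>
lemma scaled_cond_mse_tendsto:
  "tendsto_in_prob G (\<lambda>N A. 1 / \<theta> N * cond_mse N (\<theta> N) A (tilde_beta N (\<theta> N)) (local_par N h)) (2 / graphon_integral W)"
proof -
  let ?X = "\<lambda>N A. measure_pmf.expectation (local_ising h N A) (\<lambda>\<sigma>. (score h N A \<sigma>)\<^sup>2) / (\<theta> N * curvature N A)\<^sup>2"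
  have "tendsto_in_prob G ?X (information / (information * information))"
    unfolding power2_eq_square[of "\<theta> _ * _"] using information_pos
    by (intro tendsto_in_prob_divide tendsto_in_prob_mult score_second_moment_tendsto curvature_tendsto) auto
  moreover have "information / (information * information) = 2 / graphon_integral W"
    using W_pos by (simp add: information_def)
  ultimately have X: "tendsto_in_prob G ?X (2 / graphon_integral W)" by simp
  show ?thesis
  proof (rule tendsto_in_prob_squeeze[OF _ X curvature_tendsto])
    fix \<epsilon> :: real assume e: "\<epsilon> > 0"
    show "\<exists>\<delta>>0. \<forall>\<^sub>F N in sequentially. \<forall>A\<in>set_pmf (G N).
      \<epsilon> < \<bar>1 / \<theta> N * cond_mse N (\<theta> N) A (tilde_beta N (\<theta> N)) (local_par N h) - 2 / graphon_integral W\<bar> \<longrightarrow>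
      \<delta> < \<bar>?X N A - 2 / graphon_integral W\<bar> \<or> \<delta> < \<bar>\<theta> N * curvature N A - information\<bar>"
    proof (intro exI[of _ "min \<epsilon> (information / 2)"] conjI)
      show "\<forall>\<^sub>F N in sequentially. \<forall>A\<in>set_pmf (G N).
        \<epsilon> < \<bar>1 / \<theta> N * cond_mse N (\<theta> N) A (tilde_beta N (\<theta> N)) (local_par N h) - 2 / graphon_integral W\<bar> \<longrightarrow>
        min \<epsilon> (information / 2) < \<bar>?X N A - 2 / graphon_integral W\<bar> \<or>
        min \<epsilon> (information / 2) < \<bar>\<theta> N * curvature N A - information\<bar>"
        using eventually_ge_at_top[of 1]
      proof (eventually_elim, intro ballI impI)
        fix N A assume N: "N \<ge> 1"
          and big: "\<epsilon> < \<bar>1 / \<theta> N * cond_mse N (\<theta> N) A (tilde_beta N (\<theta> N)) (local_par N h) - 2 / graphon_integral W\<bar>"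
        show "min \<epsilon> (information / 2) < \<bar>?X N A - 2 / graphon_integral W\<bar> \<or>
          min \<epsilon> (information / 2) < \<bar>\<theta> N * curvature N A - information\<bar>"
        proof (cases "curvature N A = 0")
          case True thus ?thesis using information_pos by (simp add: min_less_iff_disj)
        next
          case False
          from big show ?thesis unfolding scaled_cond_mse_eq[OF N False] by (simp add: min_less_iff_disj)
        qed
      qed
    qed (use e information_pos in auto)
  qed
qed

lemma sup_scaled_cond_mse_tendsto:
  assumes I: "finite I" "I \<noteq> {}"
  shows "tendsto_in_prob G (\<lambda>N A. SUP h\<in>I. 1 / \<theta> N * cond_mse N (\<theta> N) A (tilde_beta N (\<theta> N)) (\<beta> + h * sqrt (\<theta> N)))
    (2 / graphon_integral W)"
proof -
  have "tendsto_in_prob G (\<lambda>N A. Max ((\<lambda>h. 1 / \<theta> N * cond_mse N (\<theta> N) A (tilde_beta N (\<theta> N)) (local_par N h)) ` I)) (2 / graphon_integral W)"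
    by (rule tendsto_in_prob_Max[OF I scaled_cond_mse_tendsto])
  thus ?thesis using I by (simp add: cSup_eq_Max local_par_def)
qed

end

section \<open>A finite-difference van Trees inequality\<close>

text \<open>
  If \<open>V k\<close> are unit masses for \<open>0 < k < n\<close> and \<open>V 0 = V n = 0\<close>, then summation by parts evaluates the pairing of
  the errors \<open>T - b k\<close> with the differences \<open>V (k + 1) - V k\<close>: the estimator drops out and the step
  \<open>s\<close> of the grid remains. The Cauchy-Schwarz inequality then bounds the risk under the uniform prior from below.
\<close>
lemma van_Trees_finite_difference:
  fixes p V :: "nat \<Rightarrow> 's \<Rightarrow> real" and T :: "'s \<Rightarrow> real" and b :: "nat \<Rightarrow> real"
  assumes S: "finite S" and n: "n \<ge> 1"
    and p: "\<And>k x. k < n \<Longrightarrow> x \<in> S \<Longrightarrow> p k x > 0"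
    and V0: "\<And>x. x \<in> S \<Longrightarrow> V 0 x = 0" and Vn: "\<And>x. x \<in> S \<Longrightarrow> V n x = 0"
    and V1: "\<And>k. 0 < k \<Longrightarrow> k < n \<Longrightarrow> (\<Sum>x\<in>S. V k x) = 1"
    and b: "\<And>k. b (Suc k) - b k = s"
  shows "(s * (real n - 1))\<^sup>2 \<le> (\<Sum>k<n. \<Sum>x\<in>S. p k x * (T x - b k)\<^sup>2) * (\<Sum>k<n. \<Sum>x\<in>S. (V (Suc k) x - V k x)\<^sup>2 / p k x)"
proof -
  have abel: "(\<Sum>k<m. (T x - b k) * (V (Suc k) x - V k x)) = (T x - b m) * V m x - (T x - b 0) * V 0 x + s * (\<Sum>k<m. V (Suc k) x)" for m x
  proof (induction m)
    case (Suc m)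
    have bS: "b (Suc m) = b m + s" using b[of m] by simp
    show ?case unfolding sum.lessThan_Suc Suc.IH bS by (simp add: algebra_simps)
  qed simp
  have "(\<Sum>k<n. \<Sum>x\<in>S. (T x - b k) * (V (Suc k) x - V k x)) = (\<Sum>x\<in>S. \<Sum>k<n. (T x - b k) * (V (Suc k) x - V k x))"
    by (rule sum.swap)
  also have "\<dots> = (\<Sum>x\<in>S. s * (\<Sum>k<n. V (Suc k) x))"
    by (rule sum.cong) (auto simp: abel V0 Vn)
  also have "\<dots> = s * (\<Sum>k<n. \<Sum>x\<in>S. V (Suc k) x)"
    by (simp add: sum_distrib_left[symmetric] sum.swap[of _ S])
  also have "(\<Sum>k<n. \<Sum>x\<in>S. V (Suc k) x) = (\<Sum>k<n. if Suc k = n then 0 else 1)"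
    by (rule sum.cong) (auto simp: V1 Vn)
  also have "\<dots> = real n - 1"
  proof -
    obtain m where "n = Suc m" using n by (cases n) auto
    thus ?thesis by simp
  qed
  finally have L: "(\<Sum>k<n. \<Sum>x\<in>S. (T x - b k) * (V (Suc k) x - V k x)) = s * (real n - 1)" .
  define f where "f = (\<lambda>z. sqrt (p (fst z) (snd z)) * (T (snd z) - b (fst z)))"
  define g where "g = (\<lambda>z. (V (Suc (fst z)) (snd z) - V (fst z) (snd z)) / sqrt (p (fst z) (snd z)))"
  let ?I = "{..<n} \<times> S"
  have pz: "p (fst z) (snd z) > 0" if "z \<in> ?I" for z using that p by auto
  have "s * (real n - 1) = (\<Sum>z\<in>?I. f z * g z)"
    unfolding L[symmetric] sum.cartesian_product
    by (rule sum.cong) (use pz in \<open>fastforce simp: f_def g_def\<close>)+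
  hence "(s * (real n - 1))\<^sup>2 \<le> (\<Sum>z\<in>?I. (f z)\<^sup>2) * (\<Sum>z\<in>?I. (g z)\<^sup>2)"
    using Cauchy_Schwarz_ineq_sum[of f g ?I] by simp
  also have "(\<Sum>z\<in>?I. (f z)\<^sup>2) = (\<Sum>k<n. \<Sum>x\<in>S. p k x * (T x - b k)\<^sup>2)"
    unfolding sum.cartesian_product
    by (rule sum.cong[OF refl]) (use pz in \<open>auto simp: f_def power_mult_distrib less_imp_le\<close>)
  also have "(\<Sum>z\<in>?I. (g z)\<^sup>2) = (\<Sum>k<n. \<Sum>x\<in>S. (V (Suc k) x - V k x)\<^sup>2 / p k x)"
    unfolding sum.cartesian_product
    by (rule sum.cong[OF refl]) (use pz in \<open>auto simp: g_def power_divide less_imp_le\<close>)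
  finally show ?thesis .
qed

text \<open>
  A form of Fatou's lemma for convergence in probability.
\<close>
lemma expectation_ge_of_tendsto_in_prob:
  assumes fin: "\<And>N. finite (set_pmf (p N))" and nn: "\<And>N \<omega>. 0 \<le> X N \<omega>"
    and X: "tendsto_in_prob p X L" and e: "\<epsilon> > 0"
  shows "\<forall>\<^sub>F N in sequentially. measure_pmf.expectation (p N) (X N) \<ge> L - \<epsilon>"
proof -
  define a where "a = max 0 (L - \<epsilon> / 2)"
  have "(\<lambda>N. a * (1 - measure_pmf.prob (p N) {\<omega>. \<epsilon> / 2 < \<bar>X N \<omega> - L\<bar>})) \<longlonglongrightarrow> a * (1 - 0)"
    by (intro tendsto_intros X[unfolded tendsto_in_prob_def, rule_format]) (use e in simp)
  moreover have "L - \<epsilon> < a * (1 - 0)" using e by (simp add: a_def)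
  ultimately have "\<forall>\<^sub>F N in sequentially. L - \<epsilon> < a * (1 - measure_pmf.prob (p N) {\<omega>. \<epsilon> / 2 < \<bar>X N \<omega> - L\<bar>})"
    by (rule order_tendstoD(1))
  thus ?thesis
  proof eventually_elim
    case (elim N)
    let ?B = "{\<omega>. \<epsilon> / 2 < \<bar>X N \<omega> - L\<bar>}"
    have "a * (1 - measure_pmf.prob (p N) ?B) = measure_pmf.expectation (p N) (\<lambda>\<omega>. a * (1 - indicator ?B \<omega>))"
      by (simp add: integrable_measure_pmf_finite[OF fin])
    also have "\<dots> \<le> measure_pmf.expectation (p N) (X N)"
      by (rule integral_mono)
         (use nn[of N] e in \<open>auto simp: integrable_measure_pmf_finite[OF fin] a_def indicator_def abs_if split: if_splits\<close>)
    finally show ?case using elim by simp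
  qed
qed

section \<open>The local asymptotic minimax bound\<close>

text \<open>
  With step \<open>\<eta> = n\<^bsup>-1/4\<^esup>\<close> the grid becomes fine while \<open>n \<eta>\<^sup>2 \<longlongrightarrow> \<infinity>\<close>, so that the two ends of the grid, where the test masses vanish,
  become negligible.
\<close>
lemma grid_bounds_tendsto:
  fixes v :: real
  assumes "v > 0"
  shows "(\<lambda>n. ((real n - 1) * real n powr (- 1 / 4))\<^sup>2 / (real n * (2 * (real n - 1) * exp (v * (real n powr (- 1 / 4))\<^sup>2 / 4)
      - 2 * (real n - 2) * exp (- (v * (real n powr (- 1 / 4))\<^sup>2 / 4)))) - 1 / real n) \<longlonglongrightarrow> inverse v"
  using assms by real_asymp

lemma finite_set_ising: "finite (set_pmf (ising_pmf N \<theta> A b))"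
  by (rule finite_subset[OF set_ising_pmf finite_spins])

lemma mse_eq_expectation_cond_mse:
  "mse N \<theta> W T b = measure_pmf.expectation (graph_pmf N \<theta> W) (\<lambda>A. cond_mse N \<theta> A T b)"
proof -
  let ?k = "\<lambda>A. map_pmf (\<lambda>\<sigma>. (\<sigma>, A)) (ising_pmf N \<theta> A b)"
  have "data_pmf N \<theta> W b = graph_pmf N \<theta> W \<bind> ?k"
    by (simp add: data_pmf_def map_pmf_def)
  hence "mse N \<theta> W T b = (\<Sum>A\<in>set_pmf (graph_pmf N \<theta> W). pmf (graph_pmf N \<theta> W) A *\<^sub>R
      measure_pmf.expectation (?k A) (\<lambda>d. (T d - b)\<^sup>2))"
    unfolding mse_def by (simp only:) (rule pmf_expectation_bind; auto simp: finite_set_graph_pmf finite_set_ising)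
  also have "\<dots> = (\<Sum>A\<in>set_pmf (graph_pmf N \<theta> W). pmf (graph_pmf N \<theta> W) A *\<^sub>R cond_mse N \<theta> A T b)"
    by (simp add: cond_mse_def)
  also have "\<dots> = measure_pmf.expectation (graph_pmf N \<theta> W) (\<lambda>A. cond_mse N \<theta> A T b)"
    by (rule integral_measure_pmf[symmetric]) (auto simp: finite_set_graph_pmf)
  finally show ?thesis .
qed

context high_temperature
begin

definition overlap :: "real \<Rightarrow> real \<Rightarrow> real \<Rightarrow> nat \<Rightarrow> (nat \<Rightarrow> nat \<Rightarrow> real) \<Rightarrow> real" where
  "overlap a b c N A = (\<Sum>\<sigma>\<in>spins N. ising_prob N (\<theta> N) A (local_par N a) \<sigma> * ising_prob N (\<theta> N) A (local_par N b) \<sigma>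
      / ising_prob N (\<theta> N) A (local_par N c) \<sigma>)"

text \<open>Overlaps of an exponential family are again ratios of partition functions.\<close>
lemma overlap_eq:
  "overlap a b c N A = centered_Z_ratio (a + b - c) N A * centered_Z_ratio c N A / (centered_Z_ratio a N A * centered_Z_ratio b N A)"
proof -
  define Z where "Z = (\<lambda>h. partition_fun N (\<theta> N) A (local_par N h))"
  have Z: "Z h > 0" for h by (simp add: Z_def partition_fun_pos)
  have "overlap a b c N A = (\<Sum>\<sigma>\<in>spins N. Z c / (2 ^ N * (Z a * Z b)) * exp (- local_par N (a + b - c) * hamiltonian N (\<theta> N) A \<sigma>))"
    unfolding overlap_def
  proof (rule sum.cong[OF refl])
    fix \<sigma> assume \<sigma>: "\<sigma> \<in> spins N"
    define H where "H = hamiltonian N (\<theta> N) A \<sigma>"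
    have ip: "ising_prob N (\<theta> N) A (local_par N h) \<sigma> = exp (- local_par N h * H) / (2 ^ N * Z h)" for h
      using \<sigma> by (simp add: ising_prob_def Z_def H_def)
    have "exp (- local_par N (a + b - c) * H) = exp (- local_par N a * H) * exp (- local_par N b * H) / exp (- local_par N c * H)"
      by (simp add: exp_add[symmetric] exp_diff[symmetric] local_par_def algebra_simps)
    thus "ising_prob N (\<theta> N) A (local_par N a) \<sigma> * ising_prob N (\<theta> N) A (local_par N b) \<sigma> / ising_prob N (\<theta> N) A (local_par N c) \<sigma>
      = Z c / (2 ^ N * (Z a * Z b)) * exp (- local_par N (a + b - c) * hamiltonian N (\<theta> N) A \<sigma>)"
      unfolding ip H_def[symmetric] using Z[of a] Z[of b] Z[of c] by (simp add: field_simps)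
  qed
  also have "\<dots> = Z c * Z (a + b - c) / (Z a * Z b)"
    unfolding sum_distrib_left[symmetric] using Z[of a] Z[of b]
    by (simp add: Z_def partition_fun_def[of N "\<theta> N" A "local_par N (a + b - c)"])
  finally have o: "overlap a b c N A = Z c * Z (a + b - c) / (Z a * Z b)" .
  define z where "z = partition_fun N (\<theta> N) A \<beta>"
  have z: "z > 0" by (simp add: z_def partition_fun_pos)
  define t where "t = \<beta> * sqrt (\<theta> N) * curvature N A"
  have r: "centered_Z_ratio h N A = Z h / z * exp (- (h * t))" for h
    by (simp add: centered_Z_ratio_def Z_def z_def t_def mult_ac)
  have "exp (- ((a + b - c) * t)) * exp (- (c * t)) = exp (- (a * t)) * exp (- (b * t))"
    by (simp add: exp_add[symmetric] algebra_simps)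
  hence num: "centered_Z_ratio (a + b - c) N A * centered_Z_ratio c N A
     = Z (a + b - c) * Z c / (z * z) * (exp (- (a * t)) * exp (- (b * t)))"
    unfolding r by (simp add: mult_ac)
  have den: "centered_Z_ratio a N A * centered_Z_ratio b N A = Z a * Z b / (z * z) * (exp (- (a * t)) * exp (- (b * t)))"
    unfolding r by (simp add: mult_ac)
  define E where "E = exp (- (a * t)) * exp (- (b * t))"
  have "E \<noteq> 0" by (simp add: E_def)
  thus ?thesis unfolding o num den E_def[symmetric] using z by (simp add: mult.commute)
qed

text \<open>
  The exponents combine to \<open>((a + b - c)\<^sup>2 + c\<^sup>2 - a\<^sup>2 - b\<^sup>2) / 2 = (a - c) (b - c)\<close>.
\<close>
lemma overlap_tendsto: "tendsto_in_prob G (overlap a b c) (exp ((a - c) * (b - c) * information))"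
proof -
  have "tendsto_in_prob G (\<lambda>N A. centered_Z_ratio (a + b - c) N A * centered_Z_ratio c N A / (centered_Z_ratio a N A * centered_Z_ratio b N A))
     (exp ((a + b - c)\<^sup>2 / 2 * information) * exp (c\<^sup>2 / 2 * information) / (exp (a\<^sup>2 / 2 * information) * exp (b\<^sup>2 / 2 * information)))"
    by (intro tendsto_in_prob_divide tendsto_in_prob_mult centered_Z_ratio_tendsto) simp
  moreover have "exp ((a + b - c)\<^sup>2 / 2 * information) * exp (c\<^sup>2 / 2 * information) / (exp (a\<^sup>2 / 2 * information) * exp (b\<^sup>2 / 2 * information))
     = exp ((a - c) * (b - c) * information)"
    by (simp add: exp_add[symmetric] exp_diff[symmetric]) (simp add: field_simps power2_eq_square)
  ultimately show ?thesis unfolding overlap_eq[abs_def] by simp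
qed

text \<open>
  The Fisher-type quantity of the finite-difference inequality, for the grid of step \<open>\<eta>\<close> and for the laws at the
  midpoints of the grid as test masses.
\<close>
definition difference_information :: "nat \<Rightarrow> real \<Rightarrow> nat \<Rightarrow> (nat \<Rightarrow> nat \<Rightarrow> real) \<Rightarrow> real" where
  "difference_information n \<eta> N A = (\<Sum>k<n.
     (if Suc k < n then overlap ((real k + 1 / 2) * \<eta>) ((real k + 1 / 2) * \<eta>) (real k * \<eta>) N A else 0)
     + (if 0 < k then overlap ((real k - 1 / 2) * \<eta>) ((real k - 1 / 2) * \<eta>) (real k * \<eta>) N A else 0)
     - 2 * (if 0 < k \<and> Suc k < n then overlap ((real k + 1 / 2) * \<eta>) ((real k - 1 / 2) * \<eta>) (real k * \<eta>) N A else 0))"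

text \<open>
  There are \<open>n - 1\<close> midpoints, each adjacent to two grid points, and \<open>n - 2\<close> interior grid points, each between two midpoints.
\<close>
definition limit_information :: "nat \<Rightarrow> real \<Rightarrow> real" where
  "limit_information n \<eta> = 2 * (real n - 1) * exp (information * \<eta>\<^sup>2 / 4) - 2 * (real n - 2) * exp (- (information * \<eta>\<^sup>2 / 4))"

lemma difference_information_tendsto:
  assumes n: "n \<ge> 2"
  shows "tendsto_in_prob G (difference_information n \<eta>) (limit_information n \<eta>)"
proof -
  define x where "x = information * \<eta>\<^sup>2 / 4"
  have ex: "((real k + 1 / 2) * \<eta> - real k * \<eta>) * ((real k + 1 / 2) * \<eta> - real k * \<eta>) * information = x"
    "((real k - 1 / 2) * \<eta> - real k * \<eta>) * ((real k - 1 / 2) * \<eta> - real k * \<eta>) * information = x"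
    "((real k + 1 / 2) * \<eta> - real k * \<eta>) * ((real k - 1 / 2) * \<eta> - real k * \<eta>) * information = - x" for k
    by (simp_all add: x_def algebra_simps power2_eq_square)
  have c0: "tendsto_in_prob G (\<lambda>N A. c) c" for c :: real by (rule tendsto_in_prob_const[OF tendsto_const])
  have ifT: "tendsto_in_prob G (\<lambda>N A. if P then X N A else 0) (if P then y else 0)"
    if "tendsto_in_prob G X y" for P X y using that c0 by (cases P) simp_all
  have "tendsto_in_prob G (\<lambda>N A. difference_information n \<eta> N A)
    (\<Sum>k<n. (if Suc k < n then exp x else 0) + (if 0 < k then exp x else 0) - 2 * (if 0 < k \<and> Suc k < n then exp (- x) else 0))"
    unfolding difference_information_def
  proof (rule tendsto_in_prob_sum)
    fix k
    show "tendsto_in_prob G (\<lambda>N A. (if Suc k < n then overlap ((real k + 1 / 2) * \<eta>) ((real k + 1 / 2) * \<eta>) (real k * \<eta>) N A else 0)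
     + (if 0 < k then overlap ((real k - 1 / 2) * \<eta>) ((real k - 1 / 2) * \<eta>) (real k * \<eta>) N A else 0)
     - 2 * (if 0 < k \<and> Suc k < n then overlap ((real k + 1 / 2) * \<eta>) ((real k - 1 / 2) * \<eta>) (real k * \<eta>) N A else 0))
     ((if Suc k < n then exp x else 0) + (if 0 < k then exp x else 0) - 2 * (if 0 < k \<and> Suc k < n then exp (- x) else 0))"
      by (rule tendsto_in_prob_diff[OF tendsto_in_prob_add[OF ifT ifT] tendsto_in_prob_mult[OF c0 ifT]])
         (use overlap_tendsto[of "(real k + 1 / 2) * \<eta>" "(real k + 1 / 2) * \<eta>" "real k * \<eta>"]
           overlap_tendsto[of "(real k - 1 / 2) * \<eta>" "(real k - 1 / 2) * \<eta>" "real k * \<eta>"]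
           overlap_tendsto[of "(real k + 1 / 2) * \<eta>" "(real k - 1 / 2) * \<eta>" "real k * \<eta>"] in \<open>simp_all only: ex\<close>)
  qed simp
  also have "(\<Sum>k<n. (if Suc k < n then exp x else 0) + (if 0 < k then exp x else 0) - 2 * (if 0 < k \<and> Suc k < n then exp (- x) else 0))
    = limit_information n \<eta>"
  proof -
    obtain m where m: "n = Suc (Suc m)" using n by (metis add_2_eq_Suc le_Suc_ex)
    have 1: "(\<Sum>k<n. if Suc k < n then exp x else 0) = (real n - 1) * exp x"
      unfolding m by (simp add: algebra_simps)
    have 2: "(\<Sum>k<n. if 0 < k then exp x else 0) = (real n - 1) * exp x"
      unfolding m sum.lessThan_Suc_shift by (simp add: algebra_simps)
    have 3: "(\<Sum>k<n. 2 * (if 0 < k \<and> Suc k < n then exp (- x) else 0)) = 2 * (real n - 2) * exp (- x)"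
      unfolding m sum.lessThan_Suc_shift[of _ "Suc m"] by (simp add: algebra_simps)
    show ?thesis
      unfolding sum_subtractf sum.distrib 1 2 3 by (simp add: limit_information_def x_def)
  qed
  finally show ?thesis .
qed

lemma limit_information_pos:
  assumes n: "n \<ge> 2"
  shows "limit_information n \<eta> > 0"
proof -
  define x where "x = information * \<eta>\<^sup>2 / 4"
  have x: "x \<ge> 0" using information_pos by (simp add: x_def)
  hence "exp (- x) \<le> exp x" by simp
  hence "2 * (real n - 2) * exp (- x) \<le> 2 * (real n - 2) * exp x" using n by (intro mult_left_mono) auto
  also have "\<dots> < 2 * (real n - 1) * exp x" by simp
  finally show ?thesis by (simp add: limit_information_def x_def)
qed

text \<open>
  On a fixed graph, the finite-difference inequality is applied with the Ising law at the midpoint between the grid points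
  \<open>k - 1\<close> and \<open>k\<close> as test mass \<open>V k\<close>; expanding the squares leaves overlaps.
\<close>
lemma average_cond_mse_ge:
  assumes N: "N \<ge> 1" and n: "n \<ge> 2"
  shows "((real n - 1) * \<eta>)\<^sup>2 / (real n * difference_information n \<eta> N A)
     \<le> (\<Sum>k<n. 1 / \<theta> N * cond_mse N (\<theta> N) A T (local_par N (real k * \<eta>))) / real n"
    and "\<eta> \<noteq> 0 \<Longrightarrow> difference_information n \<eta> N A > 0"
proof -
  have th: "\<theta> N > 0" using \<theta> N by auto
  define p where "p = (\<lambda>k \<sigma>. ising_prob N (\<theta> N) A (local_par N (real k * \<eta>)) \<sigma>)"
  define V where "V = (\<lambda>k \<sigma>. if 0 < k \<and> k < n then ising_prob N (\<theta> N) A (local_par N ((real k - 1 / 2) * \<eta>)) \<sigma> else 0)"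
  define R where "R = (\<Sum>k<n. \<Sum>\<sigma>\<in>spins N. p k \<sigma> * (T (\<sigma>, A) - local_par N (real k * \<eta>))\<^sup>2)"
  have pos: "ising_prob N (\<theta> N) A b \<sigma> > 0" if "\<sigma> \<in> spins N" for b \<sigma>
    using that partition_fun_pos[of N "\<theta> N" A b] by (simp add: ising_prob_def)
  have "(\<Sum>\<sigma>\<in>spins N. ising_prob N (\<theta> N) A b \<sigma>) = 1" for b
    using ising_expectation[of N "\<theta> N" A b "\<lambda>_. 1"] by simp
  hence "(\<eta> * sqrt (\<theta> N) * (real n - 1))\<^sup>2 \<le> R * (\<Sum>k<n. \<Sum>\<sigma>\<in>spins N. (V (Suc k) \<sigma> - V k \<sigma>)\<^sup>2 / p k \<sigma>)"
    unfolding R_def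
    by (intro van_Trees_finite_difference[where b = "\<lambda>k. local_par N (real k * \<eta>)"])
       (use n pos in \<open>auto simp: finite_spins p_def V_def local_par_def algebra_simps\<close>)
  also have "(\<Sum>k<n. \<Sum>\<sigma>\<in>spins N. (V (Suc k) \<sigma> - V k \<sigma>)\<^sup>2 / p k \<sigma>) = difference_information n \<eta> N A"
    unfolding difference_information_def
  proof (rule sum.cong[OF refl])
    fix k assume k: "k \<in> {..<n}"
    have "(\<Sum>\<sigma>\<in>spins N. (V (Suc k) \<sigma> - V k \<sigma>)\<^sup>2 / p k \<sigma>)
       = (\<Sum>\<sigma>\<in>spins N. V (Suc k) \<sigma> * V (Suc k) \<sigma> / p k \<sigma>) + (\<Sum>\<sigma>\<in>spins N. V k \<sigma> * V k \<sigma> / p k \<sigma>)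
         - 2 * (\<Sum>\<sigma>\<in>spins N. V (Suc k) \<sigma> * V k \<sigma> / p k \<sigma>)"
      unfolding sum_distrib_left sum.distrib[symmetric] sum_subtractf[symmetric]
    proof (rule sum.cong[OF refl])
      fix \<sigma>
      have "(V (Suc k) \<sigma> - V k \<sigma>)\<^sup>2 = V (Suc k) \<sigma> * V (Suc k) \<sigma> + V k \<sigma> * V k \<sigma> - 2 * (V (Suc k) \<sigma> * V k \<sigma>)"
        by algebra
      thus "(V (Suc k) \<sigma> - V k \<sigma>)\<^sup>2 / p k \<sigma> = V (Suc k) \<sigma> * V (Suc k) \<sigma> / p k \<sigma> + V k \<sigma> * V k \<sigma> / p k \<sigma>
          - 2 * (V (Suc k) \<sigma> * V k \<sigma> / p k \<sigma>)"
        by (simp add: add_divide_distrib diff_divide_distrib)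
    qed
    also have "(\<Sum>\<sigma>\<in>spins N. V (Suc k) \<sigma> * V (Suc k) \<sigma> / p k \<sigma>)
       = (if Suc k < n then overlap ((real k + 1 / 2) * \<eta>) ((real k + 1 / 2) * \<eta>) (real k * \<eta>) N A else 0)"
      by (simp add: V_def p_def overlap_def add.commute)
    also have "(\<Sum>\<sigma>\<in>spins N. V k \<sigma> * V k \<sigma> / p k \<sigma>)
       = (if 0 < k then overlap ((real k - 1 / 2) * \<eta>) ((real k - 1 / 2) * \<eta>) (real k * \<eta>) N A else 0)"
      using k by (simp add: V_def p_def overlap_def)
    also have "(\<Sum>\<sigma>\<in>spins N. V (Suc k) \<sigma> * V k \<sigma> / p k \<sigma>)
       = (if 0 < k \<and> Suc k < n then overlap ((real k + 1 / 2) * \<eta>) ((real k - 1 / 2) * \<eta>) (real k * \<eta>) N A else 0)"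
      using k by (simp add: V_def p_def overlap_def add.commute)
    finally show "(\<Sum>\<sigma>\<in>spins N. (V (Suc k) \<sigma> - V k \<sigma>)\<^sup>2 / p k \<sigma>)
      = (if Suc k < n then overlap ((real k + 1 / 2) * \<eta>) ((real k + 1 / 2) * \<eta>) (real k * \<eta>) N A else 0)
     + (if 0 < k then overlap ((real k - 1 / 2) * \<eta>) ((real k - 1 / 2) * \<eta>) (real k * \<eta>) N A else 0)
     - 2 * (if 0 < k \<and> Suc k < n then overlap ((real k + 1 / 2) * \<eta>) ((real k - 1 / 2) * \<eta>) (real k * \<eta>) N A else 0)" .
  qed
  finally have main: "(\<eta> * sqrt (\<theta> N) * (real n - 1))\<^sup>2 \<le> R * difference_information n \<eta> N A" .
  have R0: "R \<ge> 0" unfolding R_def p_def by (intro sum_nonneg mult_nonneg_nonneg) (auto intro: less_imp_le pos)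
  have Rc: "(\<Sum>k<n. 1 / \<theta> N * cond_mse N (\<theta> N) A T (local_par N (real k * \<eta>))) / real n = R / (\<theta> N * real n)"
    by (simp add: R_def cond_mse_def ising_expectation p_def sum_distrib_left[symmetric] sum_divide_distrib[symmetric])
  show pos: "difference_information n \<eta> N A > 0" if "\<eta> \<noteq> 0"
  proof -
    have "0 < (\<eta> * sqrt (\<theta> N) * (real n - 1))\<^sup>2" using that th n by simp
    with main have "0 < R * difference_information n \<eta> N A" by linarith
    thus ?thesis using R0 by (simp add: zero_less_mult_iff)
  qed
  show "((real n - 1) * \<eta>)\<^sup>2 / (real n * difference_information n \<eta> N A)
     \<le> (\<Sum>k<n. 1 / \<theta> N * cond_mse N (\<theta> N) A T (local_par N (real k * \<eta>))) / real n"
  proof (cases "\<eta> = 0")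
    case True
    thus ?thesis unfolding Rc using R0 th by simp
  next
    case False
    have "((real n - 1) * \<eta>)\<^sup>2 * \<theta> N \<le> R * difference_information n \<eta> N A"
      using main th by (simp add: power_mult_distrib mult_ac)
    thus ?thesis unfolding Rc using pos[OF False] th n by (simp add: field_simps)
  qed
qed

text \<open>
  The worst risk on the grid is at least the average risk, whose expectation over the graph is bounded below by
  \<open>average_cond_mse_ge\<close> on each graph.
\<close>
lemma grid_risk_ge:
  fixes est :: "nat \<Rightarrow> estimate"
  assumes n: "n \<ge> 2" and \<eta>: "\<eta> > 0" and e: "\<epsilon> > 0"
  shows "\<forall>\<^sub>F N in sequentially. ereal (((real n - 1) * \<eta>)\<^sup>2 / (real n * limit_information n \<eta>) - \<epsilon>)
     \<le> (SUP h\<in>(\<lambda>k. real k * \<eta>) ` {..<n}. ereal (1 / \<theta> N * mse N (\<theta> N) W (est N) (\<beta> + h * sqrt (\<theta> N))))"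
proof -
  let ?c = "((real n - 1) * \<eta>)\<^sup>2"
  define X where "X = (\<lambda>N A. max 0 (?c / (real n * difference_information n \<eta> N A)))"
  have lim: "tendsto_in_prob G X (max 0 (?c / (real n * limit_information n \<eta>)))"
    unfolding X_def
    by (intro tendsto_in_prob_max tendsto_in_prob_divide tendsto_in_prob_mult difference_information_tendsto[OF n] tendsto_in_prob_const tendsto_const)
       (use limit_information_pos[OF n, of \<eta>] n in auto)
  have "max 0 (?c / (real n * limit_information n \<eta>)) = ?c / (real n * limit_information n \<eta>)"
    using limit_information_pos[OF n, of \<eta>] by simp
  hence ev: "\<forall>\<^sub>F N in sequentially. measure_pmf.expectation (G N) (X N) \<ge> ?c / (real n * limit_information n \<eta>) - \<epsilon>"
    using expectation_ge_of_tendsto_in_prob[OF finite_set_graph_pmf _ lim e] by (simp add: X_def)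
  show ?thesis
    using ev eventually_ge_at_top[of 1]
  proof eventually_elim
    case (elim N)
    have th: "\<theta> N > 0" using \<theta> elim by auto
    define f where "f = (\<lambda>k. 1 / \<theta> N * mse N (\<theta> N) W (est N) (local_par N (real k * \<eta>)))"
    have "measure_pmf.expectation (G N) (X N)
       \<le> measure_pmf.expectation (G N) (\<lambda>A. (\<Sum>k<n. 1 / \<theta> N * cond_mse N (\<theta> N) A (est N) (local_par N (real k * \<eta>))) / real n)"
    proof (rule integral_mono)
      fix A
      have "?c / (real n * difference_information n \<eta> N A) \<ge> 0" using average_cond_mse_ge(2)[OF elim(2) n, of \<eta> A] \<eta> by simp
      thus "X N A \<le> (\<Sum>k<n. 1 / \<theta> N * cond_mse N (\<theta> N) A (est N) (local_par N (real k * \<eta>))) / real n"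
        using average_cond_mse_ge(1)[OF elim(2) n, of \<eta> A "est N"] by (simp add: X_def)
    qed simp_all
    also have "\<dots> = (\<Sum>k<n. f k) / real n"
      by (simp add: f_def mse_eq_expectation_cond_mse Bochner_Integration.integral_sum)
    finally have avg: "?c / (real n * limit_information n \<eta>) - \<epsilon> \<le> (\<Sum>k<n. f k) / real n" using elim by simp
    have "\<exists>k<n. ?c / (real n * limit_information n \<eta>) - \<epsilon> \<le> f k"
    proof (rule ccontr)
      assume "\<not> ?thesis"
      hence less: "f k < ?c / (real n * limit_information n \<eta>) - \<epsilon>" if "k < n" for k using that by (meson not_le)
      have "(\<Sum>k<n. f k) < (\<Sum>k<n. ?c / (real n * limit_information n \<eta>) - \<epsilon>)"
      proof (rule sum_strict_mono)
        have "0 \<in> {..<n}" using n by simp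
        thus "{..<n} \<noteq> {}" by blast
      qed (auto intro: less)
      hence "(\<Sum>k<n. f k) / real n < ?c / (real n * limit_information n \<eta>) - \<epsilon>"
        using n by (simp add: divide_less_eq mult.commute)
      with avg show False by simp
    qed
    then obtain k where k: "k < n" "?c / (real n * limit_information n \<eta>) - \<epsilon> \<le> f k" by blast
    show ?case
      by (rule SUP_upper2[of "real k * \<eta>"]) (use k in \<open>auto simp: f_def local_par_def\<close>)
  qed
qed

lemma limit_of_grid_bounds:
  "(\<lambda>n. ((real n - 1) * real n powr (- 1 / 4))\<^sup>2 / (real n * limit_information n (real n powr (- 1 / 4))) - 1 / real n)
    \<longlonglongrightarrow> 1 / information"
  using grid_bounds_tendsto[OF information_pos] unfolding limit_information_def by (simp only: inverse_eq_divide)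

lemma minimax_lower_bound:
  fixes est :: "nat \<Rightarrow> estimate"
  shows "(SUP I\<in>{I :: real set. finite I}. liminf (\<lambda>N. SUP h\<in>I. ereal (1 / \<theta> N * mse N (\<theta> N) W (est N) (\<beta> + h * sqrt (\<theta> N)))))
     \<ge> ereal (2 / graphon_integral W)"
    (is "?S \<ge> _")
proof -
  define L where "L = (\<lambda>n. ((real n - 1) * real n powr (- 1 / 4))\<^sup>2 / (real n * limit_information n (real n powr (- 1 / 4))) - 1 / real n)"
  have "(\<lambda>n. ereal (L n)) \<longlonglongrightarrow> ereal (1 / information)"
    using limit_of_grid_bounds unfolding L_def by simp
  moreover have "\<forall>\<^sub>F n in sequentially. ereal (L n) \<le> ?S"
    using eventually_ge_at_top[of 2]
  proof eventually_elim
    case (elim n)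
    let ?I = "(\<lambda>k. real k * real n powr (- 1 / 4)) ` {..<n}"
    have "ereal (L n) \<le> liminf (\<lambda>N. SUP h\<in>?I. ereal (1 / \<theta> N * mse N (\<theta> N) W (est N) (\<beta> + h * sqrt (\<theta> N))))"
      unfolding L_def by (rule Liminf_bounded[OF grid_risk_ge]) (use elim in auto)
    also have "\<dots> \<le> ?S" by (rule SUP_upper) simp
    finally show ?case .
  qed
  ultimately have "ereal (1 / information) \<le> ?S"
    by (rule tendsto_upperbound) simp
  thus ?thesis by (simp add: information_def)
qed

end

theorem theorem2p4:
  fixes W :: "real \<Rightarrow> real \<Rightarrow> real" and \<beta> :: real and \<theta> :: "nat \<Rightarrow> real"
  assumes "graphon W"
    and "case_prod W Riemann_integrable_on ({0..1} \<times> {0..1})"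
    and "(\<lambda>x. W x x) Riemann_integrable_on {0..1}"
    and "graphon_integral W > 0"
    and "0 < \<beta>" and "\<beta> < 1 / graphon_op_norm W"
    and "\<And>N. N \<ge> 1 \<Longrightarrow> 0 < \<theta> N \<and> \<theta> N < 1"
    and "\<exists>C>0. \<forall>\<^sub>F N in sequentially. real N powr (2 / 3) * \<theta> N \<ge> C"
    and "\<theta> \<longlonglongrightarrow> 0"
  shows "(\<forall>est :: nat \<Rightarrow> estimate.
            (SUP I\<in>{I :: real set. finite I}.
               liminf (\<lambda>N. SUP h\<in>I.
                 ereal (1 / \<theta> N * mse N (\<theta> N) W (est N) (\<beta> + h * sqrt (\<theta> N)))))
            \<ge> ereal (2 / graphon_integral W))
       \<and> (\<forall>I :: real set. finite I \<and> I \<noteq> {} \<longrightarrow>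
            tendsto_in_prob (\<lambda>N. graph_pmf N (\<theta> N) W)
              (\<lambda>N A. SUP h\<in>I.
                 1 / \<theta> N * cond_mse N (\<theta> N) A (tilde_beta N (\<theta> N)) (\<beta> + h * sqrt (\<theta> N)))
              (2 / graphon_integral W))"
proof -
  interpret high_temperature W \<beta> \<theta>
    by unfold_locales (use assms in auto)
  show ?thesis
    using minimax_lower_bound sup_scaled_cond_mse_tendsto by blast
qed

end
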